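(* Let $h,\tau>0$ and suppose that assumptions (B1)–(B5) and the well-posedness assumption (WP) listed in the context hold. Let $(E_h^0,H_h^0)\in ND_h\times DG_h$ be given and set $$(E_h^n,H_h^n):=S_{h,\tau}^n(E_h^{n-1},H_h^{n-1})\quad\forall n\in\mathbb N .$$ Write $$(E_h^m,H_h^m)=(E_h^*,H_h^* )+(0,H_{h,\infty})\in\mathcal W_h\oplus\mathcal N_h ,$$ with $(E_h^*,H_h^* )\in\mathcal W_h$ and $(0,H_{h,\infty})\in\mathcal N_h$. Then there exists a constant $c_{h,\tau}>0$ such that $$\mathcal E_h^n(E_h^n,H_h^n)\le\mathcal E_h^m(0,H_{h,\infty})+e^{-c_{h,\tau}(t_n-t_m)}\,\mathcal E_h^m(E_h^*,H_h^* )\quad\forall n\ge m+1 .$$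
   Context: **Domain and finite elements.** $\Omega\subset\mathbb R^3$ is a bounded Lipschitz polyhedral domain with outer unit normal $\nu$; $H(\mathrm{curl})=\{u\in L^2(\Omega)^3:\mathrm{curl}\,u\in L^2(\Omega)^3\}$; $\mathcal T_h$ is a (tetrahedral) triangulation of $\Omega$ from a quasi-uniform family. $ND_h=\{v_h\in H(\mathrm{curl}): v_h|_K(x)=a_K+b_K\times x,\ a_K,b_K\in\mathbb R^3,\ \forall K\in\mathcal T_h\}$, $DG_h=\{w_h\in L^2(\Omega)^3:w_h|_K\equiv a_K\in\mathbb R^3\ \forall K\in\mathcal T_h\}$. $Q_h$ is the $L^2$-orthogonal projection onto $DG_h$ (elementwise mean value), also applied componentwise to matrix-valued functions. $\mathbb N=\{1,2,\dots\}$, $\mathbb N_0=\mathbb N\cup\{0\}$, $t_n=n\tau$ for $n\in\mathbb N_0$. **Assumptions.** (B1) $\varepsilon\in W^{2,\infty}_{\rm loc}(0,\infty;L^\infty_{\rm sym}(\Omega)^{3\times3})\cap W^{1,\infty}(0,\infty;L^\infty_{\rm sym}(\Omega)^{3\times3})$ and $\mu\in W^{2,\infty}(0,\infty;L^\infty_{\rm sym}(\Omega)^{3\times3})$ (symmetric matrix-valued); $\mu(t)=\mu_\infty$ for all $t\ge T_\mu$, for some $T_\mu\ge0$ and a uniformly positive definite $\mu_\infty\in L^\infty_{\rm sym}(\Omega)^{3\times3}$. There are $\underline\varepsilon,\overline\varepsilon,\underline\mu,\overline\mu>0$ with $\underline\varepsilon|\xi|^2\le\xi^T\varepsilon(x,t)\xi\le\overline\varepsilon|\xi|^2$,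 $\underline\mu|\xi|^2\le\xi^T\mu(x,t)\xi\le\overline\mu|\xi|^2$ for a.e. $x\in\Omega$, all $\xi\in\mathbb R^3$, $t\in[0,\infty)$. (B2) $J_{tot}:\Omega\times\mathbb R^3\times\mathbb R^3\times[0,\infty)\to\mathbb R^3$ is measurable in the first variable, $J_{tot}(\cdot,0,0,0)\in L^2(\Omega)^3$, and there is $L_{tot}>0$ with $|J_{tot}(x,\xi,\eta,t)-J_{tot}(x,\xi',\eta',t')|\le L_{tot}(|\xi-\xi'|+|\eta-\eta'|+(1+|\xi|+|\xi'|+|\eta|+|\eta'|)|t-t'|)$ for a.e. $x$ and all $\xi,\xi',\eta,\eta'\in\mathbb R^3$, $t,t'\in[0,\infty)$. There is $T_J\ge0$ such that for all $t\ge T_J$, $\lambda\ge0$: $J_{tot}(x,\lambda\xi,\eta,t)=\lambda J_{tot}(x,\xi,\eta,t)$ and $J_{tot}(x,\xi,\eta,t)=J_{tot}(x,\xi,\eta',t)$ for a.e. $x\in\Omega$ and all $\xi,\eta,\eta'\in\mathbb R^3$. (B3) $b:\partial\Omega\times\mathbb R^3\to\mathbb R^3$ is measurable in the first variable, continuous and monotone in the second, $b(\cdot,0)=0$; there are $\underline b,\overline b,K>0$ with $b(x,\xi)\cdot\xi\ge\underline b|\xi|^2$ for a.e. $x\in\partial\Omega$ and all $|\xi|\ge K$, and $|b(x,\xi)|\le\overline b(|\xi|+1)$ for a.e. $x$ and all $\xi$; and $b(x,\lambda\xi)=\lambda b(x,\xi)$ for a.e. $x\in\partial\Omega$, all $\xi\in\mathbb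 R^3$, $\lambda\ge0$. (B4) $f\in H^1(0,\infty;L^2(\Omega)^3)$ and there is $T_f\ge0$ with $f(t)=0$ for all $t\ge T_f$. Put $J(x,\xi,\eta,t)=J_{tot}(x,\xi,\eta,t)+\partial_t\varepsilon(x,t)\xi$; for $t\ge T_J$ this does not depend on $\eta$ and one writes $J(x,\xi,t)$. (B5) There is $\gamma>0$ such that for all $v_h,\hat v_h\in ND_h$ and all $n\in\mathbb N$ with $t_n\ge T_J$: $$\tfrac12(\varepsilon(t_n)(v_h-\hat v_h),v_h-\hat v_h)_{L^2(\Omega)}+\tau(J(\cdot,v_h,t_n),v_h)_{L^2(\Omega)}-\tfrac12((\varepsilon(t_n)-\varepsilon(t_{n-1}))\hat v_h,\hat v_h)_{L^2(\Omega)}\ge\gamma\|v_h\|_{L^2(\Omega)}^2 .$$ **Solution operator.** Let $\mu_h^n=Q_h\mu(t_n)$, $\mu_{t,h}^n=Q_h\partial_t\mu(t_n)$, $f_h^n=Q_hf(t_n)$. For $n\in\mathbb N$ and $(v,w)\in ND_h\times DG_h$ consider: find $(E^{v,w},H^{v,w})\in ND_h\times DG_h$ with $$\int_\Omega\varepsilon(t_n)\tfrac{E^{v,w}-v}{\tau}\cdot v_h-H^{v,w}\cdot\mathrm{curl}\,v_h+J(\cdot,E^{v,w},H^{v,w},t_n)\cdot v_h\,dx+\int_{\partial\Omega}b(\cdot,\nu\times E^{v,w})\cdot(\nu\times v_h)\,dS=\int_\Omega f_h^n\cdot v_h\,dx\ \ \forall v_h\in ND_h,$$ $$\mu_h^n\tfrac{H^{v,w}-w}{\tau}+\mathrm{curl}\,E^{v,w}+\mu_{t,h}^nH^{v,w}=0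 .$$ (WP) For every $n\in\mathbb N$ this problem has a unique solution for every $(v,w)$, so that $S_{h,\tau}^n:ND_h\times DG_h\to ND_h\times DG_h$, $(v,w)\mapsto(E^{v,w},H^{v,w})$, is well-defined. **Energy and spaces.** $\mathcal E_h^n(v,w)=\tfrac12\big((\varepsilon(t_n)v,v)_{L^2(\Omega)}+(\mu_h^nw,w)_{L^2(\Omega)}\big)$ for $n\in\mathbb N_0$. With $\mu_{h,\infty}=Q_h\mu_\infty$: $\mathcal W_h=ND_h\times\mu_{h,\infty}^{-1}\mathrm{curl}\,ND_h$ and $\mathcal N_h=\{0\}\times\{w_h\in DG_h:(w_h,\mathrm{curl}\,v_h)_{L^2(\Omega)}=0\ \forall v_h\in ND_h\}$, the orthogonal complement of $\mathcal W_h$ in $ND_h\times DG_h$ with respect to the inner product of $L^2(\Omega)^3\times L^2_{\mu_{h,\infty}}(\Omega)^3$, where $(u,w)_{L^2_{\mu_{h,\infty}}(\Omega)}=(\mu_{h,\infty}u,w)_{L^2(\Omega)}$; hence $ND_h\times DG_h=\mathcal W_h\oplus\mathcal N_h$. Finally $m=\min\{n\in\mathbb N_0:t_n\ge\max\{T_J,T_f,T_\mu\}\}$. *)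

theory Defs
  imports "HOL-Analysis.Analysis"
begin

type_synonym vec3 = "real^3"
type_synonym mat3 = "real^3^3"
type_synonym field3 = "real^3 \<Rightarrow> real^3"


section \<open>Domain and meshes\<close>

text \<open>Near every boundary point the domain lies strictly below the graph of a Lipschitz function
  \<open>\<phi>\<close> over the plane orthogonal to a unit vector \<open>e\<close>; \<open>\<phi>\<close> is evaluated at the projection of a
  point to that plane.\<close>

definition lipschitz_domain :: "vec3 set \<Rightarrow> bool" where
  "lipschitz_domain \<Omega> \<longleftrightarrow> open \<Omega> \<and> connected \<Omega> \<and> \<Omega> \<noteq> {} \<and>
     (\<forall>x\<in>frontier \<Omega>. \<exists>e r L \<phi>. norm e = 1 \<and> r > 0 \<and> lipschitz_on L UNIV \<phi> \<and>
        \<Omega> \<inter> ball x r = {y \<in> ball x r. y \<bullet> e < (\<phi> :: vec3 \<Rightarrow> real) (y - (y \<bullet> e) *\<^sub>R e)})"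

definition polyhedral_boundary :: "vec3 set \<Rightarrow> bool" where
  "polyhedral_boundary \<Omega> \<longleftrightarrow>
     (\<exists>\<F>. finite \<F> \<and> (\<forall>F\<in>\<F>. polytope F \<and> aff_dim F = 2) \<and> frontier \<Omega> = \<Union>\<F>)"

definition bounded_lipschitz_polyhedral_domain :: "vec3 set \<Rightarrow> bool" where
  "bounded_lipschitz_polyhedral_domain \<Omega> \<longleftrightarrow>
     bounded \<Omega> \<and> lipschitz_domain \<Omega> \<and> polyhedral_boundary \<Omega>"

definition tetrahedral_mesh :: "vec3 set \<Rightarrow> vec3 set set \<Rightarrow> bool" where
  "tetrahedral_mesh \<Omega> \<T> \<longleftrightarrow>
     triangulation \<T> \<and> (\<forall>K\<in>\<T>. 3 simplex K) \<and> \<Union>\<T> = closure \<Omega>"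

text \<open>The meshes are indexed by mesh parameters \<open>h \<in> I\<close>. Every cell has diameter at most \<open>h\<close>
  and contains a ball of radius \<open>\<sigma> h\<close>, with \<open>\<sigma>\<close> uniform over the family.\<close>

definition quasi_uniform_family :: "vec3 set \<Rightarrow> real set \<Rightarrow> (real \<Rightarrow> vec3 set set) \<Rightarrow> bool" where
  "quasi_uniform_family \<Omega> I \<T> \<longleftrightarrow> I \<subseteq> {0<..} \<and> (\<forall>h\<in>I. tetrahedral_mesh \<Omega> (\<T> h)) \<and>
     (\<exists>\<sigma>>0. \<forall>h\<in>I. \<forall>K\<in>\<T> h. diameter K \<le> h \<and> (\<exists>x. cball x (\<sigma> * h) \<subseteq> K))"


section \<open>Lebesgue spaces and the weak curl\<close>

definition L2 :: "vec3 set \<Rightarrow> (vec3 \<Rightarrow> 'b::euclidean_space) set" where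
  "L2 \<Omega> = {u. u \<in> borel_measurable (lebesgue_on \<Omega>) \<and>
              integrable (lebesgue_on \<Omega>) (\<lambda>x. (norm (u x))\<^sup>2)}"

definition L2_inner :: "vec3 set \<Rightarrow> (vec3 \<Rightarrow> 'b::euclidean_space) \<Rightarrow> (vec3 \<Rightarrow> 'b) \<Rightarrow> real" where
  "L2_inner \<Omega> u w = (LINT x|lebesgue_on \<Omega>. u x \<bullet> w x)"

definition L2_norm :: "vec3 set \<Rightarrow> (vec3 \<Rightarrow> 'b::euclidean_space) \<Rightarrow> real" where
  "L2_norm \<Omega> u = sqrt (L2_inner \<Omega> u u)"

definition Linf_norm :: "vec3 set \<Rightarrow> (vec3 \<Rightarrow> 'b::euclidean_space) \<Rightarrow> real" where
  "Linf_norm \<Omega> u = Inf {C. 0 \<le> C \<and> (AE x in lebesgue_on \<Omega>. norm (u x) \<le> C)}"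

definition Linf_sym :: "vec3 set \<Rightarrow> (vec3 \<Rightarrow> mat3) set" where
  "Linf_sym \<Omega> = {A. A \<in> borel_measurable (lebesgue_on \<Omega>) \<and>
     (\<exists>C. AE x in lebesgue_on \<Omega>. norm (A x) \<le> C) \<and>
     (AE x in lebesgue_on \<Omega>. transpose (A x) = A x)}"

text \<open>\<open>Ck k f\<close> says that \<open>f\<close> is \<open>k\<close> times continuously differentiable on the whole space.\<close>

primrec Ck :: "nat \<Rightarrow> ('a::euclidean_space \<Rightarrow> 'b::euclidean_space) \<Rightarrow> bool" where
  "Ck 0 f = continuous_on UNIV f"
| "Ck (Suc k) f = (\<exists>f'. (\<forall>x. (f has_derivative f' x) (at x)) \<and> (\<forall>d. Ck k (\<lambda>x. f' x d)))"

definition test_functions :: "'a set \<Rightarrow> ('a::euclidean_space \<Rightarrow> 'b::euclidean_space) set" where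
  "test_functions U = {\<phi>. (\<forall>k. Ck k \<phi>) \<and> compact (closure {x. \<phi> x \<noteq> 0}) \<and>
                          closure {x. \<phi> x \<noteq> 0} \<subseteq> U}"

definition classical_curl :: "field3 \<Rightarrow> field3" where
  "classical_curl \<phi> x =
     (let D = (\<lambda>i j. frechet_derivative \<phi> (at x) (axis i 1) $ j)
      in vector [D 2 3 - D 3 2, D 3 1 - D 1 3, D 1 2 - D 2 1])"

text \<open>\<open>c\<close> is a representative of the weak curl of \<open>u\<close>, which is unique up to null sets.\<close>

definition has_weak_curl :: "vec3 set \<Rightarrow> field3 \<Rightarrow> field3 \<Rightarrow> bool" where
  "has_weak_curl \<Omega> u c \<longleftrightarrow> u \<in> L2 \<Omega> \<and> c \<in> L2 \<Omega> \<and>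
     (\<forall>\<phi>\<in>test_functions \<Omega>. L2_inner \<Omega> u (classical_curl \<phi>) = L2_inner \<Omega> c \<phi>)"

definition H_curl :: "vec3 set \<Rightarrow> field3 set" where
  "H_curl \<Omega> = {u. \<exists>c. has_weak_curl \<Omega> u c}"


section \<open>Finite element spaces\<close>

text \<open>A finite element function is determined almost everywhere by its values in the open cells. As
  the representative of its class we take the one that vanishes off the open cells, so that equality
  of finite element functions is equality of functions.\<close>

definition cells :: "vec3 set set \<Rightarrow> vec3 set" where
  "cells \<T> = (\<Union>K\<in>\<T>. interior K)"

definition ND :: "vec3 set \<Rightarrow> vec3 set set \<Rightarrow> field3 set" where
  "ND \<Omega> \<T> = {v \<in> H_curl \<Omega>. (\<forall>K\<in>\<T>. \<exists>a b. \<forall>x\<in>interior K. v x = a + cross3 b x) \<and>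
                            (\<forall>x. x \<notin> cells \<T> \<longrightarrow> v x = 0)}"

definition DG :: "vec3 set \<Rightarrow> vec3 set set \<Rightarrow> field3 set" where
  "DG \<Omega> \<T> = {w \<in> L2 \<Omega>. (\<forall>K\<in>\<T>. \<exists>a. \<forall>x\<in>interior K. w x = a) \<and>
                        (\<forall>x. x \<notin> cells \<T> \<longrightarrow> w x = 0)}"

text \<open>The orthogonal projection to the piecewise constants, that is, the elementwise mean value
  (see \<open>Qh_in_DG\<close> and \<open>Qh_orthogonal\<close> below). For matrix-valued functions the integral is taken entry
  by entry. The open cells of a mesh are disjoint, so at most one summand is nonzero.\<close>

definition Qh :: "vec3 set set \<Rightarrow> (vec3 \<Rightarrow> 'b::euclidean_space) \<Rightarrow> vec3 \<Rightarrow> 'b" where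
  "Qh \<T> u x = (\<Sum>K\<in>\<T>. indicator (interior K) x *\<^sub>R
                 ((1 / measure lebesgue K) *\<^sub>R (LINT y|lebesgue_on (interior K). u y)))"


lemma negligible_frontier_domain:
  assumes "bounded_lipschitz_polyhedral_domain \<Omega>"
  shows "negligible (frontier \<Omega>)"
proof -
  obtain \<F> where F: "finite \<F>" "\<And>F. F \<in> \<F> \<Longrightarrow> polytope F \<and> aff_dim F = 2" "frontier \<Omega> = \<Union>\<F>"
    using assms unfolding bounded_lipschitz_polyhedral_domain_def polyhedral_boundary_def by blast
  have "negligible F" if "F \<in> \<F>" for F
  proof -
    have "interior F = {}"
      using F(2)[OF that] aff_dim_nonempty_interior[of F] by force
    moreover have "closure F = F" using F(2)[OF that] by (simp add: polytope_imp_closed)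
    ultimately have "frontier F = F" unfolding frontier_def by simp
    then show ?thesis using negligible_convex_frontier[of F] F(2)[OF that] by (simp add: polytope_imp_convex)
  qed
  then show ?thesis using F by (simp add: negligible_Union)
qed

lemma mesh_interiors_disjoint:
  assumes "tetrahedral_mesh \<Omega> \<T>" "K \<in> \<T>" "K' \<in> \<T>" "K \<noteq> K'"
  shows "interior K \<inter> interior K' = {}"
proof -
  have f: "K \<inter> K' face_of K" "K' \<inter> K face_of K'"
    using assms unfolding tetrahedral_mesh_def triangulation_def by auto
  have "K \<inter> K' \<noteq> K \<or> K' \<inter> K \<noteq> K'" using assms(4) by blast
  then have "K \<inter> K' \<inter> interior K = {} \<or> K' \<inter> K \<inter> interior K' = {}"
    using f face_of_disjoint_interior by blast
  then show ?thesis using interior_subset by blast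
qed

lemma bounded_L2_domain:
  assumes "bounded \<Omega>" "open \<Omega>" "w \<in> borel_measurable (lebesgue_on \<Omega>)" "\<And>x. norm (w x) \<le> C"
  shows "w \<in> L2 \<Omega>"
proof -
  have fm: "finite_measure (lebesgue_on \<Omega>)"
    using assms by (intro finite_measure_lebesgue_on) (auto simp: lmeasurable_open)
  have "(\<lambda>x. (norm (w x))\<^sup>2) \<in> borel_measurable (lebesgue_on \<Omega>)" using assms by measurable
  moreover have "(norm (w x))\<^sup>2 \<le> C\<^sup>2" for x using assms(4)[of x] by (simp add: power_mono)
  ultimately show ?thesis unfolding L2_def using assms(3)
    by (auto intro!: finite_measure.integrable_const_bound[OF fm, where B="C\<^sup>2"])
qed

lemma Qh_cell:
  assumes "tetrahedral_mesh \<Omega> \<T>" "K \<in> \<T>" "x \<in> interior K"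
  shows "Qh \<T> u x = (1 / measure lebesgue K) *\<^sub>R (LINT y|lebesgue_on (interior K). u y)"
proof -
  have fin: "finite \<T>" using assms unfolding tetrahedral_mesh_def triangulation_def by auto
  have "indicator (interior K') x = (0::real)" if "K' \<in> \<T> - {K}" for K'
    using mesh_interiors_disjoint[OF assms(1,2), of K'] that assms(3) by (auto simp: indicator_def)
  then show ?thesis unfolding Qh_def
    using assms fin by (simp add: sum.remove[of _ K])
qed

lemma Qh_in_DG:
  assumes "bounded_lipschitz_polyhedral_domain \<Omega>" "tetrahedral_mesh \<Omega> \<T>"
  shows "Qh \<T> u \<in> DG \<Omega> \<T>"
proof -
  have fin: "finite \<T>" using assms unfolding tetrahedral_mesh_def triangulation_def by auto
  have o: "bounded \<Omega>" "open \<Omega>" using assms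
    unfolding bounded_lipschitz_polyhedral_domain_def lipschitz_domain_def by auto
  have [measurable]: "(indicator (interior K) :: vec3 \<Rightarrow> real) \<in> borel_measurable (lebesgue_on \<Omega>)" for K
    by (intro measurable_restrict_space1 borel_measurable_indicator) auto
  have m: "Qh \<T> u \<in> borel_measurable (lebesgue_on \<Omega>)" unfolding Qh_def[abs_def] by measurable
  have "Qh \<T> u \<in> L2 \<Omega>"
  proof (rule bounded_L2_domain[OF o m])
    show "norm (Qh \<T> u x) \<le> (\<Sum>K\<in>\<T>. norm ((1 / measure lebesgue K) *\<^sub>R (LINT y|lebesgue_on (interior K). u y)))" for x
      unfolding Qh_def by (rule sum_norm_le) (auto simp: indicator_def)
  qed
  moreover have "Qh \<T> u x = 0" if "x \<notin> cells \<T>" for x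
    unfolding Qh_def by (rule sum.neutral) (use that in \<open>auto simp: cells_def indicator_def\<close>)
  moreover have "\<exists>a. \<forall>x\<in>interior K. Qh \<T> u x = a" if "K \<in> \<T>" for K
    using Qh_cell[OF assms(2) that, of _ u] by blast
  ultimately show ?thesis unfolding DG_def by blast
qed

lemma Qh_orthogonal:
  assumes dom: "bounded_lipschitz_polyhedral_domain \<Omega>" and mesh: "tetrahedral_mesh \<Omega> \<T>"
    and u: "u \<in> L2 \<Omega>" and z: "z \<in> DG \<Omega> \<T>"
  shows "L2_inner \<Omega> (\<lambda>x. u x - Qh \<T> u x) z = 0"
proof -
  have fin: "finite \<T>" using mesh unfolding tetrahedral_mesh_def triangulation_def by auto
  have o: "bounded \<Omega>" "open \<Omega>" using dom
    unfolding bounded_lipschitz_polyhedral_domain_def lipschitz_domain_def by auto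
  interpret finite_measure "lebesgue_on \<Omega>"
    using o by (intro finite_measure_lebesgue_on) (auto simp: lmeasurable_open)
  have um: "u \<in> borel_measurable (lebesgue_on \<Omega>)" and u2: "integrable (lebesgue_on \<Omega>) (\<lambda>x. (norm (u x))\<^sup>2)"
    using u unfolding L2_def by auto
  have ui: "integrable (lebesgue_on \<Omega>) u"
  proof (rule Bochner_Integration.integrable_bound[OF _ um])
    show "integrable (lebesgue_on \<Omega>) (\<lambda>x. 1 + (norm (u x))\<^sup>2)" using u2 by simp
    have "norm (u x) \<le> 1 + (norm (u x))\<^sup>2" for x
      using zero_le_power2[of "norm (u x) - 1"] zero_le_power2[of "norm (u x)"] 
      by (simp add: power2_eq_square algebra_simps)  (smt (verit, best) norm_ge_zero)
    then show "AE x in lebesgue_on \<Omega>. norm (u x) \<le> norm (1 + (norm (u x))\<^sup>2)"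
      by (smt (verit) AE_I2 real_norm_def)
  qed
  obtain a where a: "\<And>K x. K \<in> \<T> \<Longrightarrow> x \<in> interior K \<Longrightarrow> z x = a K"
    using z unfolding DG_def by (auto) metis
  have z0: "z x = 0" if "x \<notin> cells \<T>" for x using z that unfolding DG_def by auto
  define m where "m K = (1 / measure lebesgue K) *\<^sub>R (LINT y|lebesgue_on (interior K). u y)" for K
  have cell: "(u x - Qh \<T> u x) \<bullet> z x = (\<Sum>K\<in>\<T>. (indicator (interior K) x *\<^sub>R (u x - m K)) \<bullet> a K)" for x
  proof (cases "x \<in> cells \<T>")
    case True
    then obtain K where K: "K \<in> \<T>" "x \<in> interior K" unfolding cells_def by auto
    have "indicator (interior K') x = (0::real)" if "K' \<in> \<T> - {K}" for K'
      using mesh_interiors_disjoint[OF mesh K(1), of K'] that K(2) by (auto simp: indicator_def)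
    then have "(\<Sum>K'\<in>\<T> - {K}. (indicator (interior K') x *\<^sub>R (u x - m K')) \<bullet> a K') = 0"
      by (intro sum.neutral) simp
    then have "(\<Sum>K\<in>\<T>. (indicator (interior K) x *\<^sub>R (u x - m K)) \<bullet> a K) = (u x - m K) \<bullet> a K"
      using K by (subst sum.remove[OF fin K(1)]) simp
    then show ?thesis using a[OF K] Qh_cell[OF mesh K, of u] unfolding m_def by simp
  next
    case False
    then show ?thesis using z0[OF False] by (auto simp: cells_def indicator_def)
  qed
  have cellint: "integrable (lebesgue_on \<Omega>) (\<lambda>x. indicator (interior K) x *\<^sub>R (u x - m K))
      \<and> (LINT x|lebesgue_on \<Omega>. indicator (interior K) x *\<^sub>R (u x - m K)) = 0" if K: "K \<in> \<T>" for K
  proof -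
    have "interior K \<subseteq> \<Omega> \<union> frontier \<Omega>"
    proof -
      have "K \<subseteq> closure \<Omega>" using mesh K unfolding tetrahedral_mesh_def by auto
      then show ?thesis using closure_Un_frontier[of \<Omega>] interior_subset[of K] by blast
    qed
    then have ae: "AE x in lebesgue. indicator \<Omega> x *\<^sub>R (indicator (interior K) x *\<^sub>R v x)
          = indicator (interior K) x *\<^sub>R (v x :: vec3)" for v
      using negligible_frontier_domain[OF dom]
      by (intro AE_I'[of "frontier \<Omega>"]) (auto simp: negligible_iff_null_sets indicator_def)
    have iK[measurable]: "interior K \<in> sets lebesgue" by auto
    have meas: "measure lebesgue (interior K) = measure lebesgue K"
    proof -
      have c: "convex K" "compact K" using mesh K unfolding tetrahedral_mesh_def by (auto intro: convex_simplex compact_simplex)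
      show ?thesis using measure_interior[OF _ negligible_convex_frontier[OF c(1)]] c compact_imp_bounded by auto
    qed
    have pos: "measure lebesgue K > 0" if "interior K \<noteq> {}"
    proof -
      have "bounded K" using mesh K unfolding tetrahedral_mesh_def by (auto intro: compact_simplex compact_imp_bounded)
      then have "interior K \<in> lmeasurable" by (simp add: bounded_interior lmeasurable_open)
      moreover have "\<not> negligible (interior K)" using open_not_negligible that by auto
      ultimately show ?thesis using meas
        by (metis negligible_iff_measure0 measure_nonneg order_le_less)
    qed
    have O: "\<Omega> \<in> sets lebesgue" using o by auto
    have i1: "integrable (lebesgue_on \<Omega>) (\<lambda>x. indicator (interior K) x *\<^sub>R u x)"
    proof (rule Bochner_Integration.integrable_bound[OF ui])
      have "(indicator (interior K) :: vec3 \<Rightarrow> real) \<in> borel_measurable (lebesgue_on \<Omega>)"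
        by (intro measurable_restrict_space1 borel_measurable_indicator) auto
      then show "(\<lambda>x. indicator (interior K) x *\<^sub>R u x) \<in> borel_measurable (lebesgue_on \<Omega>)" using um by measurable
    qed (auto simp: indicator_def)
    have i2: "integrable (lebesgue_on \<Omega>) (\<lambda>x. indicator (interior K) x *\<^sub>R m K)"
    proof (rule integrable_const_bound[where B="norm (m K)"])
      have "(indicator (interior K) :: vec3 \<Rightarrow> real) \<in> borel_measurable (lebesgue_on \<Omega>)"
        by (intro measurable_restrict_space1 borel_measurable_indicator) auto
      then show "(\<lambda>x. indicator (interior K) x *\<^sub>R m K) \<in> borel_measurable (lebesgue_on \<Omega>)" by measurable
    qed (auto simp: indicator_def)
    have transfer: "(LINT x|lebesgue_on \<Omega>. indicator (interior K) x *\<^sub>R v x) = (LINT x|lebesgue_on (interior K). v x)"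
      if "integrable (lebesgue_on \<Omega>) (\<lambda>x. indicator (interior K) x *\<^sub>R v x)" for v :: "vec3 \<Rightarrow> vec3"
    proof -
      have A: "(\<lambda>x. indicator \<Omega> x *\<^sub>R (indicator (interior K) x *\<^sub>R v x)) \<in> borel_measurable lebesgue"
        using that O by (auto simp: integrable_restrict_space dest: borel_measurable_integrable)
      have B: "(\<lambda>x. indicator (interior K) x *\<^sub>R v x) \<in> borel_measurable lebesgue"
        by (rule borel_measurable_AE[OF A ae])
      show ?thesis using integral_cong_AE[OF A B ae] O
        by (simp add: integral_restrict_space)
    qed
    have "(LINT x|lebesgue_on \<Omega>. indicator (interior K) x *\<^sub>R u x) - (LINT x|lebesgue_on \<Omega>. indicator (interior K) x *\<^sub>R m K) = 0"
      unfolding transfer[OF i1] transfer[OF i2]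
    proof (cases "interior K = {}")
      case True
      then show "(LINT x|lebesgue_on (interior K). u x) - (LINT x|lebesgue_on (interior K). m K) = 0"
        by (simp add: integral_restrict_space)
    next
      case False
      have "(LINT x|lebesgue_on (interior K). m K) = measure lebesgue K *\<^sub>R m K"
        using meas by (simp add: measure_restrict_space)
      then show "(LINT x|lebesgue_on (interior K). u x) - (LINT x|lebesgue_on (interior K). m K) = 0"
        using pos[OF False] unfolding m_def by simp
    qed
    then show ?thesis using i1 i2 by (simp add: scaleR_diff_right)
  qed
  have "L2_inner \<Omega> (\<lambda>x. u x - Qh \<T> u x) z =
      (LINT x|lebesgue_on \<Omega>. (\<Sum>K\<in>\<T>. (indicator (interior K) x *\<^sub>R (u x - m K)) \<bullet> a K))"
    unfolding L2_inner_def cell ..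
  also have "\<dots> = (\<Sum>K\<in>\<T>. LINT x|lebesgue_on \<Omega>. (indicator (interior K) x *\<^sub>R (u x - m K)) \<bullet> a K)"
    using cellint by (intro Bochner_Integration.integral_sum integrable_inner_left) auto
  also have "\<dots> = (\<Sum>K\<in>\<T>. (LINT x|lebesgue_on \<Omega>. (indicator (interior K) x *\<^sub>R (u x - m K))) \<bullet> a K)"
    using cellint by (intro sum.cong refl integral_inner_left) auto
  also have "\<dots> = 0" using cellint by simp
  finally show ?thesis .
qed


section \<open>Boundary integrals and traces\<close>

text \<open>The surface measure is the two-dimensional Hausdorff measure, normalised to agree with area.\<close>

definition hausdorff2 :: "vec3 set \<Rightarrow> ennreal" where
  "hausdorff2 A =
     (SUP \<delta>\<in>{0<..}. INF C\<in>{C :: nat \<Rightarrow> vec3 set. A \<subseteq> (\<Union>i. C i) \<and>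
                                 (\<forall>i. bounded (C i) \<and> diameter (C i) \<le> (\<delta>::real))}.
        \<Sum>i. ennreal (pi / 4 * (diameter (C i))\<^sup>2))"

definition surface_measure :: "vec3 set \<Rightarrow> vec3 measure" where
  "surface_measure \<Omega> =
     restrict_space (completion (measure_of UNIV (sets borel) hausdorff2)) (frontier \<Omega>)"

text \<open>In the relative interior of a boundary face the domain is locally a half-space. The other
  boundary points, where the normal is set to \<open>0\<close>, form a null set.\<close>

definition is_outer_normal :: "vec3 set \<Rightarrow> vec3 \<Rightarrow> vec3 \<Rightarrow> bool" where
  "is_outer_normal \<Omega> x n \<longleftrightarrow> norm n = 1 \<and>
     (\<exists>r>0. \<Omega> \<inter> ball x r = {y \<in> ball x r. (y - x) \<bullet> n < 0})"

definition outer_normal :: "vec3 set \<Rightarrow> field3" where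
  "outer_normal \<Omega> x =
     (if \<exists>n. is_outer_normal \<Omega> x n then THE n. is_outer_normal \<Omega> x n else 0)"

text \<open>The trace is the limit from inside. For a finite element function the limit exists in the relative interior
  of every boundary face of a cell, hence almost everywhere on the boundary.\<close>

definition trace_on_boundary :: "vec3 set \<Rightarrow> field3 \<Rightarrow> field3" where
  "trace_on_boundary \<Omega> v x =
     (if \<exists>l. (v \<longlongrightarrow> l) (at x within \<Omega>) then Lim (at x within \<Omega>) v else 0)"

definition tangential_trace :: "vec3 set \<Rightarrow> field3 \<Rightarrow> field3" where
  "tangential_trace \<Omega> v x = cross3 (outer_normal \<Omega> x) (trace_on_boundary \<Omega> v x)"


section \<open>Spaces of time-dependent functions\<close>

text \<open>Functions of time take values in a space \<open>X\<close> of functions on \<open>\<Omega>\<close> (up to null sets) with norm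
  \<open>N\<close>; a time interval is denoted by \<open>I\<close>.\<close>

definition bochner_measurable ::
  "real set \<Rightarrow> (vec3 \<Rightarrow> 'b::euclidean_space) set \<Rightarrow> ((vec3 \<Rightarrow> 'b) \<Rightarrow> real) \<Rightarrow>
   (real \<Rightarrow> vec3 \<Rightarrow> 'b) \<Rightarrow> bool" where
  "bochner_measurable I X N u \<longleftrightarrow> (AE t in lebesgue_on I. u t \<in> X) \<and>
     (\<exists>s. (\<forall>n::nat. finite (s n ` I) \<and> s n ` I \<subseteq> X \<and>
                    (\<forall>y. {t\<in>I. s n t = y} \<in> sets lebesgue)) \<and>
          (AE t in lebesgue_on I. (\<lambda>n. N (\<lambda>x. s n t x - u t x)) \<longlonglongrightarrow> 0))"

definition bochner_Linf ::
  "real set \<Rightarrow> (vec3 \<Rightarrow> 'b::euclidean_space) set \<Rightarrow> ((vec3 \<Rightarrow> 'b) \<Rightarrow> real) \<Rightarrow>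
   (real \<Rightarrow> vec3 \<Rightarrow> 'b) \<Rightarrow> bool" where
  "bochner_Linf I X N u \<longleftrightarrow> bochner_measurable I X N u \<and>
     (\<exists>C. AE t in lebesgue_on I. N (u t) \<le> C)"

definition bochner_L2 ::
  "real set \<Rightarrow> (vec3 \<Rightarrow> 'b::euclidean_space) set \<Rightarrow> ((vec3 \<Rightarrow> 'b) \<Rightarrow> real) \<Rightarrow>
   (real \<Rightarrow> vec3 \<Rightarrow> 'b) \<Rightarrow> bool" where
  "bochner_L2 I X N u \<longleftrightarrow> bochner_measurable I X N u \<and>
     integrable (lebesgue_on I) (\<lambda>t. (N (u t))\<^sup>2)"

text \<open>The identity \<open>\<integral> \<psi>' u dt = - \<integral> \<psi> u' dt\<close> of Bochner integrals, paired with every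
  \<open>\<rho> \<in> L\<^sup>2\<close>. On a bounded domain these pairings are continuous on, and separate the points of, both
  \<open>L\<^sup>\<infinity>\<close> and \<open>L\<^sup>2\<close>.\<close>

definition weak_time_derivative ::
  "real set \<Rightarrow> vec3 set \<Rightarrow> (real \<Rightarrow> vec3 \<Rightarrow> 'b::euclidean_space) \<Rightarrow> (real \<Rightarrow> vec3 \<Rightarrow> 'b) \<Rightarrow> bool" where
  "weak_time_derivative I \<Omega> u u' \<longleftrightarrow>
     (\<forall>\<psi>\<in>test_functions I. \<forall>\<rho>\<in>L2 \<Omega>.
        (LINT t|lebesgue_on I. deriv \<psi> t * L2_inner \<Omega> (u t) \<rho>) =
        - (LINT t|lebesgue_on I. \<psi> t * L2_inner \<Omega> (u' t) \<rho>))"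

definition W1_Linf_sym ::
  "real set \<Rightarrow> vec3 set \<Rightarrow> (real \<Rightarrow> vec3 \<Rightarrow> mat3) \<Rightarrow> (real \<Rightarrow> vec3 \<Rightarrow> mat3) \<Rightarrow> bool" where
  "W1_Linf_sym I \<Omega> u u' \<longleftrightarrow>
     bochner_Linf I (Linf_sym \<Omega>) (Linf_norm \<Omega>) u \<and>
     bochner_Linf I (Linf_sym \<Omega>) (Linf_norm \<Omega>) u' \<and> weak_time_derivative I \<Omega> u u'"

definition H1_L2 ::
  "real set \<Rightarrow> vec3 set \<Rightarrow> (real \<Rightarrow> field3) \<Rightarrow> (real \<Rightarrow> field3) \<Rightarrow> bool" where
  "H1_L2 I \<Omega> u u' \<longleftrightarrow>
     bochner_L2 I (L2 \<Omega>) (L2_norm \<Omega>) u \<and>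
     bochner_L2 I (L2 \<Omega>) (L2_norm \<Omega>) u' \<and> weak_time_derivative I \<Omega> u u'"

definition time_continuous ::
  "real set \<Rightarrow> (vec3 \<Rightarrow> 'b::euclidean_space) set \<Rightarrow> ((vec3 \<Rightarrow> 'b) \<Rightarrow> real) \<Rightarrow>
   (real \<Rightarrow> vec3 \<Rightarrow> 'b) \<Rightarrow> bool" where
  "time_continuous I X N u \<longleftrightarrow>
     (\<forall>t\<in>I. u t \<in> X \<and> ((\<lambda>s. N (\<lambda>x. u s x - u t x)) \<longlongrightarrow> 0) (at t within I))"


section \<open>Assumptions on the data\<close>

definition uniform_bounds :: "vec3 set \<Rightarrow> (real \<Rightarrow> vec3 \<Rightarrow> mat3) \<Rightarrow> bool" where
  "uniform_bounds \<Omega> A \<longleftrightarrow> (\<exists>l>0. \<exists>u>0. \<forall>t\<ge>0. AE x in lebesgue_on \<Omega>. \<forall>\<xi>.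
     l * (norm \<xi>)\<^sup>2 \<le> \<xi> \<bullet> (A t x *v \<xi>) \<and> \<xi> \<bullet> (A t x *v \<xi>) \<le> u * (norm \<xi>)\<^sup>2)"

text \<open>Sobolev functions of time are evaluated at single times, which refers to their continuous
  representatives. Thus \<open>\<epsilon>\<close>, \<open>\<mu>\<close> and their time derivatives \<open>\<epsilon>t\<close>, \<open>\<mu>t\<close> are required to be the
  continuous representatives.\<close>

definition coefficient_assumption ::
  "vec3 set \<Rightarrow> (real \<Rightarrow> vec3 \<Rightarrow> mat3) \<Rightarrow> (real \<Rightarrow> vec3 \<Rightarrow> mat3) \<Rightarrow> (real \<Rightarrow> vec3 \<Rightarrow> mat3) \<Rightarrow>
   (real \<Rightarrow> vec3 \<Rightarrow> mat3) \<Rightarrow> (vec3 \<Rightarrow> mat3) \<Rightarrow> real \<Rightarrow> bool" where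
  "coefficient_assumption \<Omega> \<epsilon> \<epsilon>t \<mu> \<mu>t \<mu>inf T\<^sub>\<mu> \<longleftrightarrow>
     time_continuous {0..} (Linf_sym \<Omega>) (Linf_norm \<Omega>) \<epsilon> \<and>
     time_continuous {0<..} (Linf_sym \<Omega>) (Linf_norm \<Omega>) \<epsilon>t \<and>
     time_continuous {0..} (Linf_sym \<Omega>) (Linf_norm \<Omega>) \<mu> \<and>
     time_continuous {0<..} (Linf_sym \<Omega>) (Linf_norm \<Omega>) \<mu>t \<and>
     W1_Linf_sym {0<..} \<Omega> \<epsilon> \<epsilon>t \<and>
     (\<exists>\<epsilon>tt. \<forall>a b. 0 < a \<and> a < b \<longrightarrow> W1_Linf_sym {a<..<b} \<Omega> \<epsilon>t \<epsilon>tt) \<and>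
     W1_Linf_sym {0<..} \<Omega> \<mu> \<mu>t \<and>
     (\<exists>\<mu>tt. W1_Linf_sym {0<..} \<Omega> \<mu>t \<mu>tt) \<and>
     T\<^sub>\<mu> \<ge> 0 \<and> \<mu>inf \<in> Linf_sym \<Omega> \<and> uniform_bounds \<Omega> (\<lambda>t. \<mu>inf) \<and>
     (\<forall>t\<ge>T\<^sub>\<mu>. AE x in lebesgue_on \<Omega>. \<mu> t x = \<mu>inf x) \<and>
     uniform_bounds \<Omega> \<epsilon> \<and> uniform_bounds \<Omega> \<mu>"

definition current_assumption ::
  "vec3 set \<Rightarrow> (vec3 \<Rightarrow> vec3 \<Rightarrow> vec3 \<Rightarrow> real \<Rightarrow> vec3) \<Rightarrow> real \<Rightarrow> bool" where
  "current_assumption \<Omega> Jtot T\<^sub>J \<longleftrightarrow>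
     (\<forall>\<xi> \<eta>. \<forall>t\<ge>0. (\<lambda>x. Jtot x \<xi> \<eta> t) \<in> borel_measurable (lebesgue_on \<Omega>)) \<and>
     (\<lambda>x. Jtot x 0 0 0) \<in> L2 \<Omega> \<and>
     (\<exists>L>0. AE x in lebesgue_on \<Omega>. \<forall>\<xi> \<xi>' \<eta> \<eta>'. \<forall>t\<ge>0. \<forall>t'\<ge>0.
        norm (Jtot x \<xi> \<eta> t - Jtot x \<xi>' \<eta>' t') \<le>
          L * (norm (\<xi> - \<xi>') + norm (\<eta> - \<eta>') +
               (1 + norm \<xi> + norm \<xi>' + norm \<eta> + norm \<eta>') * \<bar>t - t'\<bar>)) \<and>
     T\<^sub>J \<ge> 0 \<and>
     (\<forall>t\<ge>T\<^sub>J. \<forall>s\<ge>0. AE x in lebesgue_on \<Omega>. \<forall>\<xi> \<eta> \<eta>'.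
        Jtot x (s *\<^sub>R \<xi>) \<eta> t = s *\<^sub>R Jtot x \<xi> \<eta> t \<and> Jtot x \<xi> \<eta> t = Jtot x \<xi> \<eta>' t)"

definition boundary_assumption :: "vec3 set \<Rightarrow> (vec3 \<Rightarrow> vec3 \<Rightarrow> vec3) \<Rightarrow> bool" where
  "boundary_assumption \<Omega> b \<longleftrightarrow>
     (\<forall>\<xi>. (\<lambda>x. b x \<xi>) \<in> borel_measurable (surface_measure \<Omega>)) \<and>
     (AE x in surface_measure \<Omega>. continuous_on UNIV (b x) \<and>
        (\<forall>\<xi> \<eta>. (b x \<xi> - b x \<eta>) \<bullet> (\<xi> - \<eta>) \<ge> 0) \<and> b x 0 = 0) \<and>
     (\<exists>bl>0. \<exists>bu>0. \<exists>R>0. AE x in surface_measure \<Omega>.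
        (\<forall>\<xi>. norm \<xi> \<ge> R \<longrightarrow> b x \<xi> \<bullet> \<xi> \<ge> bl * (norm \<xi>)\<^sup>2) \<and>
        (\<forall>\<xi>. norm (b x \<xi>) \<le> bu * (norm \<xi> + 1))) \<and>
     (AE x in surface_measure \<Omega>. \<forall>\<xi>. \<forall>s\<ge>0. b x (s *\<^sub>R \<xi>) = s *\<^sub>R b x \<xi>)"

definition source_assumption :: "vec3 set \<Rightarrow> (real \<Rightarrow> field3) \<Rightarrow> real \<Rightarrow> bool" where
  "source_assumption \<Omega> f T\<^sub>f \<longleftrightarrow>
     time_continuous {0..} (L2 \<Omega>) (L2_norm \<Omega>) f \<and> (\<exists>ft. H1_L2 {0<..} \<Omega> f ft) \<and>
     T\<^sub>f \<ge> 0 \<and> (\<forall>t\<ge>T\<^sub>f. AE x in lebesgue_on \<Omega>. f t x = 0)"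

definition current :: "(vec3 \<Rightarrow> vec3 \<Rightarrow> vec3 \<Rightarrow> real \<Rightarrow> vec3) \<Rightarrow> (real \<Rightarrow> vec3 \<Rightarrow> mat3) \<Rightarrow>
    vec3 \<Rightarrow> vec3 \<Rightarrow> vec3 \<Rightarrow> real \<Rightarrow> vec3" where
  "current Jtot \<epsilon>t x \<xi> \<eta> t = Jtot x \<xi> \<eta> t + \<epsilon>t t x *v \<xi>"

text \<open>For \<open>t \<ge> T\<^sub>J\<close> the current does not depend on its magnetic argument, which is set to \<open>0\<close>.\<close>

definition dissipation_assumption ::
  "vec3 set \<Rightarrow> vec3 set set \<Rightarrow> real \<Rightarrow> (real \<Rightarrow> vec3 \<Rightarrow> mat3) \<Rightarrow>
   (vec3 \<Rightarrow> vec3 \<Rightarrow> vec3 \<Rightarrow> real \<Rightarrow> vec3) \<Rightarrow> real \<Rightarrow> bool" where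
  "dissipation_assumption \<Omega> \<T> \<tau> \<epsilon> J T\<^sub>J \<longleftrightarrow>
     (\<exists>\<gamma>>0. \<forall>v\<in>ND \<Omega> \<T>. \<forall>v'\<in>ND \<Omega> \<T>. \<forall>n::nat. n \<ge> 1 \<and> real n * \<tau> \<ge> T\<^sub>J \<longrightarrow>
        1/2 * L2_inner \<Omega> (\<lambda>x. \<epsilon> (real n * \<tau>) x *v (v x - v' x)) (\<lambda>x. v x - v' x)
        + \<tau> * L2_inner \<Omega> (\<lambda>x. J x (v x) 0 (real n * \<tau>)) v
        - 1/2 * L2_inner \<Omega> (\<lambda>x. (\<epsilon> (real n * \<tau>) x - \<epsilon> (real (n - 1) * \<tau>) x) *v v' x) v'
        \<ge> \<gamma> * (L2_norm \<Omega> v)\<^sup>2)"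


section \<open>The fully discrete scheme\<close>

text \<open>Since the weak curl is unique up to null sets, quantifying over all representatives \<open>c\<close> of
  \<open>curl v\<^sub>h\<close> in the first equation, and over some representative of \<open>curl E\<close> in the second one, is
  immaterial.\<close>

definition is_step ::
  "vec3 set \<Rightarrow> vec3 set set \<Rightarrow> real \<Rightarrow> (real \<Rightarrow> vec3 \<Rightarrow> mat3) \<Rightarrow> (real \<Rightarrow> vec3 \<Rightarrow> mat3) \<Rightarrow>
   (real \<Rightarrow> vec3 \<Rightarrow> mat3) \<Rightarrow> (vec3 \<Rightarrow> vec3 \<Rightarrow> vec3 \<Rightarrow> real \<Rightarrow> vec3) \<Rightarrow> (vec3 \<Rightarrow> vec3 \<Rightarrow> vec3) \<Rightarrow>
   (real \<Rightarrow> field3) \<Rightarrow> nat \<Rightarrow> field3 \<times> field3 \<Rightarrow> field3 \<times> field3 \<Rightarrow> bool" where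
  "is_step \<Omega> \<T> \<tau> \<epsilon> \<mu> \<mu>t J b f n vw EH \<longleftrightarrow>
     (case (vw, EH) of ((v, w), (E, H)) \<Rightarrow>
       let t = real n * \<tau> in
       E \<in> ND \<Omega> \<T> \<and> H \<in> DG \<Omega> \<T> \<and>
       (\<forall>vh\<in>ND \<Omega> \<T>. \<forall>c. has_weak_curl \<Omega> vh c \<longrightarrow>
          (LINT x|lebesgue_on \<Omega>. (\<epsilon> t x *v ((1 / \<tau>) *\<^sub>R (E x - v x))) \<bullet> vh x - H x \<bullet> c x
                                  + J x (E x) (H x) t \<bullet> vh x)
          + (LINT x|surface_measure \<Omega>.
               b x (tangential_trace \<Omega> E x) \<bullet> tangential_trace \<Omega> vh x)
          = (LINT x|lebesgue_on \<Omega>. Qh \<T> (f t) x \<bullet> vh x)) \<and>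
       (\<exists>c. has_weak_curl \<Omega> E c \<and>
          (AE x in lebesgue_on \<Omega>.
             Qh \<T> (\<mu> t) x *v ((1 / \<tau>) *\<^sub>R (H x - w x)) + c x + Qh \<T> (\<mu>t t) x *v H x = 0)))"

definition well_posed ::
  "vec3 set \<Rightarrow> vec3 set set \<Rightarrow> real \<Rightarrow> (real \<Rightarrow> vec3 \<Rightarrow> mat3) \<Rightarrow> (real \<Rightarrow> vec3 \<Rightarrow> mat3) \<Rightarrow>
   (real \<Rightarrow> vec3 \<Rightarrow> mat3) \<Rightarrow> (vec3 \<Rightarrow> vec3 \<Rightarrow> vec3 \<Rightarrow> real \<Rightarrow> vec3) \<Rightarrow> (vec3 \<Rightarrow> vec3 \<Rightarrow> vec3) \<Rightarrow>
   (real \<Rightarrow> field3) \<Rightarrow> bool" where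
  "well_posed \<Omega> \<T> \<tau> \<epsilon> \<mu> \<mu>t J b f \<longleftrightarrow>
     (\<forall>n\<ge>1. \<forall>vw \<in> ND \<Omega> \<T> \<times> DG \<Omega> \<T>. \<exists>!EH. is_step \<Omega> \<T> \<tau> \<epsilon> \<mu> \<mu>t J b f n vw EH)"

definition solution_operator ::
  "vec3 set \<Rightarrow> vec3 set set \<Rightarrow> real \<Rightarrow> (real \<Rightarrow> vec3 \<Rightarrow> mat3) \<Rightarrow> (real \<Rightarrow> vec3 \<Rightarrow> mat3) \<Rightarrow>
   (real \<Rightarrow> vec3 \<Rightarrow> mat3) \<Rightarrow> (vec3 \<Rightarrow> vec3 \<Rightarrow> vec3 \<Rightarrow> real \<Rightarrow> vec3) \<Rightarrow> (vec3 \<Rightarrow> vec3 \<Rightarrow> vec3) \<Rightarrow>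
   (real \<Rightarrow> field3) \<Rightarrow> nat \<Rightarrow> field3 \<times> field3 \<Rightarrow> field3 \<times> field3" where
  "solution_operator \<Omega> \<T> \<tau> \<epsilon> \<mu> \<mu>t J b f n vw =
     (THE EH. is_step \<Omega> \<T> \<tau> \<epsilon> \<mu> \<mu>t J b f n vw EH)"


section \<open>Energy and the orthogonal splitting\<close>

definition energy ::
  "vec3 set \<Rightarrow> vec3 set set \<Rightarrow> real \<Rightarrow> (real \<Rightarrow> vec3 \<Rightarrow> mat3) \<Rightarrow> (real \<Rightarrow> vec3 \<Rightarrow> mat3) \<Rightarrow> nat \<Rightarrow>
   field3 \<times> field3 \<Rightarrow> real" where
  "energy \<Omega> \<T> \<tau> \<epsilon> \<mu> n = (\<lambda>(v, w).
     1/2 * (L2_inner \<Omega> (\<lambda>x. \<epsilon> (real n * \<tau>) x *v v x) v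
            + L2_inner \<Omega> (\<lambda>x. Qh \<T> (\<mu> (real n * \<tau>)) x *v w x) w))"

definition W_space :: "vec3 set \<Rightarrow> vec3 set set \<Rightarrow> (vec3 \<Rightarrow> mat3) \<Rightarrow> (field3 \<times> field3) set" where
  "W_space \<Omega> \<T> \<mu>inf = ND \<Omega> \<T> \<times>
     {w \<in> DG \<Omega> \<T>. \<exists>u\<in>ND \<Omega> \<T>. \<exists>c. has_weak_curl \<Omega> u c \<and>
        (AE x in lebesgue_on \<Omega>. w x = matrix_inv (Qh \<T> \<mu>inf x) *v c x)}"

definition N_space :: "vec3 set \<Rightarrow> vec3 set set \<Rightarrow> (field3 \<times> field3) set" where
  "N_space \<Omega> \<T> = {\<lambda>x. 0} \<times>
     {w \<in> DG \<Omega> \<T>. \<forall>v\<in>ND \<Omega> \<T>. \<forall>c. has_weak_curl \<Omega> v c \<longrightarrow> L2_inner \<Omega> w c = 0}"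

end

theory Submission
  imports Defs "HOL-Computational_Algebra.Polynomial"
begin

text \<open>After the times \<open>T\<^sub>J\<close>, \<open>T\<^sub>f\<close> and \<open>T\<^sub>\<mu>\<close> the scheme has no source, its current does not see the magnetic
  field, and \<open>\<mu>\<close> is constant with vanishing derivative. Let \<open>(E, H)\<close> be the result of such a late step from
  \<open>(v, w)\<close>. Testing the first equation with \<open>E\<close>, and using the second one to replace the curl term by a
  difference of magnetic energies, gives

  energy of \<open>(E, H)\<close> + \<open>loss E v\<close> \<open>\<le>\<close> energy of \<open>(v, w)\<close>,

  because the boundary term has a sign by monotonicity (\<open>step_energy\<close>). Assumption (B5) says precisely that
  \<open>loss E v \<ge> \<gamma> \<parallel>E\<parallel>\<^sup>2\<close>. Two more facts turn this into decay by a fixed factor per step.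

  First, \<open>loss E v\<close> also controls \<open>\<parallel>v\<parallel>\<^sup>2\<close> (\<open>loss_strict\<close>). It is a quadratic polynomial in the old field \<open>v\<close>,
  and (B5) holds for all old fields, in particular for \<open>v/2\<close>; comparing the values at \<open>v\<close> and \<open>v/2\<close> leaves a
  positive multiple of \<open>\<parallel>v\<parallel>\<^sup>2\<close> at the cost of a multiple of \<open>\<parallel>E\<parallel>\<^sup>2\<close>, which (B5) pays for.

  Second, if \<open>\<mu> H\<close> is a discrete curl, then the magnetic energy is bounded by a multiple of
  \<open>(\<parallel>E\<parallel> + \<parallel>v\<parallel>)\<^sup>2\<close> (\<open>magnetic_energy_bound\<close>). Indeed \<open>\<mu> H = curl u\<close> with \<open>\<parallel>u\<parallel> \<le> C \<parallel>H\<parallel>\<close>, since everything is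
  finite-dimensional (\<open>curl_lift_bounded\<close>), and the first equation tested with \<open>u\<close> expresses \<open>(\<mu> H, H)\<close> by
  terms linear in \<open>u\<close>. Hence the whole energy is at most a constant times the loss, so each late step divides it by at least some
  \<open>1 + \<kappa>\<close> (\<open>energy_contraction\<close>). All constants are uniform in time, so \<open>\<kappa>\<close> does not depend on the step.

  The part of the magnetic field in \<open>\<N>\<^sub>h\<close> is orthogonal to all discrete curls. The first equation does not see
  it, and the second one changes \<open>\<mu> H\<close> only by discrete curls. So subtracting this part from \<open>H\<close> gives
  another solution of the scheme, to which the contraction applies (\<open>step_if_is_step\<close>), and the energy splits
  into the two contributions (\<open>late_energy_split\<close>).

  The constants come from the following facts. A finite element function is bounded by its \<open>L\<^sup>2\<close> norm
  (\<open>ND_sup_bound\<close>) and the polyhedral boundary has finite area (\<open>hausdorff2_frontier_finite\<close>), so the boundary term, which grows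
  linearly by homogeneity, is bounded in terms of \<open>L\<^sup>2\<close> norms. The current grows linearly, again by homogeneity (\<open>late_current\<close>). That
  \<open>\<partial>\<^sub>t\<mu>\<close> vanishes where \<open>\<mu>\<close> is constant follows from the weak formulation by smooth bump functions
  (\<open>stationary_imp_derivative_0\<close>).\<close>

section \<open>Square-integrable fields\<close>

lemma L2_measurable: "u \<in> L2 \<Omega> \<Longrightarrow> u \<in> borel_measurable (lebesgue_on \<Omega>)"
  and L2_integrable_square: "u \<in> L2 \<Omega> \<Longrightarrow> integrable (lebesgue_on \<Omega>) (\<lambda>x. (norm (u x))\<^sup>2)"
  unfolding L2_def by auto

lemma integrable_norm_mult_norm:
  assumes "u \<in> L2 \<Omega>" "w \<in> L2 \<Omega>"
  shows "integrable (lebesgue_on \<Omega>) (\<lambda>x. norm (u x) * norm (w x))"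
proof (rule Bochner_Integration.integrable_bound)
  show "integrable (lebesgue_on \<Omega>) (\<lambda>x. (norm (u x))\<^sup>2 + (norm (w x))\<^sup>2)"
    using assms by (simp add: L2_integrable_square)
  show "(\<lambda>x. norm (u x) * norm (w x)) \<in> borel_measurable (lebesgue_on \<Omega>)"
    using assms[THEN L2_measurable] by measurable
  have "norm (u x) * norm (w x) \<le> (norm (u x))\<^sup>2 + (norm (w x))\<^sup>2" for x
    using sum_squares_bound[of "norm (u x)" "norm (w x)"]
      mult_nonneg_nonneg[OF norm_ge_zero[of "u x"] norm_ge_zero[of "w x"]] by linarith
  then show "AE x in lebesgue_on \<Omega>. norm (norm (u x) * norm (w x)) \<le> norm ((norm (u x))\<^sup>2 + (norm (w x))\<^sup>2)"
    by (intro AE_I2) (simp add: abs_mult)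
qed

lemma integrable_inner_L2:
  fixes u w :: "vec3 \<Rightarrow> 'b::euclidean_space"
  assumes "u \<in> L2 \<Omega>" "w \<in> L2 \<Omega>"
  shows "integrable (lebesgue_on \<Omega>) (\<lambda>x. u x \<bullet> w x)"
proof (rule Bochner_Integration.integrable_bound[OF integrable_norm_mult_norm[OF assms]])
  show "(\<lambda>x. u x \<bullet> w x) \<in> borel_measurable (lebesgue_on \<Omega>)"
    using assms[THEN L2_measurable] by measurable
qed (auto intro!: AE_I2 simp: Cauchy_Schwarz_ineq2)

lemma L2_dominated:
  fixes u :: "vec3 \<Rightarrow> 'b::euclidean_space" and g :: "vec3 \<Rightarrow> 'c::euclidean_space"
  assumes "u \<in> L2 \<Omega>" and g: "g \<in> borel_measurable (lebesgue_on \<Omega>)"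
    and le: "AE x in lebesgue_on \<Omega>. norm (g x) \<le> C * norm (u x)"
  shows "g \<in> L2 \<Omega>"
proof -
  have "integrable (lebesgue_on \<Omega>) (\<lambda>x. (norm (g x))\<^sup>2)"
  proof (rule Bochner_Integration.integrable_bound)
    show "integrable (lebesgue_on \<Omega>) (\<lambda>x. C\<^sup>2 * (norm (u x))\<^sup>2)"
      using assms(1) by (simp add: L2_integrable_square)
    show "(\<lambda>x. (norm (g x))\<^sup>2) \<in> borel_measurable (lebesgue_on \<Omega>)" using g by measurable
    show "AE x in lebesgue_on \<Omega>. norm ((norm (g x))\<^sup>2) \<le> norm (C\<^sup>2 * (norm (u x))\<^sup>2)"
      using le
    proof eventually_elim
      case (elim x)
      then have "(norm (g x))\<^sup>2 \<le> (C * norm (u x))\<^sup>2" by (intro power_mono) auto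
      then show ?case by (simp add: power_mult_distrib)
    qed
  qed
  then show ?thesis unfolding L2_def using g by auto
qed

lemma L2_add:
  fixes u w :: "vec3 \<Rightarrow> 'b::euclidean_space"
  assumes "u \<in> L2 \<Omega>" "w \<in> L2 \<Omega>"
  shows "(\<lambda>x. u x + w x) \<in> L2 \<Omega>"
proof -
  have "integrable (lebesgue_on \<Omega>) (\<lambda>x. (u x \<bullet> u x + u x \<bullet> w x) + (u x \<bullet> w x + w x \<bullet> w x))"
    by (intro Bochner_Integration.integrable_add integrable_inner_L2 assms)
  then have "integrable (lebesgue_on \<Omega>) (\<lambda>x. (norm (u x + w x))\<^sup>2)"
    by (simp add: power2_norm_eq_inner algebra_simps inner_commute)
  then show ?thesis unfolding L2_def using assms[THEN L2_measurable] by auto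
qed

lemma L2_scaleR:
  fixes u :: "vec3 \<Rightarrow> 'b::euclidean_space"
  assumes "u \<in> L2 \<Omega>"
  shows "(\<lambda>x. s *\<^sub>R u x) \<in> L2 \<Omega>"
  by (rule L2_dominated[OF assms, where C="\<bar>s\<bar>"]) (use L2_measurable[OF assms] in auto)

lemma L2_diff:
  fixes u w :: "vec3 \<Rightarrow> 'b::euclidean_space"
  assumes "u \<in> L2 \<Omega>" "w \<in> L2 \<Omega>"
  shows "(\<lambda>x. u x - w x) \<in> L2 \<Omega>"
  using L2_add[OF assms(1) L2_scaleR[OF assms(2), of "-1"]] by simp

lemma L2_inner_commute: "L2_inner \<Omega> u w = L2_inner \<Omega> w u"
  unfolding L2_inner_def by (simp add: inner_commute)

lemma L2_inner_add_left:
  assumes "u \<in> L2 \<Omega>" "u' \<in> L2 \<Omega>" "w \<in> L2 \<Omega>"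
  shows "L2_inner \<Omega> (\<lambda>x. u x + u' x) w = L2_inner \<Omega> u w + L2_inner \<Omega> u' w"
  unfolding L2_inner_def using assms by (simp add: inner_add_left integrable_inner_L2)

lemma L2_inner_diff_left:
  assumes "u \<in> L2 \<Omega>" "u' \<in> L2 \<Omega>" "w \<in> L2 \<Omega>"
  shows "L2_inner \<Omega> (\<lambda>x. u x - u' x) w = L2_inner \<Omega> u w - L2_inner \<Omega> u' w"
  unfolding L2_inner_def using assms by (simp add: inner_diff_left integrable_inner_L2)

lemma L2_inner_add_right:
  assumes "u \<in> L2 \<Omega>" "u' \<in> L2 \<Omega>" "w \<in> L2 \<Omega>"
  shows "L2_inner \<Omega> w (\<lambda>x. u x + u' x) = L2_inner \<Omega> w u + L2_inner \<Omega> w u'"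
  unfolding L2_inner_def using assms by (simp add: inner_add_right integrable_inner_L2)

lemma L2_inner_diff_right:
  assumes "u \<in> L2 \<Omega>" "u' \<in> L2 \<Omega>" "w \<in> L2 \<Omega>"
  shows "L2_inner \<Omega> w (\<lambda>x. u x - u' x) = L2_inner \<Omega> w u - L2_inner \<Omega> w u'"
  unfolding L2_inner_def using assms by (simp add: inner_diff_right integrable_inner_L2)

lemma L2_inner_scaleR_left: "L2_inner \<Omega> (\<lambda>x. s *\<^sub>R u x) w = s * L2_inner \<Omega> u w"
  unfolding L2_inner_def by simp

lemma L2_inner_scaleR_right: "L2_inner \<Omega> w (\<lambda>x. s *\<^sub>R u x) = s * L2_inner \<Omega> w u"
  unfolding L2_inner_def by simp

lemma L2_inner_cong_AE:
  fixes u w :: "vec3 \<Rightarrow> 'b::euclidean_space"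
  assumes "u \<in> L2 \<Omega>" "u' \<in> L2 \<Omega>" "w \<in> L2 \<Omega>" "AE x in lebesgue_on \<Omega>. u x = u' x"
  shows "L2_inner \<Omega> u w = L2_inner \<Omega> u' w"
  unfolding L2_inner_def
  by (rule integral_cong_AE) (use assms(4) L2_measurable[OF assms(1)] L2_measurable[OF assms(2)]
     L2_measurable[OF assms(3)] in auto)

lemma L2_norm_nonneg: "0 \<le> L2_norm \<Omega> u"
  and L2_norm_square: "(L2_norm \<Omega> u)\<^sup>2 = L2_inner \<Omega> u u"
  unfolding L2_norm_def L2_inner_def by simp_all

lemma L2_inner_abs_le_norm_mult_norm:
  "u \<in> L2 \<Omega> \<Longrightarrow> w \<in> L2 \<Omega> \<Longrightarrow> \<bar>L2_inner \<Omega> u w\<bar> \<le> (LINT x|lebesgue_on \<Omega>. norm (u x) * norm (w x))"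
  unfolding L2_inner_def
  by (intro order.trans[OF integral_abs_bound] integral_mono integrable_abs integrable_inner_L2
      integrable_norm_mult_norm Cauchy_Schwarz_ineq2)

text \<open>The Cauchy-Schwarz inequality in coordinates: a quadratic polynomial without sign change has
  nonpositive discriminant. The case \<open>r = 0\<close>, where the polynomial is affine, needs its own argument.\<close>

lemma quadratic_nonneg_imp_discriminant:
  fixes p q r :: real
  assumes "\<And>s. 0 \<le> p - 2 * s * q + s\<^sup>2 * r" "0 \<le> p" "0 \<le> r"
  shows "\<bar>q\<bar> \<le> sqrt p * sqrt r"
proof -
  have "q\<^sup>2 \<le> p * r"
  proof (cases "r = 0")
    case True
    have "q = 0"
    proof (rule ccontr)
      assume "q \<noteq> 0"
      then show False using assms(1)[of "(p + 1) / (2 * q)"] True by simp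
    qed
    then show ?thesis using True by simp
  next
    case False
    then have "r > 0" using assms(3) by simp
    moreover have "0 \<le> p - q\<^sup>2 / r"
      using assms(1)[of "q / r"] False by (simp add: power2_eq_square field_simps)
    ultimately show ?thesis by (simp add: field_simps)
  qed
  then have "sqrt (q\<^sup>2) \<le> sqrt (p * r)" by (rule real_sqrt_le_mono)
  then show ?thesis unfolding real_sqrt_abs real_sqrt_mult .
qed

lemma L2_Cauchy_Schwarz:
  fixes u w :: "vec3 \<Rightarrow> 'b::euclidean_space"
  assumes u: "u \<in> L2 \<Omega>" and w: "w \<in> L2 \<Omega>"
  shows "\<bar>L2_inner \<Omega> u w\<bar> \<le> L2_norm \<Omega> u * L2_norm \<Omega> w"
  unfolding L2_norm_def
proof (rule quadratic_nonneg_imp_discriminant)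
  fix s :: real
  have "0 \<le> L2_inner \<Omega> (\<lambda>x. u x - s *\<^sub>R w x) (\<lambda>x. u x - s *\<^sub>R w x)"
    unfolding L2_inner_def by simp
  also have "\<dots> = L2_inner \<Omega> u u - 2 * s * L2_inner \<Omega> u w + s\<^sup>2 * L2_inner \<Omega> w w"
    using u w by (simp add: L2_inner_diff_left L2_inner_diff_right L2_scaleR L2_diff
        L2_inner_scaleR_left L2_inner_scaleR_right L2_inner_commute[of \<Omega> w u] power2_eq_square algebra_simps)
  finally show "0 \<le> L2_inner \<Omega> u u - 2 * s * L2_inner \<Omega> u w + s\<^sup>2 * L2_inner \<Omega> w w" .
qed (simp_all add: L2_inner_def)

lemma L2_norm_triangle:
  fixes u w :: "vec3 \<Rightarrow> 'b::euclidean_space"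
  assumes u: "u \<in> L2 \<Omega>" and w: "w \<in> L2 \<Omega>"
  shows "L2_norm \<Omega> (\<lambda>x. u x + w x) \<le> L2_norm \<Omega> u + L2_norm \<Omega> w"
proof (rule power2_le_imp_le)
  have "(L2_norm \<Omega> (\<lambda>x. u x + w x))\<^sup>2 = (L2_norm \<Omega> u)\<^sup>2 + 2 * L2_inner \<Omega> u w + (L2_norm \<Omega> w)\<^sup>2"
    using u w by (simp add: L2_norm_square L2_inner_add_left L2_inner_add_right L2_add L2_inner_commute[of \<Omega> w u])
  also have "\<dots> \<le> (L2_norm \<Omega> u + L2_norm \<Omega> w)\<^sup>2"
    using L2_Cauchy_Schwarz[OF u w] by (simp add: power2_sum)
  finally show "(L2_norm \<Omega> (\<lambda>x. u x + w x))\<^sup>2 \<le> (L2_norm \<Omega> u + L2_norm \<Omega> w)\<^sup>2" .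
qed (simp add: L2_norm_nonneg)

lemma L2_norm_scaleR: "L2_norm \<Omega> (\<lambda>x. s *\<^sub>R u x) = \<bar>s\<bar> * L2_norm \<Omega> u"
  unfolding L2_norm_def
  by (simp add: L2_inner_scaleR_left L2_inner_scaleR_right real_sqrt_mult real_sqrt_abs2 flip: mult.assoc)

lemma L2_norm_dominated:
  fixes u :: "vec3 \<Rightarrow> 'b::euclidean_space" and g :: "vec3 \<Rightarrow> 'c::euclidean_space"
  assumes u: "u \<in> L2 \<Omega>" and g: "g \<in> borel_measurable (lebesgue_on \<Omega>)"
    and le: "AE x in lebesgue_on \<Omega>. norm (g x) \<le> C * norm (u x)" and C: "0 \<le> C"
  shows "L2_norm \<Omega> g \<le> C * L2_norm \<Omega> u"
proof (rule power2_le_imp_le)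
  have "(L2_norm \<Omega> g)\<^sup>2 = (LINT x|lebesgue_on \<Omega>. (norm (g x))\<^sup>2)"
    by (simp add: L2_norm_square L2_inner_def power2_norm_eq_inner)
  also have "\<dots> \<le> (LINT x|lebesgue_on \<Omega>. C\<^sup>2 * (norm (u x))\<^sup>2)"
  proof (rule integral_mono_AE)
    show "AE x in lebesgue_on \<Omega>. (norm (g x))\<^sup>2 \<le> C\<^sup>2 * (norm (u x))\<^sup>2"
      using le by eventually_elim (metis norm_ge_zero power_mono power_mult_distrib)
  qed (use L2_integrable_square[OF u] L2_integrable_square[OF L2_dominated[OF u g le]] in auto)
  also have "\<dots> = (C * L2_norm \<Omega> u)\<^sup>2"
    by (simp add: power_mult_distrib L2_norm_square L2_inner_def power2_norm_eq_inner)
  finally show "(L2_norm \<Omega> g)\<^sup>2 \<le> (C * L2_norm \<Omega> u)\<^sup>2" .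
qed (use C in \<open>simp add: L2_norm_nonneg\<close>)

text \<open>The norm of a matrix is that of its nine entries. The factor \<open>3\<close> is not sharp; it comes from
  bounding the norm of the product by the sum of its components.\<close>

lemma norm_matrix_vector_le: "norm (A *v x) \<le> 3 * norm A * norm x" for A :: mat3
proof -
  have "norm (A *v x) \<le> (\<Sum>i\<in>UNIV. \<bar>(A *v x) $ i\<bar>)" by (rule norm_le_l1_cart)
  also have "\<dots> \<le> (\<Sum>i\<in>(UNIV::3 set). norm A * norm x)"
  proof (rule sum_mono)
    fix i :: 3
    have "\<bar>(A *v x) $ i\<bar> \<le> norm (A $ i) * norm x"
      unfolding matrix_vector_mul_component by (rule Cauchy_Schwarz_ineq2)
    also have "\<dots> \<le> norm A * norm x" by (intro mult_right_mono Finite_Cartesian_Product.norm_nth_le) auto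
    finally show "\<bar>(A *v x) $ i\<bar> \<le> norm A * norm x" .
  qed
  finally show ?thesis by simp
qed

lemma borel_measurable_matrix_vector:
  fixes A :: "'a \<Rightarrow> mat3"
  assumes A: "A \<in> borel_measurable M" and u: "u \<in> borel_measurable M"
  shows "(\<lambda>x. A x *v u x) \<in> borel_measurable M"
proof (rule borel_measurable_continuous_Pair[OF A u])
  show "continuous_on UNIV (\<lambda>x::mat3 \<times> vec3. fst x *v snd x)"
    unfolding matrix_vector_mult_def by (intro continuous_intros)
qed

lemma matrix_field_apply:
  fixes A :: "vec3 \<Rightarrow> mat3"
  assumes A: "A \<in> borel_measurable (lebesgue_on \<Omega>)" and C: "AE x in lebesgue_on \<Omega>. norm (A x) \<le> C"
    and C0: "0 \<le> C" and u: "u \<in> L2 \<Omega>"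
  shows "(\<lambda>x. A x *v u x) \<in> L2 \<Omega>" "L2_norm \<Omega> (\<lambda>x. A x *v u x) \<le> 3 * C * L2_norm \<Omega> u"
proof -
  have m: "(\<lambda>x. A x *v u x) \<in> borel_measurable (lebesgue_on \<Omega>)"
    by (intro borel_measurable_matrix_vector A L2_measurable u)
  have "AE x in lebesgue_on \<Omega>. norm (A x *v u x) \<le> (3 * C) * norm (u x)"
    using C
  proof eventually_elim
    case (elim x)
    have "norm (A x *v u x) \<le> 3 * norm (A x) * norm (u x)" by (rule norm_matrix_vector_le)
    also have "\<dots> \<le> 3 * C * norm (u x)" using elim by (intro mult_right_mono) auto
    finally show ?case .
  qed
  then show "(\<lambda>x. A x *v u x) \<in> L2 \<Omega>" "L2_norm \<Omega> (\<lambda>x. A x *v u x) \<le> 3 * C * L2_norm \<Omega> u"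
    using L2_dominated[OF u m] L2_norm_dominated[OF u m] C0 by auto
qed

lemma Linf_sym_apply_L2:
  assumes "A \<in> Linf_sym \<Omega>" "u \<in> L2 \<Omega>"
  shows "(\<lambda>x. A x *v u x) \<in> L2 \<Omega>"
proof -
  obtain C where "AE x in lebesgue_on \<Omega>. norm (A x) \<le> C" using assms(1) unfolding Linf_sym_def by auto
  then have "AE x in lebesgue_on \<Omega>. norm (A x) \<le> max C 0" by eventually_elim auto
  then show ?thesis using assms by (intro matrix_field_apply) (auto simp: Linf_sym_def)
qed

lemma symmetric_matrix_inner:
  fixes A :: mat3
  assumes "transpose A = A"
  shows "(A *v x) \<bullet> y = (A *v y) \<bullet> x"
  by (metis assms dot_lmul_matrix inner_commute transpose_matrix_vector)

lemma Linf_sym_inner_commute: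
  assumes "A \<in> Linf_sym \<Omega>" "u \<in> L2 \<Omega>" "w \<in> L2 \<Omega>"
  shows "L2_inner \<Omega> (\<lambda>x. A x *v u x) w = L2_inner \<Omega> (\<lambda>x. A x *v w x) u"
  unfolding L2_inner_def
proof (rule integral_cong_AE)
  show "AE x in lebesgue_on \<Omega>. (A x *v u x) \<bullet> w x = (A x *v w x) \<bullet> u x"
    using assms(1) unfolding Linf_sym_def by (auto elim!: eventually_mono intro: symmetric_matrix_inner)
qed (use assms in \<open>auto intro!: borel_measurable_integrable integrable_inner_L2 Linf_sym_apply_L2\<close>)

lemma coercive_field_L2_lower:
  assumes A: "A \<in> Linf_sym \<Omega>" and u: "u \<in> L2 \<Omega>"
    and l: "AE x in lebesgue_on \<Omega>. \<forall>\<xi>. l * (norm \<xi>)\<^sup>2 \<le> \<xi> \<bullet> (A x *v \<xi>)"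
  shows "l * (L2_norm \<Omega> u)\<^sup>2 \<le> L2_inner \<Omega> (\<lambda>x. A x *v u x) u"
proof -
  have "l * (L2_norm \<Omega> u)\<^sup>2 = (LINT x|lebesgue_on \<Omega>. l * (norm (u x))\<^sup>2)"
    by (simp add: L2_norm_square L2_inner_def power2_norm_eq_inner)
  also have "\<dots> \<le> (LINT x|lebesgue_on \<Omega>. (A x *v u x) \<bullet> u x)"
  proof (rule integral_mono_AE)
    show "AE x in lebesgue_on \<Omega>. l * (norm (u x))\<^sup>2 \<le> (A x *v u x) \<bullet> u x"
      using l by eventually_elim (simp add: inner_commute)
  qed (use A u in \<open>auto intro!: L2_integrable_square integrable_inner_L2 Linf_sym_apply_L2\<close>)
  finally show ?thesis unfolding L2_inner_def .
qed

lemma const_in_L2: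
  assumes "bounded \<Omega>" "open \<Omega>" shows "(\<lambda>x. c) \<in> L2 \<Omega>"
  by (rule bounded_L2_domain[OF assms, where C="norm c"]) auto

lemma Linf_sym_bounded: "A \<in> Linf_sym \<Omega> \<Longrightarrow> \<exists>C. AE x in lebesgue_on \<Omega>. norm (A x) \<le> C"
  and Linf_sym_measurable: "A \<in> Linf_sym \<Omega> \<Longrightarrow> A \<in> borel_measurable (lebesgue_on \<Omega>)"
  unfolding Linf_sym_def by auto

lemma Linf_bounded_in_L2:
  fixes A :: "vec3 \<Rightarrow> 'b::euclidean_space"
  assumes \<Omega>: "bounded \<Omega>" "open \<Omega>" and A: "A \<in> borel_measurable (lebesgue_on \<Omega>)"
    and C: "AE x in lebesgue_on \<Omega>. norm (A x) \<le> C"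
  shows "A \<in> L2 \<Omega>"
  by (rule L2_dominated[OF const_in_L2[OF \<Omega>, of "1::real"] A, where C=C]) (use C in auto)

lemma Linf_sym_L2:
  assumes \<Omega>: "bounded \<Omega>" "open \<Omega>" and A: "A \<in> Linf_sym \<Omega>"
  shows "A \<in> L2 \<Omega>"
proof -
  obtain C where "AE x in lebesgue_on \<Omega>. norm (A x) \<le> C" using Linf_sym_bounded[OF A] ..
  then show ?thesis by (rule Linf_bounded_in_L2[OF \<Omega> Linf_sym_measurable[OF A]])
qed

section \<open>Smooth test functions of time\<close>

lemma Ck_imp_continuous: "Ck k f \<Longrightarrow> continuous_on UNIV f"
proof (cases k)
  case (Suc j)
  assume "Ck k f"
  then obtain f' where "\<And>x. (f has_derivative f' x) (at x)" using Suc by auto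
  then show ?thesis
    by (meson continuous_at_imp_continuous_on has_derivative_continuous)
qed auto

lemma Ck_Suc_imp_Ck: "Ck (Suc k) f \<Longrightarrow> Ck k f"
proof (induction k arbitrary: f)
  case 0
  then show ?case using Ck_imp_continuous[of "Suc 0" f] by simp
next
  case (Suc k)
  then obtain f' where f': "\<And>x. (f has_derivative f' x) (at x)" "\<And>d. Ck (Suc k) (\<lambda>x. f' x d)"
    by auto
  show ?case unfolding Ck.simps(2)[of k] using f' Suc.IH by blast
qed

lemma Ck_const: "Ck k (\<lambda>x. c)"
  by (induction k arbitrary: c) (auto intro!: exI[of _ "\<lambda>_ _. 0"])

lemma Ck_add:
  fixes f g :: "'a::euclidean_space \<Rightarrow> 'b::euclidean_space"
  shows "Ck k f \<Longrightarrow> Ck k g \<Longrightarrow> Ck k (\<lambda>x. f x + g x)"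
proof (induction k arbitrary: f g)
  case 0
  then show ?case by (auto intro: continuous_intros)
next
  case (Suc k)
  obtain f' where f': "\<And>x. (f has_derivative f' x) (at x)" "\<And>d. Ck k (\<lambda>x. f' x d)"
    using Suc.prems by auto
  obtain g' where g': "\<And>x. (g has_derivative g' x) (at x)" "\<And>d. Ck k (\<lambda>x. g' x d)"
    using Suc.prems by auto
  show ?case unfolding Ck.simps
    by (rule exI[of _ "\<lambda>x d. f' x d + g' x d"]) (auto intro!: derivative_intros f' g' Suc.IH)
qed

lemma Ck_mult:
  fixes f g :: "'a::euclidean_space \<Rightarrow> real"
  shows "Ck k f \<Longrightarrow> Ck k g \<Longrightarrow> Ck k (\<lambda>x. f x * g x)"
proof (induction k arbitrary: f g)
  case 0
  then show ?case by (auto intro: continuous_intros)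
next
  case (Suc k)
  obtain f' where f': "\<And>x. (f has_derivative f' x) (at x)" "\<And>d. Ck k (\<lambda>x. f' x d)"
    using Suc.prems by auto
  obtain g' where g': "\<And>x. (g has_derivative g' x) (at x)" "\<And>d. Ck k (\<lambda>x. g' x d)"
    using Suc.prems by auto
  have fk: "Ck k f" "Ck k g" using Suc.prems Ck_Suc_imp_Ck by blast+
  show ?case unfolding Ck.simps(2)[of k]
    by (rule exI[of _ "\<lambda>x d. f x * g' x d + f' x d * g x"])
       (auto intro!: has_derivative_mult f' g' Suc.IH Ck_add fk)
qed

lemma Ck_affine:
  fixes f :: "real \<Rightarrow> real"
  shows "Ck k f \<Longrightarrow> Ck k (\<lambda>x. f (p * x + q))"
proof (induction k arbitrary: f)
  case 0
  then have "continuous_on UNIV f" by simp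
  then have "continuous_on UNIV (\<lambda>x. f (p * x + q))"
    by (rule continuous_on_compose2) (auto intro!: continuous_intros)
  then show ?case by simp
next
  case (Suc k)
  obtain f' where f': "\<And>x. (f has_derivative f' x) (at x)" "\<And>d. Ck k (\<lambda>x. f' x d)"
    using Suc.prems by auto
  have "((\<lambda>x. f (p * x + q)) has_derivative (\<lambda>d. f' (p * x + q) (p * d))) (at x)" for x
    by (rule has_derivative_compose[OF _ f'(1)]) (auto intro!: derivative_eq_intros)
  moreover have "Ck k (\<lambda>x. f' (p * x + q) (p * d))" for d by (rule Suc.IH[OF f'(2)])
  ultimately show ?case unfolding Ck.simps
    by (intro exI[of _ "\<lambda>x d. f' (p * x + q) (p * d)"]) blast
qed

text \<open>The functions \<open>p (1 / x) exp (- 1 / x)\<close>, extended by \<open>0\<close> to \<open>x \<le> 0\<close>. The family with all polynomials \<open>p\<close> is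
  closed under differentiation, which makes smoothness of each member a plain induction.\<close>

definition flat_exp :: "real poly \<Rightarrow> real \<Rightarrow> real" where
  "flat_exp p x = (if x > 0 then poly p (1 / x) * exp (- 1 / x) else 0)"

text \<open>With \<open>y = 1 / x\<close> this is the decay of polynomials times \<open>exp (- y)\<close> at infinity.\<close>

lemma flat_exp_tendsto_0: "(flat_exp p \<longlongrightarrow> 0) (at_right 0)"
proof -
  have mono: "((\<lambda>y::real. y ^ k * exp (- y)) \<longlongrightarrow> 0) at_top" for k :: nat
    using tendsto_power_div_exp_0[of k] unfolding exp_minus divide_inverse .
  have poly0: "((\<lambda>y. poly p y * exp (- y)) \<longlongrightarrow> 0) at_top"
  proof -
    have "((\<lambda>y. \<Sum>i\<le>degree p. coeff p i * (y ^ i * exp (- y))) \<longlongrightarrow> (\<Sum>i\<le>degree p. coeff p i * 0)) at_top"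
      by (intro tendsto_intros mono)
    then show ?thesis by (simp add: poly_altdef sum_distrib_right mult.assoc)
  qed
  have "((\<lambda>x. poly p (1 / x) * exp (- (1 / x))) \<longlongrightarrow> 0) (at_right 0)"
    by (rule filterlim_compose[OF poly0]) (use filterlim_inverse_at_top_right in \<open>simp add: inverse_eq_divide\<close>)
  moreover have "\<forall>\<^sub>F x in at_right 0. poly p (1 / x) * exp (- (1 / x)) = flat_exp p x"
    unfolding flat_exp_def by (auto simp: eventually_at_right_field intro!: exI[of _ 1])
  ultimately show ?thesis by (rule Lim_transform_eventually)
qed

text \<open>At \<open>0\<close> the difference quotient is a member of the same family, now with the polynomial \<open>y p(y)\<close>, so
  it tends to \<open>0\<close>.\<close>

lemma flat_exp_has_real_derivative:
  "(flat_exp p has_real_derivative flat_exp (monom 1 2 * (p - pderiv p)) x) (at x)"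
proof -
  consider "x > 0" | "x < 0" | "x = 0" by linarith
  then show ?thesis
  proof cases
    case 1
    have "((\<lambda>x. poly p (1 / x) * exp (- 1 / x)) has_real_derivative
        flat_exp (monom 1 2 * (p - pderiv p)) x) (at x)"
      unfolding flat_exp_def using 1
      by (auto intro!: derivative_eq_intros DERIV_chain'[OF _ poly_DERIV]
          simp: poly_monom power2_eq_square field_simps)
    then show ?thesis
      by (rule has_field_derivative_transform_within_open[of _ _ _ "{0<..}"]) (use 1 in \<open>auto simp: flat_exp_def\<close>)
  next
    case 2
    have "((\<lambda>x. 0) has_real_derivative flat_exp (monom 1 2 * (p - pderiv p)) x) (at x)"
      using 2 by (simp add: flat_exp_def)
    then show ?thesis
      by (rule has_field_derivative_transform_within_open[of _ _ _ "{..<0}"]) (use 2 in \<open>auto simp: flat_exp_def\<close>)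
  next
    case 3
    have "((\<lambda>y. flat_exp p y / y) \<longlongrightarrow> 0) (at_right 0)"
    proof (rule Lim_transform_eventually[OF flat_exp_tendsto_0[of "monom 1 1 * p"]])
      show "\<forall>\<^sub>F x in at_right 0. flat_exp (monom 1 1 * p) x = flat_exp p x / x"
        by (auto simp: flat_exp_def poly_monom)
    qed
    moreover have "((\<lambda>y. flat_exp p y / y) \<longlongrightarrow> 0) (at_left 0)"
    proof (rule Lim_transform_eventually[of "\<lambda>_. 0"])
      show "\<forall>\<^sub>F x in at_left (0::real). 0 = flat_exp p x / x"
        by (auto simp: flat_exp_def eventually_at_left_field intro!: exI[of _ "-1"])
    qed simp
    ultimately have "((\<lambda>y. flat_exp p y / y) \<longlongrightarrow> 0) (at 0)"
      by (simp add: filterlim_split_at)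
    then show ?thesis using 3 by (simp add: has_field_derivative_iff flat_exp_def)
  qed
qed

lemma Ck_flat_exp: "Ck k (flat_exp p)"
proof (induction k arbitrary: p)
  case 0
  show ?case using flat_exp_has_real_derivative
    by (auto intro!: continuous_at_imp_continuous_on DERIV_isCont)
next
  case (Suc k)
  let ?q = "monom 1 2 * (p - pderiv p)"
  have "(flat_exp p has_derivative (\<lambda>d. flat_exp ?q x * d)) (at x)" for x
    using flat_exp_has_real_derivative[of p x] by (simp add: has_field_derivative_def)
  moreover have "Ck k (\<lambda>x. flat_exp ?q x * d)" for d
    by (intro Ck_mult Suc.IH Ck_const)
  ultimately show ?case unfolding Ck.simps
    by (intro exI[of _ "\<lambda>x d. flat_exp ?q x * d"]) blast
qed

text \<open>The product of two flat exponentials, one vanishing left of \<open>a\<close> and the other one right of \<open>b\<close>.\<close>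

lemma smooth_bump_exists:
  fixes a b :: real
  assumes "a < b"
  obtains \<psi> :: "real \<Rightarrow> real"
  where "\<And>k. Ck k \<psi>" "\<And>x. \<psi> x \<ge> 0" "\<And>x. \<psi> x > 0 \<longleftrightarrow> x \<in> {a<..<b}"
proof
  let ?\<psi> = "\<lambda>x. flat_exp 1 (1 * x + (- a)) * flat_exp 1 ((- 1) * x + b)"
  show "Ck k ?\<psi>" for k by (intro Ck_mult Ck_affine Ck_flat_exp)
  show "?\<psi> x \<ge> 0" for x by (simp add: flat_exp_def)
  show "?\<psi> x > 0 \<longleftrightarrow> x \<in> {a<..<b}" for x by (auto simp: flat_exp_def)
qed

lemma smooth_bump_in_test_functions:
  fixes \<psi> :: "real \<Rightarrow> real"
  assumes "\<And>k. Ck k \<psi>" "\<And>x. \<psi> x \<ge> 0" "\<And>x. \<psi> x > 0 \<longleftrightarrow> x \<in> {a<..<b}" "{a..b} \<subseteq> U"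
  shows "\<psi> \<in> test_functions U"
proof -
  have "{x. \<psi> x \<noteq> 0} = {a<..<b}"
    using assms(2,3) by (auto simp: less_le order.strict_iff_order)
  then have "closure {x. \<psi> x \<noteq> 0} \<subseteq> {a..b}"
    by (metis closed_atLeastAtMost closure_minimal greaterThanLessThan_subseteq_atLeastAtMost_iff order_refl)
  moreover from this have "compact (closure {x. \<psi> x \<noteq> 0})"
    by (metis bounded_closed_interval bounded_subset closed_closure compact_eq_bounded_closed)
  ultimately show ?thesis unfolding test_functions_def using assms(1,4) by blast
qed

text \<open>The fundamental lemma of the calculus of variations. Near a point with \<open>g t \<noteq> 0\<close> the product \<open>g s * g t\<close> is
  positive, so its integral against a bump function at \<open>t\<close> cannot vanish.\<close>

lemma test_function_integral_eq_0_imp_0: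
  fixes g :: "real \<Rightarrow> real"
  assumes U: "open U" and g: "continuous_on U g"
    and zero: "\<And>\<psi>. \<psi> \<in> test_functions U \<Longrightarrow> (LINT t|lebesgue_on U. \<psi> t * g t) = 0"
    and t: "t \<in> U"
  shows "g t = 0"
proof (rule ccontr)
  assume nz: "g t \<noteq> 0"
  have "isCont g t" using U g t by (simp add: continuous_on_eq_continuous_at)
  then have "isCont (\<lambda>s. g s * g t) t" by (intro continuous_intros)
  moreover have "g t * g t > 0" using nz by (simp add: zero_less_mult_iff less_le) 
  ultimately have "\<forall>\<^sub>F s in at t. g s * g t > 0"
    unfolding isCont_def by (rule order_tendstoD)
  then obtain d0 where d0: "d0 > 0" "\<And>s. s \<noteq> t \<Longrightarrow> dist s t < d0 \<Longrightarrow> g s * g t > 0"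
    unfolding eventually_at by auto
  have d0': "g s * g t > 0" if "dist s t < d0" for s
    using d0(2)[of s] that \<open>g t * g t > 0\<close> by (cases "s = t") auto
  obtain d1 where d1: "d1 > 0" "cball t d1 \<subseteq> U" using U t open_contains_cball by blast
  define d where "d = min (d0/2) d1"
  have d: "d > 0" "d < d0" "d \<le> d1" using d0(1) d1(1) by (auto simp: d_def)
  obtain \<psi> :: "real \<Rightarrow> real" where \<psi>: "\<And>k. Ck k \<psi>" "\<And>x. \<psi> x \<ge> 0" "\<And>x. \<psi> x > 0 \<longleftrightarrow> x \<in> {t-d<..<t+d}"
    using smooth_bump_exists[of "t-d" "t+d"] d(1) by auto
  have I: "{t-d..t+d} \<subseteq> U" using d1(2) d(3) by (force simp: cball_eq_atLeastAtMost)
  have "\<psi> \<in> test_functions U" by (rule smooth_bump_in_test_functions[OF \<psi> I])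
  then have z: "(LINT s|lebesgue_on U. \<psi> s * g s) = 0" by (rule zero)
  have \<psi>0: "\<psi> s = 0" if "s \<notin> {t-d<..<t+d}" for s using \<psi>(2,3)[of s] that by force
  let ?h = "\<lambda>s. \<psi> s * (g s * g t)"
  have cont: "continuous_on {t-d..t+d} ?h"
    by (intro continuous_intros continuous_on_subset[OF g I] continuous_on_subset[OF Ck_imp_continuous[OF \<psi>(1)[of 0]]]) auto
  have "(LINT s|lebesgue_on {t-d..t+d}. ?h s) = (LINT s|lebesgue_on U. ?h s)"
  proof -
    have "indicator {t-d..t+d} s *\<^sub>R ?h s = indicator U s *\<^sub>R ?h s" for s
    proof (cases "s \<in> {t-d..t+d}")
      case False
      then have "\<psi> s = 0" by (intro \<psi>0) auto
      then show ?thesis by simp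
    qed (use I in auto)
    then have "(LINT s|lebesgue. indicator {t-d..t+d} s *\<^sub>R ?h s) = (LINT s|lebesgue. indicator U s *\<^sub>R ?h s)"
      by (rule Bochner_Integration.integral_cong[OF refl])
    moreover have "U \<in> sets lebesgue" "{t-d..t+d} \<in> sets lebesgue" using U by auto
    ultimately show ?thesis
      by (simp add: integral_restrict_space)
  qed
  also have "\<dots> = (LINT s|lebesgue_on U. \<psi> s * g s) * g t"
    by (subst integral_mult_left_zero[symmetric]) (simp add: mult.assoc)
  finally have "(LINT s|lebesgue_on {t-d..t+d}. ?h s) = 0" using z by simp
  moreover have "?h s \<ge> 0" if "s \<in> {t-d..t+d}" for s
  proof -
    have "dist s t < d0" using that d by (auto simp: dist_real_def)
    then show ?thesis by (rule mult_nonneg_nonneg[OF \<psi>(2) less_imp_le[OF d0']])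
  qed
  ultimately have "?h s = 0" if "s \<in> {t-d..t+d}" for s
    using integralL_eq_0_iff[OF cont] d(1) that by auto
  from this[of t] have "?h t = 0" using d(1) by simp
  moreover have "\<psi> t > 0" using \<psi>(3)[of t] d(1) by simp
  ultimately show False using nz by simp
qed

lemma eq_0_outside_support:
  fixes \<psi> :: "real \<Rightarrow> real"
  assumes "t \<notin> closure {x. \<psi> x \<noteq> 0}"
  shows "\<psi> t = 0"
proof (rule ccontr)
  assume "\<psi> t \<noteq> 0"
  then have "t \<in> {x. \<psi> x \<noteq> 0}" by simp
  then have "t \<in> closure {x. \<psi> x \<noteq> 0}" by (rule subsetD[OF closure_subset])
  then show False using assms by contradiction
qed

lemma deriv_eq_0_outside_support:
  fixes \<psi> :: "real \<Rightarrow> real"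
  assumes "t \<notin> closure {x. \<psi> x \<noteq> 0}"
  shows "deriv \<psi> t = 0"
proof -
  have "(\<psi> has_field_derivative 0) (at t)"
  proof (rule has_field_derivative_transform_within_open[OF DERIV_const])
    show "open (- closure {x. \<psi> x \<noteq> 0})" "t \<in> - closure {x. \<psi> x \<noteq> 0}" using assms by auto
    show "0 = \<psi> s" if "s \<in> - closure {x. \<psi> x \<noteq> 0}" for s
      using eq_0_outside_support[where \<psi>=\<psi> and t=s] that by simp
  qed
  then show ?thesis by (rule DERIV_imp_deriv)
qed

text \<open>Both the integrand and the boundary values of \<open>\<psi>\<close> vanish outside a compact set, so the integral may be
  taken over a large symmetric interval, which need not be contained in \<open>U\<close>.\<close>

lemma integral_deriv_test_function:
  fixes \<psi> :: "real \<Rightarrow> real"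
  assumes \<psi>: "\<psi> \<in> test_functions U" and U: "U \<in> sets lebesgue"
  shows "(LINT t|lebesgue_on U. deriv \<psi> t) = 0"
proof -
  let ?S = "closure {x. \<psi> x \<noteq> 0}"
  have "Ck (Suc 0) \<psi>" using \<psi> unfolding test_functions_def by blast
  then obtain f' where f': "\<And>x. (\<psi> has_derivative f' x) (at x)" "\<And>d. continuous_on UNIV (\<lambda>x. f' x d)"
    by auto
  have der: "(\<psi> has_real_derivative f' x 1) (at x)" for x
  proof -
    have "f' x = (\<lambda>h. f' x 1 * h)"
    proof
      fix h show "f' x h = f' x 1 * h"
        using linear_cmul[OF has_derivative_linear[OF f'(1)], of x h 1] by simp
    qed
    then show ?thesis using f'(1)[of x] by (simp add: has_field_derivative_def)
  qed
  then have d: "deriv \<psi> = (\<lambda>x. f' x 1)" by (intro ext DERIV_imp_deriv)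
  have "compact ?S" "?S \<subseteq> U" using \<psi> unfolding test_functions_def by blast+
  then have "bounded ?S" by (simp add: compact_imp_bounded)
  then obtain R where R: "R > 0" "\<And>x. x \<in> ?S \<Longrightarrow> \<bar>x\<bar> \<le> R" unfolding bounded_pos real_norm_def by blast
  define c where "c = R + 1"
  have out: "\<psi> x = 0" if "\<not> \<bar>x\<bar> \<le> R" for x
  proof (rule eq_0_outside_support[where \<psi>=\<psi>], rule notI)
    assume "x \<in> ?S"
    from R(2)[OF this] show False using that by contradiction
  qed
  have "\<psi> c = 0" "\<psi> (-c) = 0" using R(1) by (auto intro!: out simp: c_def)
  have "(deriv \<psi> has_integral \<psi> c - \<psi> (- c)) {-c..c}"
    unfolding d
  proof (rule fundamental_theorem_of_calculus)
    show "-c \<le> c" using R(1) by (simp add: c_def)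
    show "(\<psi> has_vector_derivative f' x 1) (at x within {-c..c})" for x
      using der[of x] by (simp add: has_real_derivative_iff_has_vector_derivative has_vector_derivative_at_within)
  qed
  then have "integral {-c..c} (deriv \<psi>) = 0" using \<open>\<psi> c = 0\<close> \<open>\<psi> (-c) = 0\<close> by (simp add: integral_unique)
  moreover have "integrable (lebesgue_on {-c..c}) (deriv \<psi>)"
    unfolding d by (intro continuous_imp_integrable_real continuous_on_subset[OF f'(2)]) auto
  ultimately have "(LINT t|lebesgue_on {-c..c}. deriv \<psi> t) = 0" by (simp add: lebesgue_integral_eq_integral)
  moreover have "indicator {-c..c} t *\<^sub>R deriv \<psi> t = indicator U t *\<^sub>R deriv \<psi> t" for t
  proof (cases "t \<in> ?S")
    case True
    then show ?thesis using R(2)[OF True] \<open>?S \<subseteq> U\<close> by (auto simp: c_def indicator_def)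
  qed (simp add: deriv_eq_0_outside_support)
  then have "(LINT t|lebesgue. indicator {-c..c} t *\<^sub>R deriv \<psi> t) = (LINT t|lebesgue. indicator U t *\<^sub>R deriv \<psi> t)"
    by (rule Bochner_Integration.integral_cong[OF refl])
  moreover have "{-c..c} \<in> sets lebesgue" by simp
  ultimately show ?thesis using U by (simp add: integral_restrict_space)
qed

section \<open>The weak curl and the finite element spaces\<close>

lemma continuous_in_L2:
  fixes g :: "vec3 \<Rightarrow> 'b::euclidean_space"
  assumes \<Omega>: "bounded \<Omega>" "open \<Omega>" and g: "continuous_on UNIV g"
  shows "g \<in> L2 \<Omega>"
proof -
  have "compact (closure \<Omega>)" using \<Omega>(1) by (simp add: compact_closure)
  then have "bounded (g ` closure \<Omega>)"
    using g continuous_on_subset by (blast intro: compact_imp_bounded compact_continuous_image)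
  then obtain C where C: "\<And>x. x \<in> \<Omega> \<Longrightarrow> norm (g x) \<le> C"
    unfolding bounded_iff using closure_subset by (meson imageI subsetD)
  have "(\<lambda>x. 1::real) \<in> L2 \<Omega>" by (rule bounded_L2_domain[OF \<Omega>, where C=1]) auto
  moreover have "g \<in> borel_measurable (lebesgue_on \<Omega>)"
    using g \<Omega>(2) by (intro continuous_imp_measurable_on_sets_lebesgue)
      (auto intro: continuous_on_subset)
  ultimately show ?thesis
    by (rule L2_dominated[where C=C]) (use C in \<open>auto intro!: AE_I2\<close>)
qed

lemma continuous_classical_curl:
  assumes "Ck (Suc 0) \<phi>"
  shows "continuous_on UNIV (classical_curl \<phi>)"
proof -
  obtain f' where f': "\<And>x. (\<phi> has_derivative f' x) (at x)" "\<And>d. continuous_on UNIV (\<lambda>x. f' x d)"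
    using assms by auto
  have eq: "frechet_derivative \<phi> (at x) = f' x" for x using f'(1) frechet_derivative_at by metis
  have "continuous_on UNIV (\<lambda>x. classical_curl \<phi> x $ i)" for i
    using exhaust_3[of i]
    by (elim disjE; simp add: classical_curl_def Let_def eq vector_3; intro continuous_intros f'(2))
  then have "continuous_on UNIV (\<lambda>x. \<chi> i. classical_curl \<phi> x $ i)" by (rule continuous_on_vec_lambda)
  then show ?thesis by simp
qed

text \<open>Linearity needs the pairings with test functions and with their curls to be integrals of integrable
  functions; both are continuous on a bounded set.\<close>

lemma has_weak_curl_add_scaleR:
  assumes \<Omega>: "bounded \<Omega>" "open \<Omega>" and u: "has_weak_curl \<Omega> u c" "has_weak_curl \<Omega> u' c'"
  shows "has_weak_curl \<Omega> (\<lambda>x. u x + s *\<^sub>R u' x) (\<lambda>x. c x + s *\<^sub>R c' x)"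
proof -
  have L: "u \<in> L2 \<Omega>" "c \<in> L2 \<Omega>" "u' \<in> L2 \<Omega>" "c' \<in> L2 \<Omega>" using u unfolding has_weak_curl_def by auto
  have "L2_inner \<Omega> (\<lambda>x. u x + s *\<^sub>R u' x) (classical_curl \<phi>) = L2_inner \<Omega> (\<lambda>x. c x + s *\<^sub>R c' x) \<phi>"
    if \<phi>: "\<phi> \<in> test_functions \<Omega>" for \<phi>
  proof -
    have k: "Ck k \<phi>" for k using \<phi> unfolding test_functions_def by auto
    have "\<phi> \<in> L2 \<Omega>" "classical_curl \<phi> \<in> L2 \<Omega>"
      using k[of 0] continuous_classical_curl[OF k] by (auto intro!: continuous_in_L2[OF \<Omega>])
    then show ?thesis using u \<phi> L
      by (simp add: L2_inner_add_left L2_scaleR L2_inner_scaleR_left has_weak_curl_def)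
  qed
  then show ?thesis unfolding has_weak_curl_def using L by (auto intro: L2_add L2_scaleR)
qed

lemma ND_L2: "v \<in> ND \<Omega> \<T> \<Longrightarrow> v \<in> L2 \<Omega>"
  unfolding ND_def H_curl_def has_weak_curl_def by auto

lemma DG_L2: "w \<in> DG \<Omega> \<T> \<Longrightarrow> w \<in> L2 \<Omega>"
  unfolding DG_def by auto

lemma ND_add_scaleR:
  assumes \<Omega>: "bounded \<Omega>" "open \<Omega>" and u: "u \<in> ND \<Omega> \<T>" "v \<in> ND \<Omega> \<T>"
  shows "(\<lambda>x. u x + s *\<^sub>R v x) \<in> ND \<Omega> \<T>"
proof -
  have "\<exists>a b. \<forall>x\<in>interior K. u x + s *\<^sub>R v x = a + cross3 b x" if K: "K \<in> \<T>" for K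
  proof -
    obtain a b where ab: "\<forall>x\<in>interior K. u x = a + cross3 b x" using u(1) K unfolding ND_def by blast
    obtain a' b' where ab': "\<forall>x\<in>interior K. v x = a' + cross3 b' x" using u(2) K unfolding ND_def by blast
    have "\<forall>x\<in>interior K. u x + s *\<^sub>R v x = (a + s *\<^sub>R a') + cross3 (b + s *\<^sub>R b') x"
      using ab ab' by (simp add: cross_add_left cross_mult_left scaleR_add_right)
    then show ?thesis by blast
  qed
  moreover have "(\<lambda>x. u x + s *\<^sub>R v x) \<in> H_curl \<Omega>"
    using u has_weak_curl_add_scaleR[OF \<Omega>] unfolding ND_def H_curl_def by blast
  moreover have "u x + s *\<^sub>R v x = 0" if "x \<notin> cells \<T>" for x using u that unfolding ND_def by auto
  ultimately show ?thesis unfolding ND_def by blast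
qed

lemma ND_scaleR:
  assumes \<Omega>: "bounded \<Omega>" "open \<Omega>" and u: "u \<in> ND \<Omega> \<T>"
  shows "(\<lambda>x. s *\<^sub>R u x) \<in> ND \<Omega> \<T>"
  using ND_add_scaleR[OF \<Omega> u u, of "s - 1"] by (simp add: algebra_simps)

lemma DG_add_scaleR:
  assumes u: "u \<in> DG \<Omega> \<T>" "v \<in> DG \<Omega> \<T>"
  shows "(\<lambda>x. u x + s *\<^sub>R v x) \<in> DG \<Omega> \<T>"
proof -
  have "\<exists>a. \<forall>x\<in>interior K. u x + s *\<^sub>R v x = a" if K: "K \<in> \<T>" for K
  proof -
    obtain a where a: "\<forall>x\<in>interior K. u x = a" using u(1) K unfolding DG_def by blast
    obtain a' where a': "\<forall>x\<in>interior K. v x = a'" using u(2) K unfolding DG_def by blast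
    show ?thesis using a a' by (intro exI[of _ "a + s *\<^sub>R a'"]) simp
  qed
  moreover have "(\<lambda>x. u x + s *\<^sub>R v x) \<in> L2 \<Omega>" using u by (intro L2_add L2_scaleR DG_L2)
  ultimately show ?thesis using u unfolding DG_def by auto
qed

section \<open>Cells of a mesh\<close>

text \<open>A domain below a Lipschitz graph lies on one side of its boundary: moving up from a boundary point by
  any small distance leads strictly above the graph, hence out of the closure. So a Lipschitz domain has no
  slits, and the open cells of a mesh, which lie in its closure, lie in the domain itself.\<close>

lemma interior_closure_lipschitz_domain:
  assumes "lipschitz_domain \<Omega>"
  shows "interior (closure \<Omega>) \<subseteq> \<Omega>"
proof
  fix x assume x: "x \<in> interior (closure \<Omega>)"
  show "x \<in> \<Omega>"
  proof (rule ccontr)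
    assume nx: "x \<notin> \<Omega>"
    have o: "open \<Omega>" using assms unfolding lipschitz_domain_def by auto
    then have "x \<in> frontier \<Omega>" using x nx interior_subset by (auto simp: frontier_def interior_open)
    then obtain e r L and \<phi> :: "vec3 \<Rightarrow> real" where e: "norm e = 1" "r > 0" "lipschitz_on L UNIV \<phi>"
      and eq: "\<Omega> \<inter> ball x r = {y \<in> ball x r. y \<bullet> e < \<phi> (y - (y \<bullet> e) *\<^sub>R e)}"
      using assms unfolding lipschitz_domain_def by blast
    have ee: "e \<bullet> e = 1" using e(1) by (simp add: norm_eq_1)
    have xe: "x \<bullet> e \<ge> \<phi> (x - (x \<bullet> e) *\<^sub>R e)" using eq nx e(2) by force
    have cont: "continuous_on UNIV \<phi>" using e(3) by (rule lipschitz_on_continuous_on)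
    define U where "U = {y. \<phi> (y - (y \<bullet> e) *\<^sub>R e) < y \<bullet> e}"
    have "open U" unfolding U_def
      by (intro open_Collect_less continuous_intros continuous_on_compose2[OF cont]) auto
    moreover have "U \<inter> ball x r \<inter> \<Omega> = {}"
    proof -
      have "y \<notin> U" if "y \<in> \<Omega> \<inter> ball x r" for y using that unfolding eq U_def by simp
      then show ?thesis by blast
    qed
    ultimately have disj: "U \<inter> ball x r \<inter> closure \<Omega> = {}"
      by (metis open_Int open_Int_closure_eq_empty open_ball)
    obtain d where d: "d > 0" "ball x d \<subseteq> closure \<Omega>"
      using x by (meson interior_subset mem_interior order_trans)
    define s where "s = min d r / 2"
    have s: "s > 0" "s < d" "s < r" using d(1) e(2) by (auto simp: s_def)
    have "dist x (x + s *\<^sub>R e) = s" using s(1) e(1) by (simp add: dist_norm)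
    then have "x + s *\<^sub>R e \<in> ball x r" "x + s *\<^sub>R e \<in> closure \<Omega>" using s d(2) by auto
    moreover have "x + s *\<^sub>R e \<in> U"
      using xe s(1) unfolding U_def by (simp add: inner_add_left ee algebra_simps)
    ultimately show False using disj by blast
  qed
qed

lemma domain_bounded_open:
  assumes "bounded_lipschitz_polyhedral_domain \<Omega>"
  shows "bounded \<Omega>" "open \<Omega>"
  using assms unfolding bounded_lipschitz_polyhedral_domain_def lipschitz_domain_def by auto

locale meshed_domain =
  fixes \<Omega> :: "vec3 set" and \<T> :: "vec3 set set"
  assumes domain: "bounded_lipschitz_polyhedral_domain \<Omega>"
    and mesh: "tetrahedral_mesh \<Omega> \<T>"
begin

lemmas \<Omega>_bounded = domain_bounded_open(1)[OF domain]
  and \<Omega>_open = domain_bounded_open(2)[OF domain]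

lemma finite_mesh: "finite \<T>"
  using mesh unfolding tetrahedral_mesh_def triangulation_def by auto

lemma cell_subset_domain: "K \<in> \<T> \<Longrightarrow> interior K \<subseteq> \<Omega>"
proof -
  assume "K \<in> \<T>"
  then have "interior K \<subseteq> interior (closure \<Omega>)"
    using mesh unfolding tetrahedral_mesh_def by (intro interior_mono) auto
  then show ?thesis using interior_closure_lipschitz_domain domain
    unfolding bounded_lipschitz_polyhedral_domain_def by blast
qed

lemma cell_nonempty_interior: "K \<in> \<T> \<Longrightarrow> interior K \<noteq> {}"
proof -
  assume "K \<in> \<T>"
  then have "3 simplex K" using mesh unfolding tetrahedral_mesh_def by auto
  then have "aff_dim K = 3" "convex K" by (simp_all add: aff_dim_simplex convex_simplex)
  then have "interior K = rel_interior K" "K \<noteq> {}" by (auto simp: interior_rel_interior_gen)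
  then show ?thesis using \<open>convex K\<close> by (simp add: rel_interior_eq_empty)
qed

lemma cell_measure_pos: "K \<in> \<T> \<Longrightarrow> measure lebesgue (interior K) > 0"
proof -
  assume K: "K \<in> \<T>"
  then have "interior K \<in> lmeasurable"
    using cell_subset_domain \<Omega>_bounded by (intro lmeasurable_open) (auto intro: bounded_subset)
  moreover have "\<not> negligible (interior K)" using cell_nonempty_interior[OF K] open_not_negligible by auto
  ultimately show ?thesis by (metis negligible_iff_measure0 measure_nonneg order_le_less)
qed

lemma AE_in_cells: "AE x in lebesgue_on \<Omega>. x \<in> cells \<T>"
proof -
  have conv: "convex K" if "K \<in> \<T>" for K
    using mesh that unfolding tetrahedral_mesh_def by (auto intro: convex_simplex)
  have "negligible (\<Union>K\<in>\<T>. frontier K)"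
    using finite_mesh conv by (intro negligible_Union) (auto intro: negligible_convex_frontier)
  moreover have "\<Omega> - cells \<T> \<subseteq> (\<Union>K\<in>\<T>. frontier K)"
  proof
    fix x assume x: "x \<in> \<Omega> - cells \<T>"
    then obtain K where "K \<in> \<T>" "x \<in> K" using mesh closure_subset unfolding tetrahedral_mesh_def by blast
    then show "x \<in> (\<Union>K\<in>\<T>. frontier K)" using x closure_subset unfolding cells_def frontier_def by auto
  qed
  ultimately have "\<Omega> - cells \<T> \<in> null_sets lebesgue"
    by (metis negligible_iff_null_sets negligible_subset)
  then have "AE x in lebesgue. x \<in> \<Omega> \<longrightarrow> x \<in> cells \<T>" by (auto intro!: AE_I')
  then show ?thesis using \<Omega>_open by (subst AE_restrict_space_iff) auto
qed

lemma integral_cell_le: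
  fixes g :: "vec3 \<Rightarrow> real"
  assumes K: "K \<in> \<T>" and g: "integrable (lebesgue_on \<Omega>) g" "\<And>x. 0 \<le> g x"
  shows "(LINT x|lebesgue_on (interior K). g x) \<le> (LINT x|lebesgue_on \<Omega>. g x)"
proof -
  have \<Omega>: "\<Omega> \<in> sets lebesgue" using \<Omega>_open by auto
  have i: "integrable lebesgue (\<lambda>x. indicator \<Omega> x *\<^sub>R g x)"
    using g(1) \<Omega> by (simp add: integrable_restrict_space)
  have i2: "integrable lebesgue (\<lambda>x. indicator (interior K) x *\<^sub>R g x)"
  proof -
    have "integrable lebesgue (\<lambda>x. indicator (interior K) x *\<^sub>R (indicator \<Omega> x *\<^sub>R g x))"
      by (rule integrable_mult_indicator[OF _ i]) auto
    moreover have "indicator (interior K) x *\<^sub>R (indicator \<Omega> x *\<^sub>R g x) = indicator (interior K) x *\<^sub>R g x" for x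
      using cell_subset_domain[OF K] by (auto simp: indicator_def)
    ultimately show ?thesis by (simp only:)
  qed
  have "(LINT x|lebesgue. indicator (interior K) x *\<^sub>R g x) \<le> (LINT x|lebesgue. indicator \<Omega> x *\<^sub>R g x)"
    using cell_subset_domain[OF K] g(2) by (intro integral_mono i i2) (auto simp: indicator_def)
  then show ?thesis using \<Omega> by (simp add: integral_restrict_space)
qed

lemma cell_L2_le:
  fixes v :: "vec3 \<Rightarrow> 'b::euclidean_space"
  assumes "K \<in> \<T>" "v \<in> L2 \<Omega>"
  shows "(LINT x|lebesgue_on (interior K). (norm (v x))\<^sup>2) \<le> (L2_norm \<Omega> v)\<^sup>2"
  using integral_cell_le[OF assms(1) L2_integrable_square[OF assms(2)]]
  by (simp add: L2_norm_square L2_inner_def power2_norm_eq_inner)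

text \<open>Inverse estimate for piecewise constants: on a cell of volume \<open>V\<close> the value \<open>a\<close> contributes \<open>V \<bar>a\<bar>\<^sup>2\<close>
  to the squared \<open>L\<^sup>2\<close> norm.\<close>

lemma DG_cell_bound:
  assumes w: "w \<in> DG \<Omega> \<T>" and K: "K \<in> \<T>" and x: "x \<in> interior K"
  shows "norm (w x) \<le> L2_norm \<Omega> w / sqrt (measure lebesgue (interior K))"
proof -
  obtain a where a: "\<And>y. y \<in> interior K \<Longrightarrow> w y = a" using w K unfolding DG_def by blast
  have "(LINT y|lebesgue_on (interior K). (norm (w y))\<^sup>2) = (LINT y|lebesgue_on (interior K). (norm a)\<^sup>2)"
    by (intro Bochner_Integration.integral_cong) (auto simp: a)
  also have "\<dots> = (norm a)\<^sup>2 * measure lebesgue (interior K)"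
    by (simp add: measure_restrict_space)
  finally have "(norm a)\<^sup>2 * measure lebesgue (interior K) \<le> (L2_norm \<Omega> w)\<^sup>2"
    using cell_L2_le[OF K DG_L2[OF w]] by simp
  then have "sqrt ((norm a)\<^sup>2 * measure lebesgue (interior K)) \<le> sqrt ((L2_norm \<Omega> w)\<^sup>2)"
    by (rule real_sqrt_le_mono)
  then have "norm a * sqrt (measure lebesgue (interior K)) \<le> L2_norm \<Omega> w"
    by (simp add: real_sqrt_mult L2_norm_nonneg)
  then show ?thesis using cell_measure_pos[OF K] a[OF x] by (simp add: field_simps)
qed

end

text \<open>The value of an affine function at the centre of a ball is the mean of its values at \<open>x\<close> and at the
  reflected point \<open>2 x0 - x\<close>. By convexity of the square, integrating over the ball, which the
  reflection preserves, gives the estimate.\<close>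

lemma affine_mean_value_square:
  fixes u :: "vec3 \<Rightarrow> vec3"
  assumes u: "\<And>x. u x = a + cross3 b x" and r: "r > 0"
  shows "measure lebesgue (ball x0 r) * (norm (u x0))\<^sup>2 \<le> (LINT x|lebesgue_on (ball x0 r). (norm (u x))\<^sup>2)"
proof -
  define g where "g x = indicator (ball x0 r) x *\<^sub>R (norm (u x))\<^sup>2" for x
  have uc: "continuous_on UNIV u"
    unfolding u by (intro continuous_intros continuous_on_cross)
  have [measurable]: "ball x0 r \<in> sets borel" by simp
  have um [measurable]: "u \<in> borel_measurable borel" by (rule borel_measurable_continuous_onI[OF uc])
  have gm: "g \<in> borel_measurable borel" unfolding g_def by measurable
  have gi: "integrable lborel g"
  proof -
    have "integrable lborel (\<lambda>x. indicator (cball x0 r) x *\<^sub>R (norm (u x))\<^sup>2)"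
      by (rule borel_integrable_compact) (auto intro!: continuous_intros continuous_on_subset[OF uc])
    then show ?thesis
      by (rule Bochner_Integration.integrable_bound) (use gm in \<open>auto simp: g_def indicator_def\<close>)
  qed
  have "distr lborel borel (\<lambda>x. 2 *\<^sub>R x0 + (-1) *\<^sub>R x) = lborel"
    using lborel_affine[of "-1" "2 *\<^sub>R x0"] by (simp add: density_1)
  moreover have refm: "(\<lambda>x. 2 *\<^sub>R x0 + (-1) *\<^sub>R x) \<in> lborel \<rightarrow>\<^sub>M borel" by measurable
  ultimately have refl: "(LINT x|lborel. g (2 *\<^sub>R x0 + (-1) *\<^sub>R x)) = (LINT x|lborel. g x)"
      "integrable lborel (\<lambda>x. g (2 *\<^sub>R x0 + (-1) *\<^sub>R x))"
    using integral_distr[OF refm gm] integrable_distr_eq[OF refm gm] gi by auto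
  have ptw: "2 * (indicator (ball x0 r) x * (norm (u x0))\<^sup>2) \<le> g x + g (2 *\<^sub>R x0 + (-1) *\<^sub>R x)" for x
  proof (cases "x \<in> ball x0 r")
    case True
    let ?y = "2 *\<^sub>R x0 + (-1) *\<^sub>R x"
    have "dist x0 ?y = dist x0 x" by (simp add: dist_norm scaleR_2 norm_minus_commute)
    then have y: "?y \<in> ball x0 r" using True by simp
    have "u x + u ?y = 2 *\<^sub>R u x0"
      unfolding u by (simp only: cross_add_right cross_mult_right) (simp add: scaleR_2)
    then have "2 * norm (u x0) \<le> norm (u x) + norm (u ?y)"
      by (metis norm_scaleR norm_triangle_ineq abs_numeral)
    then have "(2 * norm (u x0))\<^sup>2 \<le> (norm (u x) + norm (u ?y))\<^sup>2" by (intro power_mono) auto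
    also have "\<dots> \<le> 2 * (norm (u x))\<^sup>2 + 2 * (norm (u ?y))\<^sup>2"
      using sum_squares_bound[of "norm (u x)" "norm (u ?y)"] by (simp add: power2_sum)
    finally show ?thesis using True y by (simp add: g_def)
  qed (simp add: g_def)
  have ii: "integrable lborel (\<lambda>x. 2 * (indicator (ball x0 r) x * (norm (u x0))\<^sup>2))"
    using emeasure_lborel_ball_finite[of x0 r] by (intro integrable_mult_right integrable_mult_left integrable_real_indicator) auto
  have "2 * (measure lborel (ball x0 r) * (norm (u x0))\<^sup>2) = (LINT x|lborel. 2 * (indicator (ball x0 r) x * (norm (u x0))\<^sup>2))"
    by simp
  also have "\<dots> \<le> (LINT x|lborel. g x + g (2 *\<^sub>R x0 + (-1) *\<^sub>R x))"
    using gi refl(2) ii ptw by (intro integral_mono) auto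
  also have "\<dots> = 2 * (LINT x|lborel. g x)" using gi refl by simp
  also have "(LINT x|lborel. g x) = (LINT x|lebesgue. g x)"
    using gm by (intro integral_completion[symmetric]) simp
  also have "\<dots> = (LINT x|lebesgue_on (ball x0 r). (norm (u x))\<^sup>2)"
    unfolding g_def by (simp add: integral_restrict_space)
  finally show ?thesis by simp
qed

context meshed_domain
begin

text \<open>Inverse estimate for the local polynomials. Around a point \<open>c\<close> of the cell there is a ball of radius \<open>r\<close> all of
  whose points are centres of balls of radius \<open>r\<close> inside the cell, so the mean value estimate bounds the
  affine function there. Any point of the cell arises from a point of this ball by a dilation about \<open>c\<close>, under
  which an affine function grows at most by a factor depending on the ratio \<open>s\<close>.\<close>

lemma ND_cell_bound:
  assumes K: "K \<in> \<T>"
  shows "\<exists>C\<ge>0. \<forall>v\<in>ND \<Omega> \<T>. \<forall>x\<in>interior K. norm (v x) \<le> C * L2_norm \<Omega> v"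
proof -
  obtain c where c: "c \<in> interior K" using cell_nonempty_interior[OF K] by auto
  obtain r0 where r0: "r0 > 0" "ball c r0 \<subseteq> interior K"
    using c open_contains_ball by (metis open_interior)
  define r where "r = r0 / 2"
  have r: "r > 0" using r0 by (simp add: r_def)
  have rad: "ball x r \<subseteq> interior K" if "dist c x \<le> r" for x
  proof
    fix y assume "y \<in> ball x r"
    then have "dist c y < r0" using that dist_triangle[of c y x] by (simp add: r_def)
    then show "y \<in> interior K" using r0 by auto
  qed
  have "bounded (interior K)" using cell_subset_domain[OF K] \<Omega>_bounded bounded_subset by blast
  then obtain D where D: "\<And>x. x \<in> interior K \<Longrightarrow> dist c x \<le> D"
    unfolding bounded_any_center[of _ c] by auto
  have D0: "D \<ge> 0" using D[OF c] by simp
  define s where "s = D / r + 1"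
  have s: "s \<ge> 1" "D \<le> s * r" using D0 r by (auto simp: s_def field_simps)
  define m where "m = measure lebesgue (ball c r)"
  have m: "m > 0" using content_ball_pos[OF r, of c] by (simp add: m_def)
  have mball: "measure lebesgue (ball x r) = m" for x :: vec3
    using content_ball_conv_unit_ball[of r c] content_ball_conv_unit_ball[of r x] r by (simp add: m_def)
  define C where "C = (2 * s) / sqrt m"
  have "norm (v x) \<le> C * L2_norm \<Omega> v" if v: "v \<in> ND \<Omega> \<T>" and x: "x \<in> interior K" for v x
  proof -
    obtain a b where ab: "\<And>y. y \<in> interior K \<Longrightarrow> v y = a + cross3 b y" using v K unfolding ND_def by blast
    define u where "u y = a + cross3 b y" for y
    have near: "norm (u y) \<le> L2_norm \<Omega> v / sqrt m" if y: "dist c y \<le> r" for y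
    proof -
      have i: "(LINT z|lebesgue_on (ball y r). (norm (u z))\<^sup>2) \<le> (L2_norm \<Omega> v)\<^sup>2"
      proof -
        have ii: "integrable (lebesgue_on (interior K)) (\<lambda>z. (norm (u z))\<^sup>2)"
        proof -
          have "continuous_on UNIV u"
            unfolding u_def by (intro continuous_intros continuous_on_cross)
          then have "u \<in> L2 (interior K)"
            using cell_subset_domain[OF K] \<Omega>_bounded bounded_subset by (intro continuous_in_L2) auto
          then show ?thesis by (rule L2_integrable_square)
        qed
        have e1: "(LINT z|lebesgue_on (ball y r). (norm (u z))\<^sup>2) = (LINT z|lebesgue. indicator (ball y r) z *\<^sub>R (norm (u z))\<^sup>2)"
          by (simp add: integral_restrict_space)
        have e2: "(LINT z|lebesgue_on (interior K). (norm (u z))\<^sup>2) = (LINT z|lebesgue. indicator (interior K) z *\<^sub>R (norm (u z))\<^sup>2)"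
          by (simp add: integral_restrict_space)
        have i2: "integrable lebesgue (\<lambda>z. indicator (interior K) z *\<^sub>R (norm (u z))\<^sup>2)"
          using ii by (simp add: integrable_restrict_space)
        have "integrable lebesgue (\<lambda>z. indicator (ball y r) z *\<^sub>R (indicator (interior K) z *\<^sub>R (norm (u z))\<^sup>2))"
          by (rule integrable_mult_indicator[OF _ i2]) auto
        moreover have "indicator (ball y r) z *\<^sub>R (indicator (interior K) z *\<^sub>R (norm (u z))\<^sup>2) = indicator (ball y r) z *\<^sub>R (norm (u z))\<^sup>2" for z
          using rad[OF y] by (auto simp: indicator_def)
        ultimately have i1: "integrable lebesgue (\<lambda>z. indicator (ball y r) z *\<^sub>R (norm (u z))\<^sup>2)"
          by (simp only:)
        have "(LINT z|lebesgue_on (ball y r). (norm (u z))\<^sup>2) \<le> (LINT z|lebesgue_on (interior K). (norm (u z))\<^sup>2)"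
          unfolding e1 e2 using rad[OF y] by (intro integral_mono i1 i2) (auto simp: indicator_def)
        also have "\<dots> = (LINT z|lebesgue_on (interior K). (norm (v z))\<^sup>2)"
          by (intro Bochner_Integration.integral_cong) (auto simp: ab u_def)
        also have "\<dots> \<le> (L2_norm \<Omega> v)\<^sup>2" by (rule cell_L2_le[OF K ND_L2[OF v]])
        finally show ?thesis .
      qed
      have "m * (norm (u y))\<^sup>2 \<le> (L2_norm \<Omega> v)\<^sup>2"
        using affine_mean_value_square[of u a b r y] u_def r i mball[of y] by simp
      then have "sqrt (m * (norm (u y))\<^sup>2) \<le> sqrt ((L2_norm \<Omega> v)\<^sup>2)" by (rule real_sqrt_le_mono)
      then have "sqrt m * norm (u y) \<le> L2_norm \<Omega> v" by (simp add: real_sqrt_mult L2_norm_nonneg)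
      then show ?thesis using m by (simp add: field_simps)
    qed
    define y where "y = c + (1 / s) *\<^sub>R (x - c)"
    have "dist c y = dist c x / s" using s(1) by (simp add: y_def dist_norm norm_minus_commute)
    also have "\<dots> \<le> r" using D[OF x] s r by (simp add: field_simps)
    finally have y: "dist c y \<le> r" .
    have "u x = (1 - s) *\<^sub>R u c + s *\<^sub>R u y"
      using s(1) unfolding u_def y_def
      by (simp add: cross_add_right cross_mult_right Cross3.right_diff_distrib algebra_simps)
    then have "norm (u x) \<le> norm ((1 - s) *\<^sub>R u c) + norm (s *\<^sub>R u y)" by (metis norm_triangle_ineq)
    also have "\<dots> = (s - 1) * norm (u c) + s * norm (u y)" using s(1) by simp
    also have "\<dots> \<le> s * (L2_norm \<Omega> v / sqrt m) + s * (L2_norm \<Omega> v / sqrt m)"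
      using near[of c] near[OF y] s(1) r by (intro add_mono mult_mono) auto
    also have "\<dots> = C * L2_norm \<Omega> v" by (simp add: C_def)
    finally show ?thesis using ab[OF x] by (simp add: u_def)
  qed
  moreover have "C \<ge> 0" using s(1) m by (simp add: C_def)
  ultimately show ?thesis by blast
qed

lemma ND_sup_bound:
  obtains C where "C \<ge> 0" "\<And>v x. v \<in> ND \<Omega> \<T> \<Longrightarrow> norm (v x) \<le> C * L2_norm \<Omega> v"
proof -
  obtain C where C: "\<And>K. K \<in> \<T> \<Longrightarrow> C K \<ge> 0 \<and> (\<forall>v\<in>ND \<Omega> \<T>. \<forall>x\<in>interior K. norm (v x) \<le> C K * L2_norm \<Omega> v)"
    using ND_cell_bound by metis
  have "norm (v x) \<le> (\<Sum>K\<in>\<T>. C K) * L2_norm \<Omega> v" if v: "v \<in> ND \<Omega> \<T>" for v x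
  proof (cases "x \<in> cells \<T>")
    case True
    then obtain K where K: "K \<in> \<T>" "x \<in> interior K" unfolding cells_def by auto
    then have "norm (v x) \<le> C K * L2_norm \<Omega> v" using C v by blast
    also have "\<dots> \<le> (\<Sum>K\<in>\<T>. C K) * L2_norm \<Omega> v"
      using C K finite_mesh by (intro mult_right_mono member_le_sum L2_norm_nonneg) auto
    finally show ?thesis .
  next
    case False
    then have "v x = 0" using v unfolding ND_def by auto
    then show ?thesis using C by (simp add: sum_nonneg L2_norm_nonneg)
  qed
  moreover have "(\<Sum>K\<in>\<T>. C K) \<ge> 0" using C by (simp add: sum_nonneg)
  ultimately show ?thesis using that by blast
qed

end

section \<open>Tangential traces\<close>

text \<open>The outer normal is defined by definite description, so its uniqueness has to be shown. If \<open>n \<noteq> n'\<close> were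
  both outer normals at \<open>x\<close>, then \<open>x + s (n' - n)\<close> with small \<open>s > 0\<close> would lie on the inner side of one half-space and on
  the outer side of the other.\<close>

lemma outer_normal_le_1: "norm (outer_normal \<Omega> x) \<le> 1"
proof (cases "\<exists>n. is_outer_normal \<Omega> x n")
  case True
  have unique: "n = n'" if n: "is_outer_normal \<Omega> x n" and n': "is_outer_normal \<Omega> x n'" for n n'
  proof (rule ccontr)
    assume ne: "n \<noteq> n'"
    obtain r where r: "r > 0" "\<Omega> \<inter> ball x r = {y \<in> ball x r. (y - x) \<bullet> n < 0}"
      using n unfolding is_outer_normal_def by auto
    obtain r' where r': "r' > 0" "\<Omega> \<inter> ball x r' = {y \<in> ball x r'. (y - x) \<bullet> n' < 0}"
      using n' unfolding is_outer_normal_def by auto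
    have nn: "n \<bullet> n = 1" "n' \<bullet> n' = 1" using n n' by (auto simp: is_outer_normal_def norm_eq_1)
    have lt: "n \<bullet> n' < 1"
    proof -
      have "0 < (n - n') \<bullet> (n - n')" using ne by simp
      then show ?thesis using nn by (simp add: inner_diff_left inner_diff_right inner_commute)
    qed
    define s where "s = min r r' / 4"
    define y where "y = x + s *\<^sub>R (n' - n)"
    have s: "s > 0" "s * 2 < r" "s * 2 < r'" using r r' by (auto simp: s_def)
    have "norm (n' - n) \<le> 2" using n n' norm_triangle_ineq4[of n' n] by (simp add: is_outer_normal_def)
    then have "dist x y \<le> s * 2" using s(1) by (simp add: y_def dist_norm mult_left_mono)
    then have y: "y \<in> ball x r" "y \<in> ball x r'" using s by auto
    have "(y - x) \<bullet> n = s * (n \<bullet> n' - 1)" "(y - x) \<bullet> n' = s * (1 - n \<bullet> n')"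
      using nn by (simp_all add: y_def inner_diff_left inner_diff_right inner_commute[of n' n] inner_commute[of _ "n' - n"])
    then have "(y - x) \<bullet> n < 0" "(y - x) \<bullet> n' > 0" using s lt by (auto simp: mult_less_0_iff)
    then show False using y r r' by (smt (verit, best) IntD1 IntI mem_Collect_eq)
  qed
  have "is_outer_normal \<Omega> x (outer_normal \<Omega> x)"
    unfolding outer_normal_def using True theI'[of "is_outer_normal \<Omega> x"] unique by auto
  then show ?thesis by (simp add: is_outer_normal_def)
qed (simp add: outer_normal_def)

text \<open>The trace is a limit of values of \<open>v\<close>, or \<open>0\<close> where there is no limit.\<close>

lemma trace_on_boundary_le:
  assumes "open \<Omega>" "x \<in> frontier \<Omega>" "\<And>y. norm (v y) \<le> C"
  shows "norm (trace_on_boundary \<Omega> v x) \<le> C"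
proof (cases "\<exists>l. (v \<longlongrightarrow> l) (at x within \<Omega>)")
  case True
  have "x \<notin> \<Omega>" "x \<in> closure \<Omega>" using assms by (auto simp: frontier_def interior_open)
  then have nt: "at x within \<Omega> \<noteq> bot"
    by (simp add: closure_def trivial_limit_within)
  obtain l where l: "(v \<longlongrightarrow> l) (at x within \<Omega>)" using True by blast
  then have "norm l \<le> C" using nt assms(3) by (intro Lim_norm_ubound[of _ v]) auto
  moreover have "Lim (at x within \<Omega>) v = l" by (rule tendsto_Lim[OF nt l])
  ultimately show ?thesis using True by (simp add: trace_on_boundary_def)
next
  case False
  have "0 \<le> C" using assms(3) norm_ge_zero order_trans by blast
  then show ?thesis using False by (simp add: trace_on_boundary_def)
qed

lemma tangential_trace_le:
  assumes "open \<Omega>" "x \<in> frontier \<Omega>" "\<And>y. norm (v y) \<le> C"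
  shows "norm (tangential_trace \<Omega> v x) \<le> C"
proof -
  let ?n = "outer_normal \<Omega> x" and ?t = "trace_on_boundary \<Omega> v x"
  have "(norm (cross3 ?n ?t))\<^sup>2 \<le> (norm ?n * norm ?t)\<^sup>2"
    using norm_cross_dot[of ?n ?t] by (metis le_add_same_cancel1 zero_le_power2)
  then have "norm (cross3 ?n ?t) \<le> norm ?n * norm ?t" by (rule power2_le_imp_le) simp
  also have "\<dots> \<le> 1 * C"
    using trace_on_boundary_le[OF assms] outer_normal_le_1 by (intro mult_mono) auto
  finally show ?thesis by (simp add: tangential_trace_def)
qed

section \<open>Area of a polyhedral boundary\<close>

text \<open>Finite covers by small sets with bounded sum of squared diameters: up to the factor \<open>\<pi> / 4\<close>, a uniform
  bound \<open>c\<close> on the sums that define the two-dimensional Hausdorff measure.\<close>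

definition thin_covers :: "vec3 set \<Rightarrow> real \<Rightarrow> bool" where
  "thin_covers A c \<longleftrightarrow> (\<forall>\<delta>>0. \<exists>\<C>. finite \<C> \<and> A \<subseteq> \<Union>\<C> \<and>
     (\<forall>C\<in>\<C>. bounded C \<and> diameter C \<le> \<delta>) \<and> (\<Sum>C\<in>\<C>. (diameter C)\<^sup>2) \<le> c)"

lemma thin_covers_empty: "thin_covers {} 0"
  unfolding thin_covers_def by (auto intro!: exI[of _ "{}"])

lemma thin_covers_Un:
  assumes "thin_covers A c" "thin_covers B d"
  shows "thin_covers (A \<union> B) (c + d)"
  unfolding thin_covers_def
proof (intro allI impI)
  fix \<delta> :: real assume d: "\<delta> > 0"
  obtain \<C> where C: "finite \<C>" "A \<subseteq> \<Union>\<C>" "\<forall>C\<in>\<C>. bounded C \<and> diameter C \<le> \<delta>" "(\<Sum>C\<in>\<C>. (diameter C)\<^sup>2) \<le> c"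
    using assms(1) d unfolding thin_covers_def by blast
  obtain \<D> where D: "finite \<D>" "B \<subseteq> \<Union>\<D>" "\<forall>C\<in>\<D>. bounded C \<and> diameter C \<le> \<delta>" "(\<Sum>C\<in>\<D>. (diameter C)\<^sup>2) \<le> d"
    using assms(2) d unfolding thin_covers_def by blast
  have "(\<Sum>C\<in>\<C>\<union>\<D>. (diameter C)\<^sup>2) \<le> (\<Sum>C\<in>\<C>. (diameter C)\<^sup>2) + (\<Sum>C\<in>\<D>. (diameter C)\<^sup>2)"
    using C(1) D(1) by (simp add: sum_Un sum_nonneg)
  then have "(\<Sum>C\<in>\<C>\<union>\<D>. (diameter C)\<^sup>2) \<le> c + d" using C(4) D(4) by linarith
  then show "\<exists>\<C>. finite \<C> \<and> A \<union> B \<subseteq> \<Union>\<C> \<and> (\<forall>C\<in>\<C>. bounded C \<and> diameter C \<le> \<delta>) \<and> (\<Sum>C\<in>\<C>. (diameter C)\<^sup>2) \<le> c + d"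
    using C D by (intro exI[of _ "\<C> \<union> \<D>"]) auto
qed

lemma thin_covers_Union:
  assumes "finite \<F>" "\<And>F. F \<in> \<F> \<Longrightarrow> \<exists>c. thin_covers F c"
  shows "\<exists>c. thin_covers (\<Union>\<F>) c"
  using assms by (induction \<F>) (auto intro: thin_covers_empty thin_covers_Un)

lemma hausdorff2_finite:
  assumes "thin_covers A c"
  shows "hausdorff2 A < \<infinity>"
proof -
  have "hausdorff2 A \<le> ennreal (pi / 4 * c)"
    unfolding hausdorff2_def
  proof (rule SUP_least)
    fix \<delta> :: real assume "\<delta> \<in> {0<..}"
    then have d: "\<delta> > 0" by simp
    obtain \<C> where C: "finite \<C>" "A \<subseteq> \<Union>\<C>" "\<forall>C\<in>\<C>. bounded C \<and> diameter C \<le> \<delta>" "(\<Sum>C\<in>\<C>. (diameter C)\<^sup>2) \<le> c"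
      using assms d unfolding thin_covers_def by blast
    obtain f where f: "bij_betw f {..<card \<C>} \<C>"
      using C(1) ex_bij_betw_nat_finite[of \<C>] by (auto simp: atLeast0LessThan)
    define g where "g i = (if i < card \<C> then f i else {})" for i
    have fim: "f ` {..<card \<C>} = \<C>" using f by (simp add: bij_betw_def)
    have "(\<Sum>i. ennreal (pi / 4 * (diameter (g i))\<^sup>2)) = (\<Sum>i<card \<C>. ennreal (pi / 4 * (diameter (g i))\<^sup>2))"
      by (intro suminf_finite) (auto simp: g_def)
    also have "\<dots> = (\<Sum>i<card \<C>. ennreal (pi / 4 * (diameter (f i))\<^sup>2))" by (simp add: g_def)
    also have "\<dots> = (\<Sum>C\<in>\<C>. ennreal (pi / 4 * (diameter C)\<^sup>2))" by (rule sum.reindex_bij_betw[OF f])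
    also have "\<dots> = ennreal (\<Sum>C\<in>\<C>. pi / 4 * (diameter C)\<^sup>2)" by (rule sum_ennreal) simp
    also have "\<dots> \<le> ennreal (pi / 4 * c)"
      unfolding sum_distrib_left[symmetric] using C(4) by (intro ennreal_leI mult_left_mono) auto
    finally have le: "(\<Sum>i. ennreal (pi / 4 * (diameter (g i))\<^sup>2)) \<le> ennreal (pi / 4 * c)" .
    have "bounded (g i) \<and> diameter (g i) \<le> \<delta>" for i
      using C(3) fim d by (auto simp: g_def)
    moreover have "A \<subseteq> (\<Union>i. g i)"
    proof
      fix x assume "x \<in> A"
      then obtain i where "i < card \<C>" "x \<in> f i" using C(2) fim by blast
      then show "x \<in> (\<Union>i. g i)" by (auto simp: g_def intro!: exI[of _ i])
    qed
    ultimately have "g \<in> {C. A \<subseteq> (\<Union>i. C i) \<and> (\<forall>i. bounded (C i) \<and> diameter (C i) \<le> \<delta>)}" by blast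
    then show "(INF C\<in>{C. A \<subseteq> (\<Union>i. C i) \<and> (\<forall>i. bounded (C i) \<and> diameter (C i) \<le> \<delta>)}.
        \<Sum>i. ennreal (pi / 4 * (diameter (C i))\<^sup>2)) \<le> ennreal (pi / 4 * c)"
      using le by (intro INF_lower2)
  qed
  then show ?thesis by (simp add: order_le_less_trans)
qed

text \<open>If two bounded functions \<open>p\<close>, \<open>q\<close> are Lipschitz coordinates on \<open>A\<close>, sort the points of \<open>A\<close> by the squares of
  side \<open>1/N\<close> that contain \<open>(p x, q x)\<close>. There are of the order of \<open>N\<^sup>2\<close> such pieces, each of diameter at most \<open>2 L / N\<close>.\<close>

lemma thin_covers_two_parameters:
  fixes A :: "vec3 set" and p q :: "vec3 \<Rightarrow> real"
  assumes L: "L \<ge> 0" "\<And>x y. x \<in> A \<Longrightarrow> y \<in> A \<Longrightarrow> dist x y \<le> L * (\<bar>p x - p y\<bar> + \<bar>q x - q y\<bar>)"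
    and R: "\<And>x. x \<in> A \<Longrightarrow> \<bar>p x\<bar> \<le> R \<and> \<bar>q x\<bar> \<le> R" "R \<ge> 0"
  shows "thin_covers A ((2 * R + 5)\<^sup>2 * (2 * L)\<^sup>2)"
  unfolding thin_covers_def
proof (intro allI impI)
  fix \<delta> :: real assume d: "\<delta> > 0"
  obtain N0 :: nat where N0: "real N0 \<ge> 2 * L / \<delta>" by (meson real_arch_simple)
  define N where "N = Suc N0"
  have N: "real N \<ge> 1" "2 * L / real N \<le> \<delta>"
  proof -
    show "real N \<ge> 1" by (simp add: N_def)
    have "2 * L \<le> \<delta> * real N0" using N0 d by (simp add: field_simps)
    also have "\<dots> \<le> \<delta> * real N" using d by (simp add: N_def)
    finally show "2 * L / real N \<le> \<delta>" by (simp add: N_def field_simps)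
  qed
  define piece where "piece = (\<lambda>(i::int, j::int). {x \<in> A. \<lfloor>real N * p x\<rfloor> = i \<and> \<lfloor>real N * q x\<rfloor> = j})"
  define M where "M = \<lceil>real N * R\<rceil> + 1"
  define \<C> where "\<C> = piece ` ({-M..M} \<times> {-M..M})"
  have diam: "dist x y \<le> 2 * L / real N" if xy: "x \<in> piece ij" "y \<in> piece ij" for ij x y
  proof -
    have close: "\<bar>s - t\<bar> \<le> 1 / real N" if "\<lfloor>real N * s\<rfloor> = \<lfloor>real N * t\<rfloor>" for s t
    proof -
      have "\<bar>real N * s - real N * t\<bar> \<le> 1" using that by linarith
      then have "real N * \<bar>s - t\<bar> \<le> 1" by (simp add: abs_mult flip: right_diff_distrib)
      then show ?thesis using N by (simp add: field_simps)
    qed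
    have "dist x y \<le> L * (\<bar>p x - p y\<bar> + \<bar>q x - q y\<bar>)"
      using xy by (intro L(2)) (auto simp: piece_def split: prod.splits)
    also have "\<dots> \<le> L * (1 / real N + 1 / real N)"
      using xy by (intro mult_left_mono add_mono close L(1)) (auto simp: piece_def split: prod.splits)
    finally show ?thesis by (simp add: mult.commute)
  qed
  have bd: "bounded C \<and> diameter C \<le> 2 * L / real N" if C: "C \<in> \<C>" for C
  proof -
    obtain ij where ij: "C = piece ij" using C unfolding \<C>_def by blast
    have "bounded C"
    proof (cases "C = {}")
      case False
      then obtain x where "x \<in> C" by blast
      then show ?thesis using diam ij unfolding bounded_def by blast
    qed simp
    moreover have "diameter C \<le> 2 * L / real N"
      using diam ij L(1) N by (intro diameter_le) (auto simp: dist_norm)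
    ultimately show ?thesis by blast
  qed
  have cover: "A \<subseteq> \<Union>\<C>"
  proof
    fix x assume x: "x \<in> A"
    have fl: "\<lfloor>real N * s\<rfloor> \<in> {-M..M}" if "\<bar>s\<bar> \<le> R" for s
    proof -
      have "\<bar>real N * s\<bar> \<le> real N * R" using that N by (simp add: abs_mult mult_left_mono)
      then show ?thesis unfolding M_def by (simp add: floor_le_iff le_floor_iff) linarith
    qed
    have "x \<in> piece (\<lfloor>real N * p x\<rfloor>, \<lfloor>real N * q x\<rfloor>)" using x by (simp add: piece_def)
    then show "x \<in> \<Union>\<C>" using fl R(1)[OF x] unfolding \<C>_def by blast
  qed
  have M0: "M \<ge> 0"
  proof -
    have "0 \<le> real N * R" using R(2) by simp
    then show ?thesis unfolding M_def by linarith
  qed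
  have "(\<Sum>C\<in>\<C>. (diameter C)\<^sup>2) \<le> (\<Sum>C\<in>\<C>. (2 * L / real N)\<^sup>2)"
    using bd by (intro sum_mono power_mono diameter_ge_0) auto
  also have "\<dots> = real (card \<C>) * (2 * L / real N)\<^sup>2" by simp
  also have "\<dots> \<le> (real N * (2 * R + 5))\<^sup>2 * (2 * L / real N)\<^sup>2"
  proof (intro mult_right_mono)
    have "card \<C> \<le> card ({-M..M} \<times> {-M..M})" unfolding \<C>_def by (rule card_image_le) simp
    also have "\<dots> = (nat (2 * M + 1))\<^sup>2" by (simp add: card_cartesian_product power2_eq_square)
    finally have "real (card \<C>) \<le> (real_of_int (2 * M + 1))\<^sup>2"
      using M0 by (metis of_nat_le_iff of_nat_power of_nat_nat add_nonneg_nonneg zero_le_mult_iff zero_le_one zero_le_numeral  of_int_of_nat_eq)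
    also have "\<dots> \<le> (real N * (2 * R + 5))\<^sup>2"
    proof (rule power_mono)
      have "real_of_int M \<le> real N * R + 2" unfolding M_def by linarith
      then show "real_of_int (2 * M + 1) \<le> real N * (2 * R + 5)" using N by (simp add: algebra_simps)
    qed (use M0 in simp)
    finally show "real (card \<C>) \<le> (real N * (2 * R + 5))\<^sup>2" .
  qed simp
  also have "\<dots> = (2 * R + 5)\<^sup>2 * (2 * L)\<^sup>2" using N by (simp add: power_mult_distrib power_divide)
  finally have "(\<Sum>C\<in>\<C>. (diameter C)\<^sup>2) \<le> (2 * R + 5)\<^sup>2 * (2 * L)\<^sup>2" .
  moreover have "finite \<C>" by (simp add: \<C>_def)
  moreover have "\<forall>C\<in>\<C>. bounded C \<and> diameter C \<le> \<delta>" using bd N(2) by force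
  ultimately show "\<exists>\<C>. finite \<C> \<and> A \<subseteq> \<Union>\<C> \<and> (\<forall>C\<in>\<C>. bounded C \<and> diameter C \<le> \<delta>) \<and>
      (\<Sum>C\<in>\<C>. (diameter C)\<^sup>2) \<le> (2 * R + 5)\<^sup>2 * (2 * L)\<^sup>2"
    using cover by blast
qed

text \<open>A set of dimension at most two lies in a plane. If the \<open>k\<close>-th component of the normal vector is nonzero, the plane is a Lipschitz
  graph over the other two coordinates \<open>i\<close>, \<open>j\<close>.\<close>

lemma thin_covers_flat:
  fixes F :: "vec3 set"
  assumes bF: "bounded F" and F: "aff_dim F < 3"
  shows "\<exists>c. thin_covers F c"
proof -
  obtain a \<beta> where a: "a \<noteq> 0" "F \<subseteq> {x. a \<bullet> x = \<beta>}"
    using aff_lowdim_subset_hyperplane[of F] F by auto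
  obtain R where R: "\<And>x. x \<in> F \<Longrightarrow> norm x \<le> R" "R \<ge> 0"
    using bF by (meson bounded_pos less_imp_le)
  have comp: "\<bar>x $ i\<bar> \<le> R" if "x \<in> F" for x i
    using R(1)[OF that] component_le_norm_cart[of x i] by linarith
  have "\<exists>i j k. (\<forall>l::3. l = i \<or> l = j \<or> l = k) \<and> i \<noteq> j \<and> i \<noteq> k \<and> j \<noteq> k \<and> a $ k \<noteq> 0"
  proof -
    obtain k where k: "a $ k \<noteq> 0" using a(1) by (auto simp: vec_eq_iff)
    have "\<exists>i j. (\<forall>l::3. l = i \<or> l = j \<or> l = k) \<and> i \<noteq> j \<and> i \<noteq> k \<and> j \<noteq> k"
    proof -
      have "(\<forall>l::3. l = 2 \<or> l = 3 \<or> l = 1)" "(\<forall>l::3. l = 1 \<or> l = 3 \<or> l = 2)" "(\<forall>l::3. l = 1 \<or> l = 2 \<or> l = 3)"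
        "(1::3) \<noteq> 2" "(1::3) \<noteq> 3" "(2::3) \<noteq> 3" by (simp_all add: forall_3)
      then show ?thesis using exhaust_3[of k] by metis
    qed
    then show ?thesis using k by blast
  qed
  then obtain i j k :: 3 where ijk: "\<And>l. l = i \<or> l = j \<or> l = k" "i \<noteq> j" "i \<noteq> k" "j \<noteq> k" "a $ k \<noteq> 0" by blast
  have sum3: "(\<Sum>l\<in>UNIV. f l) = f i + f j + f k" for f :: "3 \<Rightarrow> real"
  proof -
    have U: "(UNIV::3 set) = {i, j, k}" using ijk(1) by auto
    have "i \<notin> {j, k}" "j \<notin> {k}" using ijk by auto
    then show ?thesis unfolding U by (simp add: add.assoc)
  qed
  define L where "L = 1 + (\<bar>a $ i\<bar> + \<bar>a $ j\<bar>) / \<bar>a $ k\<bar>"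
  have L0: "L \<ge> 0" by (simp add: L_def)
  have "dist x y \<le> L * (\<bar>x $ i - y $ i\<bar> + \<bar>x $ j - y $ j\<bar>)" if xy: "x \<in> F" "y \<in> F" for x y
  proof -
    define z where "z = x - y"
    have "a \<bullet> z = 0" using a(2) xy by (auto simp: z_def inner_diff_right)
    then have "a $ i * z $ i + a $ j * z $ j + a $ k * z $ k = 0" by (simp add: inner_vec_def sum3)
    then have "\<bar>a $ k\<bar> * \<bar>z $ k\<bar> = \<bar>a $ i * z $ i + a $ j * z $ j\<bar>"
      by (simp add: abs_mult[symmetric]) 
    also have "\<dots> \<le> \<bar>a $ i\<bar> * \<bar>z $ i\<bar> + \<bar>a $ j\<bar> * \<bar>z $ j\<bar>"
      by (simp add: abs_mult[symmetric])
    also have "\<dots> \<le> (\<bar>a $ i\<bar> + \<bar>a $ j\<bar>) * (\<bar>z $ i\<bar> + \<bar>z $ j\<bar>)" by (simp add: algebra_simps)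
    finally have "\<bar>z $ k\<bar> \<le> (\<bar>a $ i\<bar> + \<bar>a $ j\<bar>) / \<bar>a $ k\<bar> * (\<bar>z $ i\<bar> + \<bar>z $ j\<bar>)"
      using ijk(5) by (simp add: field_simps)
    moreover have "norm z \<le> \<bar>z $ i\<bar> + \<bar>z $ j\<bar> + \<bar>z $ k\<bar>" using norm_le_l1_cart[of z] by (simp add: sum3)
    ultimately show ?thesis by (simp add: z_def dist_norm L_def algebra_simps)
  qed
  then have "thin_covers F ((2 * R + 5)\<^sup>2 * (2 * L)\<^sup>2)"
    using comp R(2) L0 by (intro thin_covers_two_parameters[where p="\<lambda>x. x $ i" and q="\<lambda>x. x $ j"]) auto
  then show ?thesis by blast
qed

lemma hausdorff2_frontier_finite:
  assumes "polyhedral_boundary \<Omega>"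
  shows "hausdorff2 (frontier \<Omega>) < \<infinity>"
proof -
  obtain \<F> where F: "finite \<F>" "\<forall>F\<in>\<F>. polytope F \<and> aff_dim F = 2" "frontier \<Omega> = \<Union>\<F>"
    using assms unfolding polyhedral_boundary_def by blast
  have "\<exists>c. thin_covers F c" if "F \<in> \<F>" for F
    using F(2) that by (intro thin_covers_flat) (auto simp: polytope_imp_bounded)
  then show ?thesis using thin_covers_Union[OF F(1)] hausdorff2_finite F(3) by auto
qed

text \<open>\<^const>\<open>measure_of\<close> yields either the given set function or, when that is not countably additive, the zero
  measure. The bound holds in both cases.\<close>

lemma finite_surface_measure:
  assumes "polyhedral_boundary \<Omega>"
  shows "finite_measure (surface_measure \<Omega>)"
    and "space (surface_measure \<Omega>) = frontier \<Omega>"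
proof -
  let ?H = "measure_of UNIV (sets borel) hausdorff2 :: vec3 measure"
  have sH: "sets ?H = sets borel" 
    by (metis sets.sigma_sets_eq sets_measure_of sets.space_closed space_borel)
  have fH: "frontier \<Omega> \<in> sets ?H" unfolding sH by simp
  have "emeasure ?H (frontier \<Omega>) \<le> hausdorff2 (frontier \<Omega>)"
    by (simp add: emeasure_measure_of_conv)
  then have fin: "emeasure ?H (frontier \<Omega>) < \<infinity>"
    using hausdorff2_frontier_finite[OF assms] by (rule order_le_less_trans)
  show sp: "space (surface_measure \<Omega>) = frontier \<Omega>"
    by (simp add: surface_measure_def space_restrict_space space_measure_of_conv)
  have "emeasure (surface_measure \<Omega>) (frontier \<Omega>) = emeasure ?H (frontier \<Omega>)"
    unfolding surface_measure_def using fH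
    by (subst emeasure_restrict_space) (auto simp: emeasure_completion space_measure_of_conv)
  then show "finite_measure (surface_measure \<Omega>)"
    using fin sp by (intro finite_measureI) auto
qed

text \<open>If \<open>g\<close> is not integrable, its integral is \<open>0\<close> by convention and the bound is trivial.\<close>

lemma abs_integral_le_bound:
  fixes g :: "'a \<Rightarrow> real"
  assumes "finite_measure M" "AE x in M. \<bar>g x\<bar> \<le> C" "C \<ge> 0"
  shows "\<bar>\<integral>x. g x \<partial>M\<bar> \<le> C * measure M (space M)"
proof (cases "integrable M g")
  case True
  interpret finite_measure M by fact
  have "\<bar>\<integral>x. g x \<partial>M\<bar> \<le> (\<integral>x. \<bar>g x\<bar> \<partial>M)" by (rule integral_abs_bound)
  also have "\<dots> \<le> (\<integral>x. C \<partial>M)" using True assms(2) by (intro integral_mono_AE) auto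
  finally show ?thesis by (simp add: mult.commute)
qed (use assms(3) in \<open>simp add: not_integrable_integral_eq\<close>)

section \<open>The boundary term of the scheme\<close>

lemma boundary_term_nonneg:
  assumes "boundary_assumption \<Omega> b"
  shows "0 \<le> (LINT x|surface_measure \<Omega>. b x (g x) \<bullet> g x)"
proof (rule integral_nonneg_AE)
  have "AE x in surface_measure \<Omega>. continuous_on UNIV (b x) \<and>
      (\<forall>\<xi> \<eta>. (b x \<xi> - b x \<eta>) \<bullet> (\<xi> - \<eta>) \<ge> 0) \<and> b x 0 = 0"
    using assms unfolding boundary_assumption_def by blast
  then show "AE x in surface_measure \<Omega>. 0 \<le> b x (g x) \<bullet> g x"
  proof eventually_elim
    case (elim x)
    then have "(b x (g x) - b x 0) \<bullet> (g x - 0) \<ge> 0" by blast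
    then show ?case using elim by simp
  qed
qed

text \<open>The given bound \<open>bu (\<bar>\<xi>\<bar> + 1)\<close> is used for unit vectors only, and positive homogeneity extends it to all \<open>\<xi>\<close>.\<close>

lemma boundary_linear_growth:
  assumes "boundary_assumption \<Omega> b"
  obtains B where "B > 0" "AE x in surface_measure \<Omega>. \<forall>\<xi>. norm (b x \<xi>) \<le> B * norm \<xi>"
proof -
  obtain bu where bu: "bu > 0" "AE x in surface_measure \<Omega>. \<forall>\<xi>. norm (b x \<xi>) \<le> bu * (norm \<xi> + 1)"
    using assms unfolding boundary_assumption_def by (auto elim!: eventually_mono)
  have hom: "AE x in surface_measure \<Omega>. \<forall>\<xi>. \<forall>s\<ge>0. b x (s *\<^sub>R \<xi>) = s *\<^sub>R b x \<xi>"
    using assms unfolding boundary_assumption_def by blast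
  have "AE x in surface_measure \<Omega>. \<forall>\<xi>. norm (b x \<xi>) \<le> (2 * bu) * norm \<xi>"
    using bu(2) hom
  proof eventually_elim
    case (elim x)
    show ?case
    proof
      fix \<xi> :: vec3
      show "norm (b x \<xi>) \<le> (2 * bu) * norm \<xi>"
      proof (cases "\<xi> = 0")
        case True
        then show ?thesis using elim(2)[rule_format, of 0 0] by simp
      next
        case False
        define e where "e = (1 / norm \<xi>) *\<^sub>R \<xi>"
        have e: "\<xi> = norm \<xi> *\<^sub>R e" "norm e = 1" using False by (auto simp: e_def)
        have "b x \<xi> = norm \<xi> *\<^sub>R b x e" using elim(2) e(1) norm_ge_zero by metis
        then have "norm (b x \<xi>) = norm \<xi> * norm (b x e)" by simp
        also have "\<dots> \<le> norm \<xi> * (2 * bu)"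
          using elim(1)[rule_format, of e] e(2) by (intro mult_left_mono) auto
        finally show ?thesis by (simp add: mult.commute)
      qed
    qed
  qed
  then show ?thesis using that[of "2 * bu"] bu(1) by simp
qed

context meshed_domain
begin

lemma boundary_term_bound:
  assumes "boundary_assumption \<Omega> b"
  obtains C where "C \<ge> 0" "\<And>u v. u \<in> ND \<Omega> \<T> \<Longrightarrow> v \<in> ND \<Omega> \<T> \<Longrightarrow>
    \<bar>LINT x|surface_measure \<Omega>. b x (tangential_trace \<Omega> u x) \<bullet> tangential_trace \<Omega> v x\<bar>
      \<le> C * L2_norm \<Omega> u * L2_norm \<Omega> v"
proof -
  have pb: "polyhedral_boundary \<Omega>" using domain unfolding bounded_lipschitz_polyhedral_domain_def by auto
  obtain B where B: "B > 0" "AE x in surface_measure \<Omega>. \<forall>\<xi>. norm (b x \<xi>) \<le> B * norm \<xi>"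
    using boundary_linear_growth[OF assms] .
  obtain S where S: "S \<ge> 0" "\<And>v x. v \<in> ND \<Omega> \<T> \<Longrightarrow> norm (v x) \<le> S * L2_norm \<Omega> v"
    using ND_sup_bound by blast
  define C where "C = B * S * S * measure (surface_measure \<Omega>) (frontier \<Omega>)"
  have "\<bar>LINT x|surface_measure \<Omega>. b x (tangential_trace \<Omega> u x) \<bullet> tangential_trace \<Omega> v x\<bar>
      \<le> C * L2_norm \<Omega> u * L2_norm \<Omega> v" if uv: "u \<in> ND \<Omega> \<T>" "v \<in> ND \<Omega> \<T>" for u v
  proof -
    let ?u = "S * L2_norm \<Omega> u" and ?v = "S * L2_norm \<Omega> v"
    have tr: "norm (tangential_trace \<Omega> w x) \<le> S * L2_norm \<Omega> w" if "w \<in> ND \<Omega> \<T>" "x \<in> frontier \<Omega>" for w x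
      using that S by (intro tangential_trace_le \<Omega>_open) auto
    have "AE x in surface_measure \<Omega>. x \<in> frontier \<Omega>"
      by (rule AE_I2) (simp add: finite_surface_measure(2)[OF pb])
    then have "AE x in surface_measure \<Omega>. \<bar>b x (tangential_trace \<Omega> u x) \<bullet> tangential_trace \<Omega> v x\<bar> \<le> (B * ?u) * ?v"
      using B(2)
    proof eventually_elim
      case (elim x)
      have "\<bar>b x (tangential_trace \<Omega> u x) \<bullet> tangential_trace \<Omega> v x\<bar>
          \<le> norm (b x (tangential_trace \<Omega> u x)) * norm (tangential_trace \<Omega> v x)"
        by (rule Cauchy_Schwarz_ineq2)
      also have "\<dots> \<le> (B * norm (tangential_trace \<Omega> u x)) * norm (tangential_trace \<Omega> v x)"
        using elim by (intro mult_right_mono) auto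
      also have "\<dots> \<le> (B * ?u) * ?v"
        using tr[OF uv(1)] tr[OF uv(2)] elim B(1) S(1)
        by (intro mult_mono) (auto simp: L2_norm_nonneg)
      finally show ?case .
    qed
    then have "\<bar>LINT x|surface_measure \<Omega>. b x (tangential_trace \<Omega> u x) \<bullet> tangential_trace \<Omega> v x\<bar>
        \<le> ((B * ?u) * ?v) * measure (surface_measure \<Omega>) (space (surface_measure \<Omega>))"
      using B(1) S(1) by (intro abs_integral_le_bound finite_surface_measure pb) (auto simp: L2_norm_nonneg)
    then show ?thesis by (simp add: C_def finite_surface_measure(2)[OF pb] mult_ac)
  qed
  moreover have "C \<ge> 0" using B(1) S(1) by (simp add: C_def)
  ultimately show ?thesis using that by blast
qed

end

section \<open>Coefficients depending on time\<close>

text \<open>The infimum in the essential supremum is attained, because countably many null sets form a null set.\<close>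

lemma AE_norm_le_Linf_norm:
  fixes u :: "vec3 \<Rightarrow> 'b::euclidean_space"
  assumes "AE x in lebesgue_on \<Omega>. norm (u x) \<le> C"
  shows "AE x in lebesgue_on \<Omega>. norm (u x) \<le> Linf_norm \<Omega> u"
proof -
  let ?S = "{C. 0 \<le> C \<and> (AE x in lebesgue_on \<Omega>. norm (u x) \<le> C)}"
  have "AE x in lebesgue_on \<Omega>. norm (u x) \<le> max C 0" using assms by eventually_elim auto
  then have ne: "max C 0 \<in> ?S" by auto
  have "AE x in lebesgue_on \<Omega>. norm (u x) \<le> Linf_norm \<Omega> u + 1 / real (Suc n)" for n
  proof -
    obtain D where "D \<in> ?S" "D < Linf_norm \<Omega> u + 1 / real (Suc n)"
      using cInf_lessD[of ?S "Linf_norm \<Omega> u + 1 / real (Suc n)"] ne unfolding Linf_norm_def by fastforce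
    then show ?thesis by (auto elim!: eventually_mono)
  qed
  then have "AE x in lebesgue_on \<Omega>. \<forall>n. norm (u x) \<le> Linf_norm \<Omega> u + 1 / real (Suc n)"
    by (simp add: AE_all_countable)
  then show ?thesis
  proof eventually_elim
    case (elim x)
    have "(\<lambda>n. Linf_norm \<Omega> u + 1 / real (Suc n)) \<longlonglongrightarrow> Linf_norm \<Omega> u + 0"
      by (intro tendsto_intros LIMSEQ_Suc lim_1_over_n)
    then show ?case using elim by (intro LIMSEQ_le_const[of _ "Linf_norm \<Omega> u"]) auto
  qed
qed

lemma Linf_sym_diff_bounded:
  assumes "A \<in> Linf_sym \<Omega>" "B \<in> Linf_sym \<Omega>"
  shows "\<exists>C. AE x in lebesgue_on \<Omega>. norm (A x - B x) \<le> C"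
proof -
  obtain C D where "AE x in lebesgue_on \<Omega>. norm (A x) \<le> C" "AE x in lebesgue_on \<Omega>. norm (B x) \<le> D"
    using assms[THEN Linf_sym_bounded] by blast
  then have "AE x in lebesgue_on \<Omega>. norm (A x - B x) \<le> C + D"
    by eventually_elim (metis add_mono norm_triangle_ineq4 order_trans)
  then show ?thesis by blast
qed

text \<open>A bound valid at almost every time, enlarged by \<open>1\<close>, holds at every time: near \<open>t\<close> there is a time \<open>s\<close> at which it holds, and, by
  continuity, the values at \<open>s\<close> and \<open>t\<close> differ by less than \<open>1\<close>.\<close>

lemma bounded_in_time:
  assumes bd: "bochner_Linf {0<..} (Linf_sym \<Omega>) (Linf_norm \<Omega>) A"
    and cont: "time_continuous {0<..} (Linf_sym \<Omega>) (Linf_norm \<Omega>) A"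
  obtains C where "C \<ge> 0" "\<And>t. t > 0 \<Longrightarrow> AE x in lebesgue_on \<Omega>. norm (A t x) \<le> C"
proof -
  obtain C where C: "AE t in lebesgue_on {0<..}. Linf_norm \<Omega> (A t) \<le> C"
    using bd unfolding bochner_Linf_def by blast
  have sym: "A t \<in> Linf_sym \<Omega>" if "t > 0" for t using cont that unfolding time_continuous_def by auto
  have "AE x in lebesgue_on \<Omega>. norm (A t x) \<le> max C 0 + 1" if t: "t > 0" for t
  proof -
    have "((\<lambda>s. Linf_norm \<Omega> (\<lambda>x. A s x - A t x)) \<longlongrightarrow> 0) (at t within {0<..})"
      using cont t unfolding time_continuous_def by auto
    then have "\<forall>\<^sub>F s in at t within {0<..}. Linf_norm \<Omega> (\<lambda>x. A s x - A t x) < 1"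
      by (rule order_tendstoD) simp
    then obtain d where d: "d > 0"
      "\<And>s. s > 0 \<Longrightarrow> s \<noteq> t \<Longrightarrow> dist s t < d \<Longrightarrow> Linf_norm \<Omega> (\<lambda>x. A s x - A t x) < 1"
      unfolding eventually_at by auto
    have "\<exists>s\<in>{t<..<t+d}. Linf_norm \<Omega> (A s) \<le> C"
    proof (rule ccontr)
      assume no: "\<not> ?thesis"
      have "AE s in lebesgue. s \<in> {0<..} \<longrightarrow> Linf_norm \<Omega> (A s) \<le> C"
        using C by (simp add: AE_restrict_space_iff)
      then have "AE s in lebesgue. s \<notin> {t<..<t+d}"
        using no t by (auto elim!: eventually_mono)
      then have "{t<..<t+d} \<in> null_sets lebesgue" by (subst AE_iff_null_sets) auto
      then have "negligible {t<..<t+d}" by (simp add: negligible_iff_null_sets)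
      then show False using d(1) open_not_negligible[of "{t<..<t+d}"] by auto
    qed
    then obtain s where s: "t < s" "s < t + d" "Linf_norm \<Omega> (A s) \<le> C" by auto
    have s0: "s > 0" using s t by simp
    have close: "Linf_norm \<Omega> (\<lambda>x. A s x - A t x) < 1" using s t by (intro d(2)) (auto simp: dist_real_def)
    obtain D where "AE x in lebesgue_on \<Omega>. norm (A s x) \<le> D" using Linf_sym_bounded[OF sym[OF s0]] ..
    note 1 = AE_norm_le_Linf_norm[OF this]
    obtain D' where "AE x in lebesgue_on \<Omega>. norm (A s x - A t x) \<le> D'"
      using Linf_sym_diff_bounded[OF sym[OF s0] sym[OF t]] ..
    note 2 = AE_norm_le_Linf_norm[OF this]
    from 1 2 show ?thesis
    proof eventually_elim
      case (elim x)
      have "norm (A t x) = norm (A s x - (A s x - A t x))" by simp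
      also have "\<dots> \<le> norm (A s x) + norm (A s x - A t x)" by (rule norm_triangle_ineq4)
      finally show ?case using elim s(3) close by linarith
    qed
  qed
  then show ?thesis using that[of "max C 0 + 1"] by simp
qed

lemma uniform_bounds_coercive:
  assumes "uniform_bounds \<Omega> A"
  obtains l where "l > 0"
    "\<And>t. t \<ge> 0 \<Longrightarrow> AE x in lebesgue_on \<Omega>. \<forall>\<xi>. l * (norm \<xi>)\<^sup>2 \<le> \<xi> \<bullet> (A t x *v \<xi>)"
proof -
  obtain l u where l: "l > 0" "\<And>t. t \<ge> 0 \<Longrightarrow> AE x in lebesgue_on \<Omega>. \<forall>\<xi>.
      l * (norm \<xi>)\<^sup>2 \<le> \<xi> \<bullet> (A t x *v \<xi>) \<and> \<xi> \<bullet> (A t x *v \<xi>) \<le> u * (norm \<xi>)\<^sup>2"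
    using assms unfolding uniform_bounds_def by blast
  have "AE x in lebesgue_on \<Omega>. \<forall>\<xi>. l * (norm \<xi>)\<^sup>2 \<le> \<xi> \<bullet> (A t x *v \<xi>)" if "t \<ge> 0" for t
    using l(2)[OF that] by eventually_elim blast
  with l(1) show ?thesis by (rule that)
qed

lemma continuous_L2_inner_in_time:
  assumes \<Omega>: "bounded \<Omega>" "open \<Omega>"
    and cont: "time_continuous I (Linf_sym \<Omega>) (Linf_norm \<Omega>) A" and \<rho>: "\<rho> \<in> L2 \<Omega>"
  shows "continuous_on I (\<lambda>t. L2_inner \<Omega> (A t) \<rho>)"
  unfolding continuous_on_def
proof
  fix t assume t: "t \<in> I"
  have sym: "A s \<in> Linf_sym \<Omega>" if "s \<in> I" for s using cont that unfolding time_continuous_def by auto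
  define K where "K = (LINT x|lebesgue_on \<Omega>. norm (\<rho> x))"
  have \<rho>i: "integrable (lebesgue_on \<Omega>) (\<lambda>x. norm (\<rho> x))"
    using integrable_norm_mult_norm[OF const_in_L2[OF \<Omega>, of "1::real"] \<rho>] by simp
  have le: "\<bar>L2_inner \<Omega> (A s) \<rho> - L2_inner \<Omega> (A t) \<rho>\<bar> \<le> Linf_norm \<Omega> (\<lambda>x. A s x - A t x) * K"
    if s: "s \<in> I" for s
  proof -
    let ?N = "Linf_norm \<Omega> (\<lambda>x. A s x - A t x)"
    obtain D where "AE x in lebesgue_on \<Omega>. norm (A s x - A t x) \<le> D"
      using Linf_sym_diff_bounded[OF sym[OF s] sym[OF t]] ..
    note ae = AE_norm_le_Linf_norm[OF this]
    have L: "(\<lambda>x. A s x - A t x) \<in> L2 \<Omega>" by (intro L2_diff Linf_sym_L2 \<Omega> sym s t)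
    have "L2_inner \<Omega> (A s) \<rho> - L2_inner \<Omega> (A t) \<rho> = L2_inner \<Omega> (\<lambda>x. A s x - A t x) \<rho>"
      by (intro L2_inner_diff_left[symmetric] Linf_sym_L2 \<Omega> sym s t \<rho>)
    also have "\<bar>\<dots>\<bar> \<le> (LINT x|lebesgue_on \<Omega>. norm (A s x - A t x) * norm (\<rho> x))"
      by (rule L2_inner_abs_le_norm_mult_norm[OF L \<rho>])
    also have "\<dots> \<le> (LINT x|lebesgue_on \<Omega>. ?N * norm (\<rho> x))"
    proof (rule integral_mono_AE)
      show "AE x in lebesgue_on \<Omega>. norm (A s x - A t x) * norm (\<rho> x) \<le> ?N * norm (\<rho> x)"
        using ae by eventually_elim (simp add: mult_right_mono)
    qed (use integrable_norm_mult_norm[OF L \<rho>] \<rho>i in auto)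
    finally show ?thesis by (simp add: K_def)
  qed
  have "((\<lambda>s. Linf_norm \<Omega> (\<lambda>x. A s x - A t x)) \<longlongrightarrow> 0) (at t within I)"
    using cont t unfolding time_continuous_def by auto
  then have lim: "((\<lambda>s. Linf_norm \<Omega> (\<lambda>x. A s x - A t x) * K) \<longlongrightarrow> 0) (at t within I)"
    using tendsto_mult_right[of _ 0 _ K] by simp
  have "((\<lambda>s. L2_inner \<Omega> (A s) \<rho> - L2_inner \<Omega> (A t) \<rho>) \<longlongrightarrow> 0) (at t within I)"
    by (rule Lim_null_comparison[OF _ lim]) (auto simp: eventually_at_filter intro!: always_eventually le)
  then show "((\<lambda>t. L2_inner \<Omega> (A t) \<rho>) \<longlongrightarrow> L2_inner \<Omega> (A t) \<rho>) (at t within I)"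
    by (rule LIM_zero_cancel)
qed

text \<open>For test functions supported in \<open>{T<..}\<close> the left side of the weak formulation is the integral of
  \<open>\<psi>'\<close> times a constant, that is \<open>0\<close>. Hence the continuous function that pairs the derivative with \<open>\<rho>\<close> integrates to \<open>0\<close> against all of
  them.\<close>

lemma stationary_imp_derivative_0:
  assumes \<Omega>: "bounded \<Omega>" "open \<Omega>" and T: "T \<ge> 0" and t: "t > T"
    and A: "\<And>s. s > T \<Longrightarrow> A s \<in> Linf_sym \<Omega>" "Ainf \<in> Linf_sym \<Omega>" 
    and At: "time_continuous {0<..} (Linf_sym \<Omega>) (Linf_norm \<Omega>) At"
    and wd: "weak_time_derivative {0<..} \<Omega> A At"
    and const: "\<And>s. s > T \<Longrightarrow> AE x in lebesgue_on \<Omega>. A s x = Ainf x"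
    and \<rho>: "\<rho> \<in> L2 \<Omega>"
  shows "L2_inner \<Omega> (At t) \<rho> = 0"
proof (rule test_function_integral_eq_0_imp_0[where U="{T<..}" and g="\<lambda>t. L2_inner \<Omega> (At t) \<rho>"])
  show "continuous_on {T<..} (\<lambda>t. L2_inner \<Omega> (At t) \<rho>)"
    using continuous_on_subset[OF continuous_L2_inner_in_time[OF \<Omega> At \<rho>]] T by auto
  fix \<psi> :: "real \<Rightarrow> real" assume \<psi>: "\<psi> \<in> test_functions {T<..}"
  then have \<psi>0: "\<psi> \<in> test_functions {0<..}" and sup: "closure {x. \<psi> x \<noteq> 0} \<subseteq> {T<..}"
    using T unfolding test_functions_def by auto
  have "s \<notin> closure {x. \<psi> x \<noteq> 0}" if "s \<le> T" for s using that sup by (meson greaterThan_iff not_le subsetD)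
  then have out: "\<psi> s = 0" "deriv \<psi> s = 0" if "s \<le> T" for s
    using eq_0_outside_support[where \<psi>=\<psi> and t=s] deriv_eq_0_outside_support[where \<psi>=\<psi> and t=s] that by simp_all
  have "indicator {T<..} s *\<^sub>R (\<psi> s * L2_inner \<Omega> (At s) \<rho>) = indicator {0<..} s *\<^sub>R (\<psi> s * L2_inner \<Omega> (At s) \<rho>)" for s
    using out(1)[of s] T by (auto simp: indicator_def)
  then have "(LINT s|lebesgue. indicator {T<..} s *\<^sub>R (\<psi> s * L2_inner \<Omega> (At s) \<rho>))
      = (LINT s|lebesgue. indicator {0<..} s *\<^sub>R (\<psi> s * L2_inner \<Omega> (At s) \<rho>))"
    by (rule Bochner_Integration.integral_cong[OF refl])
  then have "(LINT s|lebesgue_on {T<..}. \<psi> s * L2_inner \<Omega> (At s) \<rho>) = (LINT s|lebesgue_on {0<..}. \<psi> s * L2_inner \<Omega> (At s) \<rho>)"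
    by (simp add: integral_restrict_space)
  also have "\<dots> = - (LINT s|lebesgue_on {0<..}. deriv \<psi> s * L2_inner \<Omega> (A s) \<rho>)"
    using wd \<psi>0 \<rho> unfolding weak_time_derivative_def by simp
  also have "(LINT s|lebesgue_on {0<..}. deriv \<psi> s * L2_inner \<Omega> (A s) \<rho>)
      = (LINT s|lebesgue_on {0<..}. deriv \<psi> s * L2_inner \<Omega> Ainf \<rho>)"
  proof (intro Bochner_Integration.integral_cong refl)
    fix s
    show "deriv \<psi> s * L2_inner \<Omega> (A s) \<rho> = deriv \<psi> s * L2_inner \<Omega> Ainf \<rho>"
    proof (cases "s \<le> T")
      case False
      then show ?thesis
        using L2_inner_cong_AE[OF Linf_sym_L2[OF \<Omega> A(1)] Linf_sym_L2[OF \<Omega> A(2)] \<rho> const] by simp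
    qed (simp add: out)
  qed
  also have "\<dots> = (LINT s|lebesgue_on {0<..}. deriv \<psi> s) * L2_inner \<Omega> Ainf \<rho>" by simp
  also have "\<dots> = 0" by (simp add: integral_deriv_test_function[OF \<psi>0])
  finally show "(LINT s|lebesgue_on {T<..}. \<psi> s * L2_inner \<Omega> (At s) \<rho>) = 0" by simp
qed (use t in auto)

section \<open>The current at late times\<close>

text \<open>Lebesgue measure is complete.\<close>

lemma borel_measurable_lebesgue_on_AE:
  fixes f g :: "vec3 \<Rightarrow> vec3"
  assumes \<Omega>: "\<Omega> \<in> sets lebesgue" and f: "f \<in> borel_measurable (lebesgue_on \<Omega>)"
    and eq: "AE x in lebesgue_on \<Omega>. f x = g x"
  shows "g \<in> borel_measurable (lebesgue_on \<Omega>)"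
proof -
  have "(\<lambda>x. if x \<in> \<Omega> then f x else 0) \<in> borel_measurable lebesgue"
    using f \<Omega> by (simp add: borel_measurable_if)
  moreover have "AE x in lebesgue. (if x \<in> \<Omega> then f x else 0) = (if x \<in> \<Omega> then g x else 0)"
    using eq \<Omega> by (auto simp: AE_restrict_space_iff elim!: eventually_mono)
  ultimately have "(\<lambda>x. if x \<in> \<Omega> then g x else 0) \<in> borel_measurable lebesgue"
    by (rule borel_measurable_AE)
  then show ?thesis using \<Omega> by (simp add: borel_measurable_if)
qed

text \<open>Approximate \<open>v\<close> by simple functions. For these the composition is measurable piece by piece; continuity in the second argument
  and completeness of the measure carry this over to the limit.\<close>

lemma caratheodory_measurable:
  fixes F :: "vec3 \<Rightarrow> vec3 \<Rightarrow> vec3"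
  assumes \<Omega>: "\<Omega> \<in> sets lebesgue"
    and F: "\<And>\<xi>. (\<lambda>x. F x \<xi>) \<in> borel_measurable (lebesgue_on \<Omega>)"
    and cont: "AE x in lebesgue_on \<Omega>. continuous_on UNIV (F x)"
    and v: "v \<in> borel_measurable (lebesgue_on \<Omega>)"
  shows "(\<lambda>x. F x (v x)) \<in> borel_measurable (lebesgue_on \<Omega>)"
proof -
  obtain s where s: "\<And>i. simple_function (lebesgue_on \<Omega>) (s i)"
    "\<And>x. x \<in> space (lebesgue_on \<Omega>) \<Longrightarrow> (\<lambda>i. s i x) \<longlonglongrightarrow> v x"
    using borel_measurable_implies_sequence_metric[OF v, of 0] by blast
  have Fs: "(\<lambda>x. F x (s i x)) \<in> borel_measurable (lebesgue_on \<Omega>)" for i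
  proof (rule measurable_compose_countable'[where f="\<lambda>\<xi> x. F x \<xi>" and I="s i ` space (lebesgue_on \<Omega>)"])
    show "s i \<in> lebesgue_on \<Omega> \<rightarrow>\<^sub>M count_space (s i ` space (lebesgue_on \<Omega>))"
      using s(1)[of i] by (simp add: simple_function_def measurable_count_space_eq2)
    show "countable (s i ` space (lebesgue_on \<Omega>))"
      using s(1)[of i] by (auto simp: simple_function_def intro: countable_finite)
  qed (rule F)
  obtain N where N: "{x \<in> space (lebesgue_on \<Omega>). \<not> continuous_on UNIV (F x)} \<subseteq> N"
    "N \<in> null_sets (lebesgue_on \<Omega>)"
    using cont by (auto elim!: AE_E intro: that simp: null_sets_def)
  have [measurable]: "N \<in> sets (lebesgue_on \<Omega>)" using N(2) by auto
  define g where "g x = (if x \<in> N then 0 else F x (v x))" for x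
  have "g \<in> borel_measurable (lebesgue_on \<Omega>)"
  proof (rule borel_measurable_LIMSEQ_metric)
    show "(\<lambda>x. if x \<in> N then 0 else F x (s i x)) \<in> borel_measurable (lebesgue_on \<Omega>)" for i
      by (intro measurable_If_set measurable_const Fs) auto
    show "(\<lambda>i. if x \<in> N then 0 else F x (s i x)) \<longlonglongrightarrow> g x" if x: "x \<in> space (lebesgue_on \<Omega>)" for x
    proof (cases "x \<in> N")
      case False
      then have "isCont (F x) (v x)" using N(1) x by (auto simp: continuous_on_eq_continuous_at)
      then show ?thesis using False s(2)[OF x] by (auto simp: g_def intro: isCont_tendsto_compose)
    qed (simp add: g_def)
  qed
  moreover have "AE x in lebesgue_on \<Omega>. g x = F x (v x)"
    by (rule AE_I'[OF N(2)]) (auto simp: g_def)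
  ultimately show ?thesis by (rule borel_measurable_lebesgue_on_AE[OF \<Omega>])
qed

text \<open>At late times \<open>Jtot x 0 0 t = 0\<close> by homogeneity, here with factor \<open>0\<close>. So the Lipschitz bound becomes linear
  growth without the constant term. The part with the time derivative of \<open>\<epsilon>\<close> is bounded uniformly in time.\<close>

lemma late_current:
  assumes \<Omega>: "\<Omega> \<in> sets lebesgue" and J: "current_assumption \<Omega> Jtot T"
    and A: "bochner_Linf {0<..} (Linf_sym \<Omega>) (Linf_norm \<Omega>) \<epsilon>t"
           "time_continuous {0<..} (Linf_sym \<Omega>) (Linf_norm \<Omega>) \<epsilon>t"
  obtains C where "C \<ge> 0"
    "\<And>t v. t > 0 \<Longrightarrow> t \<ge> T \<Longrightarrow> v \<in> L2 \<Omega> \<Longrightarrow> (\<lambda>x. current Jtot \<epsilon>t x (v x) 0 t) \<in> L2 \<Omega>"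
    "\<And>t v. t > 0 \<Longrightarrow> t \<ge> T \<Longrightarrow> v \<in> L2 \<Omega> \<Longrightarrow>
       L2_norm \<Omega> (\<lambda>x. current Jtot \<epsilon>t x (v x) 0 t) \<le> C * L2_norm \<Omega> v"
    "\<And>t v w. t > 0 \<Longrightarrow> t \<ge> T \<Longrightarrow>
       AE x in lebesgue_on \<Omega>. current Jtot \<epsilon>t x (v x) (w x) t = current Jtot \<epsilon>t x (v x) 0 t"
proof -
  obtain D where D: "D \<ge> 0" "\<And>t. t > 0 \<Longrightarrow> AE x in lebesgue_on \<Omega>. norm (\<epsilon>t t x) \<le> D"
    using bounded_in_time[OF A] by blast
  obtain L where L: "L > 0" and lip: "AE x in lebesgue_on \<Omega>. \<forall>\<xi> \<xi>' \<eta> \<eta>'. \<forall>t\<ge>0. \<forall>t'\<ge>0.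
        norm (Jtot x \<xi> \<eta> t - Jtot x \<xi>' \<eta>' t') \<le>
          L * (norm (\<xi> - \<xi>') + norm (\<eta> - \<eta>') +
               (1 + norm \<xi> + norm \<xi>' + norm \<eta> + norm \<eta>') * \<bar>t - t'\<bar>)"
    using J unfolding current_assumption_def by blast
  have lip0: "AE x in lebesgue_on \<Omega>. \<forall>\<xi> \<xi>'. norm (Jtot x \<xi> 0 t - Jtot x \<xi>' 0 t) \<le> L * norm (\<xi> - \<xi>')"
    if "t \<ge> 0" for t
    using lip
  proof eventually_elim
    case (elim x)
    show ?case
    proof (intro allI)
      fix \<xi> \<xi>' :: vec3
      show "norm (Jtot x \<xi> 0 t - Jtot x \<xi>' 0 t) \<le> L * norm (\<xi> - \<xi>')"
        using elim[rule_format, OF that that, of \<xi> 0 \<xi>' 0] by simp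
    qed
  qed
  have hom: "AE x in lebesgue_on \<Omega>. \<forall>\<xi> \<eta> \<eta>'. 
      Jtot x (s *\<^sub>R \<xi>) \<eta> t = s *\<^sub>R Jtot x \<xi> \<eta> t \<and> Jtot x \<xi> \<eta> t = Jtot x \<xi> \<eta>' t" if "t \<ge> T" "s \<ge> 0" for s t
    using J that unfolding current_assumption_def by blast
  have sym: "\<epsilon>t t \<in> Linf_sym \<Omega>" if "t > 0" for t using A(2) that unfolding time_continuous_def by auto
  have eq: "AE x in lebesgue_on \<Omega>. current Jtot \<epsilon>t x (v x) (w x) t = current Jtot \<epsilon>t x (v x) 0 t"
    if "t \<ge> T" for t v w
    using hom[OF that order_refl] by eventually_elim (metis current_def)
  have meas: "(\<lambda>x. current Jtot \<epsilon>t x (v x) 0 t) \<in> borel_measurable (lebesgue_on \<Omega>)"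
    if t: "t > 0" and v: "v \<in> L2 \<Omega>" for t v
    unfolding current_def
  proof (rule borel_measurable_add)
    show "(\<lambda>x. \<epsilon>t t x *v v x) \<in> borel_measurable (lebesgue_on \<Omega>)"
      by (intro borel_measurable_matrix_vector Linf_sym_measurable sym t L2_measurable v)
    show "(\<lambda>x. Jtot x (v x) 0 t) \<in> borel_measurable (lebesgue_on \<Omega>)"
    proof (rule caratheodory_measurable[OF \<Omega> _ _ L2_measurable[OF v]])
      show "(\<lambda>x. Jtot x \<xi> 0 t) \<in> borel_measurable (lebesgue_on \<Omega>)" for \<xi>
        using J t unfolding current_assumption_def by auto
      show "AE x in lebesgue_on \<Omega>. continuous_on UNIV (\<lambda>\<xi>. Jtot x \<xi> 0 t)"
        using lip0[OF less_imp_le[OF t]]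
      proof eventually_elim
        case (elim x)
        then have "lipschitz_on L UNIV (\<lambda>\<xi>. Jtot x \<xi> 0 t)"
          using L by (intro lipschitz_onI) (auto simp: dist_norm)
        then show ?case by (rule lipschitz_on_continuous_on)
      qed
    qed
  qed
  have le: "AE x in lebesgue_on \<Omega>. norm (current Jtot \<epsilon>t x (v x) 0 t) \<le> (L + 3 * D) * norm (v x)"
    if t: "t > 0" "t \<ge> T" for t v
    using lip0[OF less_imp_le[OF t(1)]] hom[OF t(2) order_refl] D(2)[OF t(1)]
  proof eventually_elim
    case (elim x)
    have "Jtot x (0 *\<^sub>R 0) 0 t = 0 *\<^sub>R Jtot x 0 0 t" using elim(2) by blast
    then have "norm (Jtot x (v x) 0 t) \<le> L * norm (v x)"
      using elim(1)[rule_format, of "v x" 0] by simp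
    moreover have "norm (\<epsilon>t t x *v v x) \<le> (3 * D) * norm (v x)"
      using norm_matrix_vector_le[of "\<epsilon>t t x" "v x"] mult_right_mono[OF elim(3), of "3 * norm (v x)"]
      by (simp add: mult_ac)
    ultimately show ?case
      unfolding current_def using norm_triangle_ineq[of "Jtot x (v x) 0 t" "\<epsilon>t t x *v v x"]
      by (simp add: algebra_simps)
  qed
  show ?thesis
    by (rule that[of "L + 3 * D"])
       (use L D(1) L2_dominated[OF _ meas le] L2_norm_dominated[OF _ meas le] eq in auto)
qed

section \<open>Elementwise mean values\<close>

context meshed_domain
begin

lemma AE_cell:
  assumes "K \<in> \<T>" "AE x in lebesgue_on \<Omega>. P x"
  shows "AE x in lebesgue_on (interior K). P x"
proof -
  have "AE x in lebesgue. x \<in> \<Omega> \<longrightarrow> P x" using assms(2) \<Omega>_open by (subst (asm) AE_restrict_space_iff) auto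
  then have "AE x in lebesgue. x \<in> interior K \<longrightarrow> P x"
    by eventually_elim (use cell_subset_domain[OF assms(1)] in auto)
  then show ?thesis by (subst AE_restrict_space_iff) auto
qed

lemma measurable_cell:
  assumes "K \<in> \<T>" "u \<in> borel_measurable (lebesgue_on \<Omega>)"
  shows "u \<in> borel_measurable (lebesgue_on (interior K))"
  by (rule measurable_restrict_mono[OF assms(2) cell_subset_domain[OF assms(1)]])

lemma Qh_cong_AE:
  assumes "u \<in> borel_measurable (lebesgue_on \<Omega>)" "u' \<in> borel_measurable (lebesgue_on \<Omega>)"
    and "AE x in lebesgue_on \<Omega>. u x = u' x"
  shows "Qh \<T> u = Qh \<T> u'"
proof -
  have "(LINT y|lebesgue_on (interior K). u y) = (LINT y|lebesgue_on (interior K). u' y)" if "K \<in> \<T>" for K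
    using that assms by (intro integral_cong_AE measurable_cell AE_cell)
  then show ?thesis unfolding Qh_def by (intro ext sum.cong) auto
qed

lemma Qh_0: "Qh \<T> (\<lambda>x. 0) = (\<lambda>x. 0)"
  unfolding Qh_def by simp

lemma Qh_eq_0_if_orthogonal_L2:
  fixes u :: "vec3 \<Rightarrow> 'b::euclidean_space"
  assumes u: "u \<in> L2 \<Omega>" and orth: "\<And>\<rho>. \<rho> \<in> L2 \<Omega> \<Longrightarrow> L2_inner \<Omega> u \<rho> = 0"
  shows "Qh \<T> u = (\<lambda>x. 0)"
proof -
  have "L2_inner \<Omega> u u = 0" by (rule orth[OF u])
  then have "AE x in lebesgue_on \<Omega>. u x \<bullet> u x = 0"
    unfolding L2_inner_def using integral_nonneg_eq_0_iff_AE[OF integrable_inner_L2[OF u u]] by auto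
  then have "AE x in lebesgue_on \<Omega>. u x = 0" by simp
  then have "Qh \<T> u = Qh \<T> (\<lambda>x. 0)" by (intro Qh_cong_AE L2_measurable u borel_measurable_const)
  then show ?thesis by (simp add: Qh_0)
qed

lemma integrable_cell:
  fixes u :: "vec3 \<Rightarrow> 'b::euclidean_space"
  assumes K: "K \<in> \<T>" and u: "u \<in> borel_measurable (lebesgue_on \<Omega>)" "AE x in lebesgue_on \<Omega>. norm (u x) \<le> C"
  shows "integrable (lebesgue_on (interior K)) u"
proof -
  have "bounded (interior K)" using cell_subset_domain[OF K] \<Omega>_bounded bounded_subset by blast
  then have "finite_measure (lebesgue_on (interior K))"
    by (intro finite_measure_lebesgue_on) (auto simp: lmeasurable_open)
  then show ?thesis
    using AE_cell[OF K u(2)] measurable_cell[OF K u(1)] by (rule finite_measure.integrable_const_bound)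
qed

lemma measure_cell: "K \<in> \<T> \<Longrightarrow> measure lebesgue K = measure lebesgue (interior K)"
proof -
  assume "K \<in> \<T>"
  then have "bounded K" "convex K"
    using mesh unfolding tetrahedral_mesh_def by (auto intro: compact_simplex compact_imp_bounded convex_simplex)
  then show ?thesis by (metis measure_interior negligible_convex_frontier)
qed

text \<open>Mean values commute with linear maps. This transfers symmetry and lower bounds from a matrix
  field to its mean values.\<close>

lemma Qh_linear_functional:
  fixes A :: "vec3 \<Rightarrow> 'b::euclidean_space" and f :: "'b \<Rightarrow> 'c::euclidean_space"
  assumes A: "A \<in> borel_measurable (lebesgue_on \<Omega>)" "AE x in lebesgue_on \<Omega>. norm (A x) \<le> C"
    and f: "linear f"
  shows "f (Qh \<T> A x) = Qh \<T> (\<lambda>x. f (A x)) x"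
proof -
  interpret bounded_linear f using f by (rule linear_linear[THEN iffD2])
  show ?thesis
    unfolding Qh_def sum scaleR
    by (intro sum.cong refl arg_cong2[where f=scaleR] integral_bounded_linear[OF bounded_linear_axioms, symmetric]
        integrable_cell[OF _ A])
qed

lemma Qh_mono_ge:
  fixes u :: "vec3 \<Rightarrow> real"
  assumes u: "u \<in> borel_measurable (lebesgue_on \<Omega>)" "AE x in lebesgue_on \<Omega>. norm (u x) \<le> C"
    and c: "AE x in lebesgue_on \<Omega>. c \<le> u x" and x: "x \<in> cells \<T>"
  shows "c \<le> Qh \<T> u x"
proof -
  obtain K where K: "K \<in> \<T>" "x \<in> interior K" using x unfolding cells_def by auto
  let ?m = "measure lebesgue (interior K)"
  have fin: "integrable (lebesgue_on (interior K)) (\<lambda>x. c)"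
    by (rule integrable_cell[OF K(1), where C="\<bar>c\<bar>"]) auto
  have "?m * c = (LINT y|lebesgue_on (interior K). c)" by (simp add: measure_restrict_space)
  also have "\<dots> \<le> (LINT y|lebesgue_on (interior K). u y)"
    by (intro integral_mono_AE fin integrable_cell[OF K(1) u] AE_cell[OF K(1) c])
  finally show ?thesis
    using cell_measure_pos[OF K(1)] by (simp add: Qh_cell[OF mesh K] measure_cell[OF K(1)] field_simps)
qed

lemma Qh_Linf_sym:
  assumes A: "A \<in> Linf_sym \<Omega>"
  shows "Qh \<T> A \<in> Linf_sym \<Omega>"
proof -
  obtain C where C: "AE x in lebesgue_on \<Omega>. norm (A x) \<le> C" using Linf_sym_bounded[OF A] ..
  note Am = Linf_sym_measurable[OF A]
  have "(\<lambda>x. transpose (A x)) \<in> borel_measurable (lebesgue_on \<Omega>)"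
  proof (rule measurable_compose[OF Am borel_measurable_continuous_onI])
    show "continuous_on UNIV (transpose :: mat3 \<Rightarrow> mat3)"
      unfolding transpose_def by (intro continuous_intros)
  qed
  moreover have "AE x in lebesgue_on \<Omega>. transpose (A x) = A x" using A unfolding Linf_sym_def by auto
  ultimately have "Qh \<T> (\<lambda>x. transpose (A x)) = Qh \<T> A" by (intro Qh_cong_AE Am)
  moreover have "linear (transpose :: mat3 \<Rightarrow> mat3)"
    by (intro linearI) (auto simp: transpose_def vec_eq_iff)
  ultimately have sym: "transpose (Qh \<T> A x) = Qh \<T> A x" for x
    using Qh_linear_functional[OF Am C, where f=transpose and x=x] by simp
  have "norm (Qh \<T> A x) \<le> (\<Sum>K\<in>\<T>. norm ((1 / measure lebesgue K) *\<^sub>R (LINT y|lebesgue_on (interior K). A y)))" for x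
    unfolding Qh_def by (rule sum_norm_le) (auto simp: indicator_def)
  moreover have "Qh \<T> A \<in> borel_measurable (lebesgue_on \<Omega>)"
    unfolding Qh_def[abs_def]
    by (intro borel_measurable_sum borel_measurable_scaleR borel_measurable_const
        measurable_restrict_space1 borel_measurable_indicator) auto
  ultimately show ?thesis unfolding Linf_sym_def using sym by blast
qed

lemma Qh_coercive:
  assumes A: "A \<in> Linf_sym \<Omega>" and l: "AE x in lebesgue_on \<Omega>. \<forall>\<xi>. l * (norm \<xi>)\<^sup>2 \<le> \<xi> \<bullet> (A x *v \<xi>)"
    and x: "x \<in> cells \<T>"
  shows "l * (norm \<xi>)\<^sup>2 \<le> \<xi> \<bullet> (Qh \<T> A x *v \<xi>)"
proof -
  obtain C where C: "AE x in lebesgue_on \<Omega>. norm (A x) \<le> C" using Linf_sym_bounded[OF A] ..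
  note Am = Linf_sym_measurable[OF A]
  have lin: "linear (\<lambda>B::mat3. \<xi> \<bullet> (B *v \<xi>))"
    by (intro linearI) (auto simp: matrix_vector_mult_add_rdistrib inner_add_right scaleR_matrix_vector_assoc[symmetric])
  have "l * (norm \<xi>)\<^sup>2 \<le> Qh \<T> (\<lambda>x. \<xi> \<bullet> (A x *v \<xi>)) x"
  proof (rule Qh_mono_ge[OF _ _ _ x, where C="norm \<xi> * (3 * C * norm \<xi>)"])
    show "(\<lambda>x. \<xi> \<bullet> (A x *v \<xi>)) \<in> borel_measurable (lebesgue_on \<Omega>)"
      by (intro borel_measurable_inner borel_measurable_matrix_vector Am borel_measurable_const)
    show "AE x in lebesgue_on \<Omega>. l * (norm \<xi>)\<^sup>2 \<le> \<xi> \<bullet> (A x *v \<xi>)" using l by eventually_elim auto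
    show "AE x in lebesgue_on \<Omega>. norm (\<xi> \<bullet> (A x *v \<xi>)) \<le> norm \<xi> * (3 * C * norm \<xi>)"
      using C
    proof eventually_elim
      case (elim x)
      have le: "norm (A x *v \<xi>) \<le> 3 * C * norm \<xi>"
        using norm_matrix_vector_le[of "A x" \<xi>] mult_right_mono[OF elim, of "3 * norm \<xi>"] by (simp add: mult_ac)
      have "norm (\<xi> \<bullet> (A x *v \<xi>)) \<le> norm \<xi> * norm (A x *v \<xi>)" by (simp add: Cauchy_Schwarz_ineq2)
      also have "\<dots> \<le> norm \<xi> * (3 * C * norm \<xi>)" by (rule mult_left_mono[OF le norm_ge_zero])
      finally show ?case .
    qed
  qed
  then show ?thesis using Qh_linear_functional[OF Am C lin] by simp
qed

lemma Qh_matrix_inv: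
  assumes A: "A \<in> Linf_sym \<Omega>" and l: "l > 0" "AE x in lebesgue_on \<Omega>. \<forall>\<xi>. l * (norm \<xi>)\<^sup>2 \<le> \<xi> \<bullet> (A x *v \<xi>)"
    and x: "x \<in> cells \<T>"
  shows "Qh \<T> A x *v (matrix_inv (Qh \<T> A x) *v c) = c"
proof -
  have "\<xi> = 0" if "Qh \<T> A x *v \<xi> = 0" for \<xi>
    using Qh_coercive[OF A l(2) x, of \<xi>] that l(1) by (simp add: mult_le_0_iff)
  then have "invertible (Qh \<T> A x)"
    unfolding invertible_left_inverse matrix_left_invertible_ker by blast
  then have "Qh \<T> A x ** matrix_inv (Qh \<T> A x) = mat 1"
    unfolding invertible_def matrix_inv_def by (rule someI2_ex) simp
  then show ?thesis by (simp add: matrix_vector_mul_assoc)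
qed

end

section \<open>Bounded right inverses of the curl\<close>

text \<open>Every linear relation \<open>R\<close> between functions \<open>w\<close> and \<open>u\<close> whose left side is determined by finitely many functionals
  has a bounded selection: to each \<open>w\<close> in its domain there is some \<open>u\<close> whose seminorm is at most a constant times the
  values of the functionals at \<open>w\<close>. The proof is Gaussian elimination, one functional at a time. If some \<open>w0\<close> has \<open>g w0 \<noteq> 0\<close>,
  subtracting a multiple of it reduces the claim to functions with \<open>g w = 0\<close>. The form of a relation suits weak
  curls, which are determined up to null sets only.\<close>

lemma bounded_lifting:
  fixes \<Lambda> :: "((vec3 \<Rightarrow> 'b::real_vector) \<Rightarrow> real) set"
    and R :: "(vec3 \<Rightarrow> 'b) \<Rightarrow> (vec3 \<Rightarrow> 'c::real_vector) \<Rightarrow> bool" and p :: "(vec3 \<Rightarrow> 'c) \<Rightarrow> real"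
  assumes fin: "finite \<Lambda>"
    and lin: "\<And>f w w' s. f \<in> \<Lambda> \<Longrightarrow> f (\<lambda>x. w x + s *\<^sub>R w' x) = f w + s * f w'"
    and R: "\<And>w u w' u' s. R w u \<Longrightarrow> R w' u' \<Longrightarrow> R (\<lambda>x. w x + s *\<^sub>R w' x) (\<lambda>x. u x + s *\<^sub>R u' x)"
    and p: "\<And>w u w' u' s. R w u \<Longrightarrow> R w' u' \<Longrightarrow> p (\<lambda>x. u x + s *\<^sub>R u' x) \<le> p u + \<bar>s\<bar> * p u'"
      "\<And>u. 0 \<le> p u"
    and null: "\<And>w u. R w u \<Longrightarrow> (\<And>f. f \<in> \<Lambda> \<Longrightarrow> f w = 0) \<Longrightarrow> \<exists>u'. R w u' \<and> p u' \<le> 0"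
  shows "\<exists>C\<ge>0. \<forall>w u. R w u \<longrightarrow> (\<exists>u'. R w u' \<and> p u' \<le> C * (\<Sum>f\<in>\<Lambda>. \<bar>f w\<bar>))"
  using fin lin R p(1) null
proof (induction \<Lambda> arbitrary: R rule: finite_induct)
  case empty
  then show ?case by (intro exI[of _ 0]) auto
next
  case (insert g \<Lambda>)
  define R' where "R' w u \<longleftrightarrow> R w u \<and> g w = 0" for w u
  have "\<exists>C\<ge>0. \<forall>w u. R' w u \<longrightarrow> (\<exists>u'. R' w u' \<and> p u' \<le> C * (\<Sum>f\<in>\<Lambda>. \<bar>f w\<bar>))"
  proof (rule insert.IH)
    show "R' (\<lambda>x. w x + s *\<^sub>R w' x) (\<lambda>x. u x + s *\<^sub>R u' x)" if "R' w u" "R' w' u'" for w u w' u' s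
      using that insert.prems(2)[of w u w' u' s] insert.prems(1)[of g w s w'] by (simp add: R'_def)
    show "p (\<lambda>x. u x + s *\<^sub>R u' x) \<le> p u + \<bar>s\<bar> * p u'" if "R' w u" "R' w' u'" for w u w' u' s
      using that insert.prems(3)[of w u w' u' s] by (simp add: R'_def)
    show "\<exists>u'. R' w u' \<and> p u' \<le> 0" if "R' w u" "\<And>f. f \<in> \<Lambda> \<Longrightarrow> f w = 0" for w u
      using that insert.prems(4)[of w u] by (auto simp: R'_def)
  qed (use insert.prems(1) in auto)
  then obtain C where C: "C \<ge> 0" "\<And>w u. R' w u \<Longrightarrow> \<exists>u'. R' w u' \<and> p u' \<le> C * (\<Sum>f\<in>\<Lambda>. \<bar>f w\<bar>)"
    by blast
  show ?case
  proof (cases "\<exists>w u. R w u \<and> g w \<noteq> 0")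
    case False
    have "\<exists>u'. R w u' \<and> p u' \<le> C * (\<Sum>f\<in>insert g \<Lambda>. \<bar>f w\<bar>)" if "R w u" for w u
    proof -
      have "R' w u" using that False by (auto simp: R'_def)
      then obtain u' where "R' w u'" "p u' \<le> C * (\<Sum>f\<in>\<Lambda>. \<bar>f w\<bar>)" using C(2) by blast
      then show ?thesis using insert.hyps by (auto simp: R'_def)
    qed
    then show ?thesis using C(1) by blast
  next
    case True
    then obtain w0 u0 where w0: "R w0 u0" "g w0 \<noteq> 0" by blast
    define S0 where "S0 = (\<Sum>f\<in>\<Lambda>. \<bar>f w0\<bar>)"
    define D where "D = C + (C * S0 + p u0) / \<bar>g w0\<bar>"
    have D: "D \<ge> 0" using C(1) p(2) by (auto simp: D_def S0_def sum_nonneg)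
    have "\<exists>u'. R w u' \<and> p u' \<le> D * (\<Sum>f\<in>insert g \<Lambda>. \<bar>f w\<bar>)" if w: "R w u" for w u
    proof -
      define t where "t = g w / g w0"
      define w1 where "w1 = (\<lambda>x. w x + (- t) *\<^sub>R w0 x)"
      have "g w1 = 0" unfolding w1_def by (subst insert.prems(1)) (use w0 in \<open>auto simp: t_def\<close>)
      then have "R' w1 (\<lambda>x. u x + (- t) *\<^sub>R u0 x)"
        unfolding R'_def w1_def using insert.prems(2)[OF w w0(1), of "- t"] by blast
      then obtain u1 where u1: "R' w1 u1" "p u1 \<le> C * (\<Sum>f\<in>\<Lambda>. \<bar>f w1\<bar>)" using C(2) by blast
      have "(\<Sum>f\<in>\<Lambda>. \<bar>f w1\<bar>) \<le> (\<Sum>f\<in>\<Lambda>. \<bar>f w\<bar> + \<bar>t\<bar> * \<bar>f w0\<bar>)"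
      proof (rule sum_mono)
        fix f assume "f \<in> \<Lambda>"
        then have "f w1 = f w + (- t) * f w0" unfolding w1_def by (intro insert.prems(1)) auto
        then show "\<bar>f w1\<bar> \<le> \<bar>f w\<bar> + \<bar>t\<bar> * \<bar>f w0\<bar>" by (simp add: abs_mult[symmetric])
      qed
      also have "\<dots> = (\<Sum>f\<in>\<Lambda>. \<bar>f w\<bar>) + \<bar>t\<bar> * S0" by (simp add: S0_def sum.distrib sum_distrib_left)
      finally have sum1: "(\<Sum>f\<in>\<Lambda>. \<bar>f w1\<bar>) \<le> (\<Sum>f\<in>\<Lambda>. \<bar>f w\<bar>) + \<bar>t\<bar> * S0" .
      have "(\<lambda>x. w1 x + t *\<^sub>R w0 x) = w" by (simp add: w1_def)
      then have "R w (\<lambda>x. u1 x + t *\<^sub>R u0 x)"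
        using insert.prems(2)[OF _ w0(1), of w1 u1 t] u1(1) by (simp add: R'_def)
      moreover have "p (\<lambda>x. u1 x + t *\<^sub>R u0 x) \<le> D * (\<Sum>f\<in>insert g \<Lambda>. \<bar>f w\<bar>)"
      proof -
        have "p (\<lambda>x. u1 x + t *\<^sub>R u0 x) \<le> p u1 + \<bar>t\<bar> * p u0"
          using insert.prems(3)[OF _ w0(1), of w1 u1 t] u1(1) by (simp add: R'_def)
        also have "\<dots> \<le> C * ((\<Sum>f\<in>\<Lambda>. \<bar>f w\<bar>) + \<bar>t\<bar> * S0) + \<bar>t\<bar> * p u0"
          using u1(2) mult_left_mono[OF sum1 C(1)] by linarith
        also have "\<dots> = C * (\<Sum>f\<in>\<Lambda>. \<bar>f w\<bar>) + (D - C) * \<bar>g w\<bar>"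
          by (simp add: D_def t_def algebra_simps add_divide_distrib)
        also have "\<dots> \<le> D * (\<Sum>f\<in>\<Lambda>. \<bar>f w\<bar>) + D * \<bar>g w\<bar>"
          using C(1) p(2)[of u0] by (intro add_mono mult_right_mono sum_nonneg) (auto simp: D_def S0_def sum_nonneg)
        finally show ?thesis using insert.hyps by (simp add: algebra_simps)
      qed
      ultimately show ?thesis by blast
    qed
    then show ?thesis using D by blast
  qed
qed

context meshed_domain
begin

text \<open>\<open>M w\<close> is a curl of the finite element function \<open>u\<close>. For \<open>M = \<mu>\<^sub>h\<close> the fields \<open>w\<close> that admit such a \<open>u\<close> form the
  magnetic component of \<open>\<W>\<^sub>h\<close>; in this form it is manifestly preserved by the scheme.\<close>

definition curl_lift :: "(vec3 \<Rightarrow> mat3) \<Rightarrow> field3 \<Rightarrow> field3 \<Rightarrow> bool" where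
  "curl_lift M w u \<longleftrightarrow> w \<in> DG \<Omega> \<T> \<and> u \<in> ND \<Omega> \<T> \<and>
     (\<exists>c. has_weak_curl \<Omega> u c \<and> (AE x in lebesgue_on \<Omega>. c x = M x *v w x))"

lemma curl_lift_add_scaleR:
  assumes "curl_lift M w u" "curl_lift M w' u'"
  shows "curl_lift M (\<lambda>x. w x + s *\<^sub>R w' x) (\<lambda>x. u x + s *\<^sub>R u' x)"
proof -
  obtain c where c: "has_weak_curl \<Omega> u c" "AE x in lebesgue_on \<Omega>. c x = M x *v w x"
    using assms(1) unfolding curl_lift_def by blast
  obtain c' where c': "has_weak_curl \<Omega> u' c'" "AE x in lebesgue_on \<Omega>. c' x = M x *v w' x"
    using assms(2) unfolding curl_lift_def by blast
  have "AE x in lebesgue_on \<Omega>. c x + s *\<^sub>R c' x = M x *v (w x + s *\<^sub>R w' x)"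
    using c(2) c'(2) by eventually_elim (simp add: matrix_vector_right_distrib matrix_vector_mult_scaleR)
  then show ?thesis
    using assms has_weak_curl_add_scaleR[OF \<Omega>_bounded \<Omega>_open c(1) c'(1), of s]
      ND_add_scaleR[OF \<Omega>_bounded \<Omega>_open] DG_add_scaleR
    unfolding curl_lift_def by blast
qed

text \<open>The functionals are the components of \<open>w\<close> at one point of each open cell, which determine a piecewise
  constant function.\<close>

lemma curl_lift_bounded:
  obtains C where "C \<ge> 0"
    "\<And>w u. curl_lift M w u \<Longrightarrow> \<exists>u'. curl_lift M w u' \<and> L2_norm \<Omega> u' \<le> C * L2_norm \<Omega> w"
proof -
  have "\<forall>K\<in>\<T>. \<exists>x. x \<in> interior K" using cell_nonempty_interior by blast
  then obtain pt where pt: "\<And>K. K \<in> \<T> \<Longrightarrow> pt K \<in> interior K" by metis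
  define \<Lambda> where "\<Lambda> = (\<lambda>(K, i) (w::field3). w (pt K) $ i) ` (\<T> \<times> (UNIV::3 set))"
  have "\<exists>C\<ge>0. \<forall>w u. curl_lift M w u \<longrightarrow> (\<exists>u'. curl_lift M w u' \<and> L2_norm \<Omega> u' \<le> C * (\<Sum>f\<in>\<Lambda>. \<bar>f w\<bar>))"
  proof (rule bounded_lifting)
    show "finite \<Lambda>" using finite_mesh by (simp add: \<Lambda>_def)
    show "L2_norm \<Omega> (\<lambda>x. u x + s *\<^sub>R u' x) \<le> L2_norm \<Omega> u + \<bar>s\<bar> * L2_norm \<Omega> u'"
      if "curl_lift M w u" "curl_lift M w' u'" for w u w' u' s
    proof -
      have "u \<in> L2 \<Omega>" "u' \<in> L2 \<Omega>" using that ND_L2 unfolding curl_lift_def by blast+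
      then show ?thesis
        using L2_norm_triangle[of u \<Omega> "\<lambda>x. s *\<^sub>R u' x"] by (simp add: L2_norm_scaleR L2_scaleR)
    qed
    show "\<exists>u'. curl_lift M w u' \<and> L2_norm \<Omega> u' \<le> 0"
      if wu: "curl_lift M w u" and zero: "\<And>f. f \<in> \<Lambda> \<Longrightarrow> f w = 0" for w u
    proof -
      have "w x = 0" for x
      proof (cases "x \<in> cells \<T>")
        case True
        then obtain K where K: "K \<in> \<T>" "x \<in> interior K" unfolding cells_def by auto
        have w: "w \<in> DG \<Omega> \<T>" using wu unfolding curl_lift_def by blast
        obtain a where "\<forall>x\<in>interior K. w x = a" using w K(1) unfolding DG_def by blast
        then have "w x = w (pt K)" using K pt by simp
        moreover have "w (pt K) $ i = 0" for i
          using zero[of "\<lambda>w. w (pt K) $ i"] K(1) by (force simp: \<Lambda>_def)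
        ultimately show ?thesis by (simp add: vec_eq_iff)
      next
        case False
        then show ?thesis using wu unfolding curl_lift_def DG_def by auto
      qed
      then have "(\<lambda>x. w x + (- 1) *\<^sub>R w x) = w" by auto
      then have "curl_lift M w (\<lambda>x. u x + (- 1) *\<^sub>R u x)" using curl_lift_add_scaleR[OF wu wu, of "- 1"] by simp
      moreover have "L2_norm \<Omega> (\<lambda>x. u x + (- 1) *\<^sub>R u x) \<le> 0" by (simp add: L2_norm_def L2_inner_def)
      ultimately show ?thesis by blast
    qed
  qed (auto simp: \<Lambda>_def L2_norm_nonneg intro: curl_lift_add_scaleR)
  then obtain C where C: "C \<ge> 0"
    "\<And>w u. curl_lift M w u \<Longrightarrow> \<exists>u'. curl_lift M w u' \<and> L2_norm \<Omega> u' \<le> C * (\<Sum>f\<in>\<Lambda>. \<bar>f w\<bar>)" by blast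
  define S where "S = (\<Sum>K\<in>\<T>. 1 / sqrt (measure lebesgue (interior K)))"
  have S: "(\<Sum>f\<in>\<Lambda>. \<bar>f w\<bar>) \<le> (real (card \<Lambda>) * S) * L2_norm \<Omega> w" if w: "w \<in> DG \<Omega> \<T>" for w
  proof -
    have "\<bar>f w\<bar> \<le> S * L2_norm \<Omega> w" if f: "f \<in> \<Lambda>" for f
    proof -
      obtain K i where K: "K \<in> \<T>" "f = (\<lambda>w. w (pt K) $ i)" using f by (auto simp: \<Lambda>_def)
      have "\<bar>f w\<bar> \<le> norm (w (pt K))" using K(2) component_le_norm_cart by auto
      also have "\<dots> \<le> (1 / sqrt (measure lebesgue (interior K))) * L2_norm \<Omega> w"
        using DG_cell_bound[OF w K(1) pt[OF K(1)]] by simp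
      also have "\<dots> \<le> S * L2_norm \<Omega> w"
        unfolding S_def using K(1) finite_mesh
        by (intro mult_right_mono L2_norm_nonneg member_le_sum) auto
      finally show ?thesis .
    qed
    then have "(\<Sum>f\<in>\<Lambda>. \<bar>f w\<bar>) \<le> real (card \<Lambda>) * (S * L2_norm \<Omega> w)"
      by (rule sum_bounded_above)
    then show ?thesis by (simp add: mult.assoc)
  qed
  have "\<exists>u'. curl_lift M w u' \<and> L2_norm \<Omega> u' \<le> (C * (real (card \<Lambda>) * S)) * L2_norm \<Omega> w"
    if wu: "curl_lift M w u" for w u
  proof -
    obtain u' where u': "curl_lift M w u'" "L2_norm \<Omega> u' \<le> C * (\<Sum>f\<in>\<Lambda>. \<bar>f w\<bar>)" using C(2)[OF wu] by blast
    have "w \<in> DG \<Omega> \<T>" using wu unfolding curl_lift_def by blast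
    then have "C * (\<Sum>f\<in>\<Lambda>. \<bar>f w\<bar>) \<le> C * ((real (card \<Lambda>) * S) * L2_norm \<Omega> w)"
      by (intro mult_left_mono S C(1))
    then show ?thesis using u' by (intro exI[of _ u']) (simp add: mult.assoc)
  qed
  moreover have "C * (real (card \<Lambda>) * S) \<ge> 0" using C(1) by (simp add: S_def sum_nonneg)
  ultimately show ?thesis using that by blast
qed

end

section \<open>Contraction of the energy at late times\<close>

text \<open>The data of the scheme at late times, with the estimates that the energy argument uses. Here \<open>Jh n u\<close> is the
  current of \<open>u\<close> at step \<open>n\<close>, \<open>bd\<close> the boundary term, \<open>M\<close> the final mean permeability. The lower bound on \<open>eps n\<close> is required for every
  \<open>n\<close>, since the first late step involves \<open>eps (n - 1)\<close> at a step that is not late.\<close>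

locale late_scheme = meshed_domain +
  fixes \<tau> :: real and eps :: "nat \<Rightarrow> vec3 \<Rightarrow> mat3" and Jh :: "nat \<Rightarrow> field3 \<Rightarrow> field3"
    and bd :: "field3 \<Rightarrow> field3 \<Rightarrow> real" and M :: "vec3 \<Rightarrow> mat3" and late :: "nat \<Rightarrow> bool"
    and l Ce CJ Cb lM \<gamma> :: real
  assumes tau: "\<tau> > 0"
    and eps_sym: "\<And>n. eps n \<in> Linf_sym \<Omega>"
    and eps_lower: "l > 0" "\<And>n u. u \<in> L2 \<Omega> \<Longrightarrow> l * (L2_norm \<Omega> u)\<^sup>2 \<le> L2_inner \<Omega> (\<lambda>x. eps n x *v u x) u"
    and eps_upper: "Ce \<ge> 0"
      "\<And>n u. late n \<Longrightarrow> u \<in> L2 \<Omega> \<Longrightarrow> L2_norm \<Omega> (\<lambda>x. eps n x *v u x) \<le> Ce * L2_norm \<Omega> u"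
    and J_upper: "CJ \<ge> 0" "\<And>n u. late n \<Longrightarrow> u \<in> L2 \<Omega> \<Longrightarrow> Jh n u \<in> L2 \<Omega>"
      "\<And>n u. late n \<Longrightarrow> u \<in> L2 \<Omega> \<Longrightarrow> L2_norm \<Omega> (Jh n u) \<le> CJ * L2_norm \<Omega> u"
    and bd_nonneg: "\<And>u. 0 \<le> bd u u"
    and bd_upper: "Cb \<ge> 0" "\<And>u v. u \<in> ND \<Omega> \<T> \<Longrightarrow> v \<in> ND \<Omega> \<T> \<Longrightarrow> \<bar>bd u v\<bar> \<le> Cb * L2_norm \<Omega> u * L2_norm \<Omega> v"
    and M_sym: "M \<in> Linf_sym \<Omega>"
    and M_lower: "lM > 0" "\<And>u. u \<in> L2 \<Omega> \<Longrightarrow> lM * (L2_norm \<Omega> u)\<^sup>2 \<le> L2_inner \<Omega> (\<lambda>x. M x *v u x) u"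
    and dissipation: "\<gamma> > 0" "\<And>n v v'. late n \<Longrightarrow> v \<in> ND \<Omega> \<T> \<Longrightarrow> v' \<in> ND \<Omega> \<T> \<Longrightarrow>
        \<gamma> * (L2_norm \<Omega> v)\<^sup>2 \<le>
        1/2 * L2_inner \<Omega> (\<lambda>x. eps n x *v (v x - v' x)) (\<lambda>x. v x - v' x)
        + \<tau> * L2_inner \<Omega> (Jh n v) v
        - 1/2 * L2_inner \<Omega> (\<lambda>x. (eps n x - eps (n - 1) x) *v v' x) v'"
begin

abbreviation eps_form :: "nat \<Rightarrow> field3 \<Rightarrow> field3 \<Rightarrow> real" where
  "eps_form n u v \<equiv> L2_inner \<Omega> (\<lambda>x. eps n x *v u x) v"

abbreviation mu_form :: "field3 \<Rightarrow> field3 \<Rightarrow> real" where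
  "mu_form u v \<equiv> L2_inner \<Omega> (\<lambda>x. M x *v u x) v"

abbreviation nrm :: "field3 \<Rightarrow> real" where "nrm u \<equiv> L2_norm \<Omega> u"

lemma e_commute: "u \<in> L2 \<Omega> \<Longrightarrow> v \<in> L2 \<Omega> \<Longrightarrow> eps_form n u v = eps_form n v u"
  by (rule Linf_sym_inner_commute[OF eps_sym])

lemma e_diff_left: "u \<in> L2 \<Omega> \<Longrightarrow> u' \<in> L2 \<Omega> \<Longrightarrow> v \<in> L2 \<Omega> \<Longrightarrow> eps_form n (\<lambda>x. u x - u' x) v = eps_form n u v - eps_form n u' v"
  by (simp add: matrix_vector_mult_diff_distrib L2_inner_diff_left Linf_sym_apply_L2[OF eps_sym])

lemma e_diff_right: "u \<in> L2 \<Omega> \<Longrightarrow> u' \<in> L2 \<Omega> \<Longrightarrow> v \<in> L2 \<Omega> \<Longrightarrow> eps_form n v (\<lambda>x. u x - u' x) = eps_form n v u - eps_form n v u'"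
  by (simp add: L2_inner_diff_right Linf_sym_apply_L2[OF eps_sym])

lemma e_scaleR_left: "eps_form n (\<lambda>x. s *\<^sub>R u x) v = s * eps_form n u v"
  by (simp add: matrix_vector_mult_scaleR L2_inner_scaleR_left)

lemma e_le: "late n \<Longrightarrow> u \<in> L2 \<Omega> \<Longrightarrow> v \<in> L2 \<Omega> \<Longrightarrow> \<bar>eps_form n u v\<bar> \<le> Ce * nrm u * nrm v"
  using L2_Cauchy_Schwarz[OF Linf_sym_apply_L2[OF eps_sym], of u v n]
    mult_right_mono[OF eps_upper(2) L2_norm_nonneg[of \<Omega> v], of n u] by linarith

lemma J_le: "late n \<Longrightarrow> u \<in> L2 \<Omega> \<Longrightarrow> v \<in> L2 \<Omega> \<Longrightarrow> \<bar>L2_inner \<Omega> (Jh n u) v\<bar> \<le> CJ * nrm u * nrm v"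
  using L2_Cauchy_Schwarz[OF J_upper(2), of n u v]
    mult_right_mono[OF J_upper(3) L2_norm_nonneg[of \<Omega> v], of n u] by linarith

lemma m_commute: "u \<in> L2 \<Omega> \<Longrightarrow> v \<in> L2 \<Omega> \<Longrightarrow> mu_form u v = mu_form v u"
  by (rule Linf_sym_inner_commute[OF M_sym])

lemma m_diff_left: "u \<in> L2 \<Omega> \<Longrightarrow> u' \<in> L2 \<Omega> \<Longrightarrow> v \<in> L2 \<Omega> \<Longrightarrow> mu_form (\<lambda>x. u x - u' x) v = mu_form u v - mu_form u' v"
  by (simp add: matrix_vector_mult_diff_distrib L2_inner_diff_left Linf_sym_apply_L2[OF M_sym])

lemma m_diff_right: "u \<in> L2 \<Omega> \<Longrightarrow> u' \<in> L2 \<Omega> \<Longrightarrow> v \<in> L2 \<Omega> \<Longrightarrow> mu_form v (\<lambda>x. u x - u' x) = mu_form v u - mu_form v u'"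
  by (simp add: L2_inner_diff_right Linf_sym_apply_L2[OF M_sym])

text \<open>The left side of (B5) with the terms in \<open>eps n v'\<close> cancelled; it is quadratic in the old field \<open>v'\<close> with leading
  part \<open>1/2 (eps (n - 1) v', v')\<close>.\<close>

definition loss :: "nat \<Rightarrow> field3 \<Rightarrow> field3 \<Rightarrow> real" where
  "loss n v v' = 1/2 * eps_form n v v - eps_form n v v' + 1/2 * eps_form (n - 1) v' v' + \<tau> * L2_inner \<Omega> (Jh n v) v"

lemma loss_ge:
  assumes n: "late n" and v: "v \<in> ND \<Omega> \<T>" "v' \<in> ND \<Omega> \<T>"
  shows "\<gamma> * (nrm v)\<^sup>2 \<le> loss n v v'"
proof -
  have L: "v \<in> L2 \<Omega>" "v' \<in> L2 \<Omega>" using v ND_L2 by auto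
  have "L2_inner \<Omega> (\<lambda>x. (eps n x - eps (n - 1) x) *v v' x) v' = eps_form n v' v' - eps_form (n - 1) v' v'"
    using L by (simp add: matrix_vector_mult_diff_rdistrib L2_inner_diff_left Linf_sym_apply_L2[OF eps_sym])
  moreover have "eps_form n (\<lambda>x. v x - v' x) (\<lambda>x. v x - v' x) = eps_form n v v - 2 * eps_form n v v' + eps_form n v' v'"
    using L by (simp add: e_diff_left e_diff_right L2_diff e_commute[of v' v])
  ultimately show ?thesis using dissipation(2)[OF n v] by (simp add: loss_def algebra_simps)
qed

text \<open>Let \<open>w = v' / 2\<close>. Since \<open>loss n v\<close> is a quadratic polynomial on the line through \<open>0\<close> and \<open>v'\<close>,
  \<open>loss n v v' = 2 loss n v w + 1/4 (eps (n - 1) v', v') - loss n v 0\<close>. The first term is nonnegative, the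
  second one at least \<open>l/4 \<parallel>v'\<parallel>\<^sup>2\<close>, the last one at most \<open>K \<parallel>v\<parallel>\<^sup>2\<close>. A convex combination of this bound with (B5) absorbs \<open>K \<parallel>v\<parallel>\<^sup>2\<close>.\<close>

lemma loss_strict:
  obtains \<delta> where "\<delta> > 0"
    "\<And>n v v'. late n \<Longrightarrow> v \<in> ND \<Omega> \<T> \<Longrightarrow> v' \<in> ND \<Omega> \<T> \<Longrightarrow> \<delta> * ((nrm v)\<^sup>2 + (nrm v')\<^sup>2) \<le> loss n v v'"
proof -
  define K where "K = Ce / 2 + \<tau> * CJ"
  have K: "K \<ge> 0" using eps_upper(1) J_upper(1) tau by (simp add: K_def)
  \<comment> \<open>the weight for which \<open>\<gamma> - \<theta> (\<gamma> + K)\<close>, the remaining coefficient of \<open>\<parallel>v\<parallel>\<^sup>2\<close>, is \<open>\<gamma> / 2\<close>\<close>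
  define \<theta> where "\<theta> = \<gamma> / (2 * (\<gamma> + K))"
  have th: "\<theta> > 0" "\<theta> \<le> 1" "\<theta> * (\<gamma> + K) = \<gamma> / 2" using dissipation(1) K by (auto simp: \<theta>_def field_simps)
  define \<delta> where "\<delta> = min (\<gamma> / 2) (\<theta> * l / 4)"
  have "\<delta> * ((nrm v)\<^sup>2 + (nrm v')\<^sup>2) \<le> loss n v v'" if n: "late n" and v: "v \<in> ND \<Omega> \<T>" "v' \<in> ND \<Omega> \<T>" for n v v'
  proof -
    have L: "v \<in> L2 \<Omega>" "v' \<in> L2 \<Omega>" using v ND_L2 by auto
    define w where "w = (\<lambda>x. (1/2) *\<^sub>R v' x)"
    have w: "w \<in> ND \<Omega> \<T>" unfolding w_def by (rule ND_scaleR[OF \<Omega>_bounded \<Omega>_open v(2)])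
    have "eps_form n v w = eps_form n v v' / 2" "eps_form (n - 1) w w = eps_form (n - 1) v' v' / 4"
      by (simp_all add: w_def e_scaleR_left L2_inner_scaleR_right)
    then have "loss n v v' = 2 * loss n v w + eps_form (n - 1) v' v' / 4 - (eps_form n v v / 2 + \<tau> * L2_inner \<Omega> (Jh n v) v)"
      by (simp add: loss_def algebra_simps)
    moreover have "eps_form n v v / 2 + \<tau> * L2_inner \<Omega> (Jh n v) v \<le> K * (nrm v)\<^sup>2"
    proof -
      have "eps_form n v v \<le> Ce * (nrm v)\<^sup>2" using e_le[OF n L(1) L(1)] by (simp add: power2_eq_square)
      moreover have "\<tau> * L2_inner \<Omega> (Jh n v) v \<le> \<tau> * (CJ * (nrm v)\<^sup>2)"
        using J_le[OF n L(1) L(1)] tau by (intro mult_left_mono) (auto simp: power2_eq_square)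
      ultimately show ?thesis by (simp add: K_def algebra_simps)
    qed
    moreover have "0 \<le> loss n v w"
      by (rule order_trans[OF _ loss_ge[OF n v(1) w]]) (use dissipation(1) in simp)
    moreover have "l * (nrm v')\<^sup>2 \<le> eps_form (n - 1) v' v'" by (rule eps_lower(2)[OF L(2)])
    ultimately have A: "l / 4 * (nrm v')\<^sup>2 - K * (nrm v)\<^sup>2 \<le> loss n v v'" by simp
    have B: "\<gamma> * (nrm v)\<^sup>2 \<le> loss n v v'" by (rule loss_ge[OF n v])
    have "\<theta> * (l / 4 * (nrm v')\<^sup>2 - K * (nrm v)\<^sup>2) + (1 - \<theta>) * (\<gamma> * (nrm v)\<^sup>2) \<le> loss n v v'"
      using mult_left_mono[OF A, of \<theta>] mult_left_mono[OF B, of "1 - \<theta>"] th(1,2) by (simp add: algebra_simps)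
    moreover have "\<theta> * (l / 4 * (nrm v')\<^sup>2 - K * (nrm v)\<^sup>2) + (1 - \<theta>) * (\<gamma> * (nrm v)\<^sup>2)
        = \<theta> * l / 4 * (nrm v')\<^sup>2 + (\<gamma> - \<theta> * (\<gamma> + K)) * (nrm v)\<^sup>2" by (simp add: algebra_simps)
    ultimately have "\<theta> * l / 4 * (nrm v')\<^sup>2 + \<gamma> / 2 * (nrm v)\<^sup>2 \<le> loss n v v'" using th(3) by simp
    moreover have "\<delta> * (nrm v')\<^sup>2 \<le> \<theta> * l / 4 * (nrm v')\<^sup>2" "\<delta> * (nrm v)\<^sup>2 \<le> \<gamma> / 2 * (nrm v)\<^sup>2"
      by (intro mult_right_mono; simp add: \<delta>_def)+
    ultimately show ?thesis by (simp add: distrib_left)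
  qed
  moreover have "\<delta> > 0" using dissipation(1) th(1) eps_lower(1) by (simp add: \<delta>_def)
  ultimately show ?thesis using that by blast
qed

text \<open>One step of the scheme at a late time, without source and multiplied by \<open>\<tau>\<close>.\<close>

definition step :: "nat \<Rightarrow> field3 \<times> field3 \<Rightarrow> field3 \<times> field3 \<Rightarrow> bool" where
  "step n vw EH \<longleftrightarrow> (case (vw, EH) of ((v, w), (E, H)) \<Rightarrow>
     E \<in> ND \<Omega> \<T> \<and> H \<in> DG \<Omega> \<T> \<and>
     (\<forall>vh\<in>ND \<Omega> \<T>. \<forall>c. has_weak_curl \<Omega> vh c \<longrightarrow>
        eps_form n (\<lambda>x. E x - v x) vh - \<tau> * L2_inner \<Omega> H c + \<tau> * L2_inner \<Omega> (Jh n E) vh + \<tau> * bd E vh = 0) \<and>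
     (\<exists>c. has_weak_curl \<Omega> E c \<and> (AE x in lebesgue_on \<Omega>. M x *v (H x - w x) + \<tau> *\<^sub>R c x = 0)))"

definition late_energy :: "nat \<Rightarrow> field3 \<times> field3 \<Rightarrow> real" where
  "late_energy n = (\<lambda>(v, w). 1/2 * (eps_form n v v + mu_form w w))"

text \<open>The discrete energy balance: test with \<open>E\<close>, and insert \<open>\<tau> curl E = - M (H - w)\<close>. The squared increment of the magnetic field and
  the boundary term are nonnegative and are dropped.\<close>

lemma step_energy:
  assumes st: "step n (v, w) (E, H)" and v: "v \<in> ND \<Omega> \<T>" and w: "w \<in> DG \<Omega> \<T>"
  shows "late_energy n (E, H) + loss n E v \<le> late_energy (n - 1) (v, w)"
proof -
  have E: "E \<in> ND \<Omega> \<T>" and H: "H \<in> DG \<Omega> \<T>" using st unfolding step_def by auto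
  obtain c where c: "has_weak_curl \<Omega> E c" "AE x in lebesgue_on \<Omega>. M x *v (H x - w x) + \<tau> *\<^sub>R c x = 0"
    using st unfolding step_def by auto
  have eq: "eps_form n (\<lambda>x. E x - v x) E - \<tau> * L2_inner \<Omega> H c + \<tau> * L2_inner \<Omega> (Jh n E) E + \<tau> * bd E E = 0"
    using st E c(1) unfolding step_def by auto
  have L: "v \<in> L2 \<Omega>" "E \<in> L2 \<Omega>" "w \<in> L2 \<Omega>" "H \<in> L2 \<Omega>" "c \<in> L2 \<Omega>"
    using v E w H c(1) ND_L2 DG_L2 unfolding has_weak_curl_def by auto
  let ?D = "\<lambda>x. H x - w x"
  have D: "?D \<in> L2 \<Omega>" by (intro L2_diff L)
  have "mu_form ?D H = L2_inner \<Omega> (\<lambda>x. (- \<tau>) *\<^sub>R c x) H"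
  proof (rule L2_inner_cong_AE)
    show "AE x in lebesgue_on \<Omega>. M x *v (H x - w x) = (- \<tau>) *\<^sub>R c x"
      using c(2) by eventually_elim (simp add: eq_neg_iff_add_eq_0)
  qed (intro Linf_sym_apply_L2 M_sym D L(4) L2_scaleR L(5))+
  then have "- (\<tau> * L2_inner \<Omega> H c) = mu_form ?D H"
    by (simp only: L2_inner_scaleR_left L2_inner_commute[of \<Omega> H c] mult_minus_left)
  also have "\<dots> = 1/2 * mu_form H H - 1/2 * mu_form w w + 1/2 * mu_form ?D ?D"
    using L D by (simp add: m_diff_left m_diff_right m_commute[of w H] field_simps)
  also have "\<dots> \<ge> 1/2 * mu_form H H - 1/2 * mu_form w w"
  proof -
    have "0 \<le> lM * (nrm ?D)\<^sup>2" using M_lower(1) by simp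
    also have "\<dots> \<le> mu_form ?D ?D" by (rule M_lower(2)[OF D])
    finally show ?thesis by simp
  qed
  finally have "1/2 * mu_form H H - 1/2 * mu_form w w \<le> - (\<tau> * L2_inner \<Omega> H c)" .
  moreover have "0 \<le> \<tau> * bd E E" using bd_nonneg tau by simp
  moreover have "eps_form n (\<lambda>x. E x - v x) E = eps_form n E E - eps_form n E v"
    using L by (simp add: e_diff_left e_commute[of v E])
  moreover have "late_energy n (E, H) = eps_form n E E / 2 + mu_form H H / 2"
    "late_energy (n - 1) (v, w) = eps_form (n - 1) v v / 2 + mu_form w w / 2"
    by (simp_all add: late_energy_def)
  moreover have "loss n E v = eps_form n E E / 2 - eps_form n E v + eps_form (n - 1) v v / 2 + \<tau> * L2_inner \<Omega> (Jh n E) E"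
    by (simp add: loss_def)
  ultimately show ?thesis using eq by linarith
qed

text \<open>\<open>M H\<close> differs from \<open>M w\<close> by \<open>- \<tau> curl E\<close>.\<close>

lemma step_curl_lift:
  assumes st: "step n (v, w) (E, H)" and w: "curl_lift M w u"
  shows "\<exists>u'. curl_lift M H u'"
proof -
  have E: "E \<in> ND \<Omega> \<T>" and H: "H \<in> DG \<Omega> \<T>" using st unfolding step_def by auto
  obtain c where c: "has_weak_curl \<Omega> E c" "AE x in lebesgue_on \<Omega>. M x *v (H x - w x) + \<tau> *\<^sub>R c x = 0"
    using st unfolding step_def by auto
  obtain c0 where c0: "has_weak_curl \<Omega> u c0" "AE x in lebesgue_on \<Omega>. c0 x = M x *v w x"
    using w unfolding curl_lift_def by blast
  have "AE x in lebesgue_on \<Omega>. c0 x + (- \<tau>) *\<^sub>R c x = M x *v H x"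
    using c(2) c0(2) by eventually_elim (simp add: matrix_vector_mult_diff_distrib algebra_simps)
  moreover have "has_weak_curl \<Omega> (\<lambda>x. u x + (- \<tau>) *\<^sub>R E x) (\<lambda>x. c0 x + (- \<tau>) *\<^sub>R c x)"
    by (rule has_weak_curl_add_scaleR[OF \<Omega>_bounded \<Omega>_open c0(1) c(1)])
  moreover have "(\<lambda>x. u x + (- \<tau>) *\<^sub>R E x) \<in> ND \<Omega> \<T>"
    using w E by (intro ND_add_scaleR[OF \<Omega>_bounded \<Omega>_open]) (auto simp: curl_lift_def)
  ultimately show ?thesis using H unfolding curl_lift_def by blast
qed

text \<open>Test with a function \<open>u\<close> that satisfies \<open>curl u = M H\<close> and \<open>\<parallel>u\<parallel> \<le> C \<parallel>H\<parallel>\<close>. The curl term becomes \<open>(M H, H)\<close>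
  and the others are at most a constant times \<open>(\<parallel>E\<parallel> + \<parallel>v\<parallel>) \<parallel>H\<parallel>\<close>. One factor \<open>\<parallel>H\<parallel>\<close> cancels against the lower bound on \<open>M\<close>,
  which bounds \<open>\<parallel>H\<parallel>\<close> and then \<open>(M H, H)\<close>.\<close>

lemma magnetic_energy_bound:
  obtains K where "K \<ge> 0" "\<And>n v w E H u. late n \<Longrightarrow> step n (v, w) (E, H) \<Longrightarrow> v \<in> ND \<Omega> \<T> \<Longrightarrow> curl_lift M H u \<Longrightarrow>
     mu_form H H \<le> K * (nrm E + nrm v)\<^sup>2"
proof -
  obtain C where C: "C \<ge> 0"
    "\<And>w u. curl_lift M w u \<Longrightarrow> \<exists>u'. curl_lift M w u' \<and> L2_norm \<Omega> u' \<le> C * L2_norm \<Omega> w"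
    using curl_lift_bounded[of M] by blast
  define B where "B = (Ce / \<tau> + CJ + Cb) * C"
  have B0: "B \<ge> 0" using C(1) eps_upper(1) J_upper(1) bd_upper(1) tau by (simp add: B_def)
  have "mu_form H H \<le> (B * (B / lM)) * (nrm E + nrm v)\<^sup>2"
    if n: "late n" and st: "step n (v, w) (E, H)" and v: "v \<in> ND \<Omega> \<T>" and Hu: "curl_lift M H u0" for n v w E H u0
  proof -
    obtain u where u: "curl_lift M H u" "nrm u \<le> C * nrm H" using C(2)[OF Hu] by blast
    obtain c where c: "has_weak_curl \<Omega> u c" "AE x in lebesgue_on \<Omega>. c x = M x *v H x"
      using u(1) unfolding curl_lift_def by blast
    have ND: "u \<in> ND \<Omega> \<T>" "E \<in> ND \<Omega> \<T>" "H \<in> DG \<Omega> \<T>" using u(1) st unfolding curl_lift_def step_def by auto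
    have L: "u \<in> L2 \<Omega>" "E \<in> L2 \<Omega>" "v \<in> L2 \<Omega>" "H \<in> L2 \<Omega>" "c \<in> L2 \<Omega>"
      using ND v c(1) ND_L2 DG_L2 unfolding has_weak_curl_def by auto
    let ?s = "nrm E + nrm v"
    have s0: "?s \<ge> 0" by (simp add: L2_norm_nonneg)
    have eq: "eps_form n (\<lambda>x. E x - v x) u - \<tau> * L2_inner \<Omega> H c + \<tau> * L2_inner \<Omega> (Jh n E) u + \<tau> * bd E u = 0"
      using st ND(1) c(1) unfolding step_def by auto
    have "mu_form H H = L2_inner \<Omega> c H"
      by (rule L2_inner_cong_AE[symmetric]) (use c(2) L Linf_sym_apply_L2[OF M_sym] in auto)
    then have mHH: "\<tau> * mu_form H H = eps_form n (\<lambda>x. E x - v x) u + \<tau> * L2_inner \<Omega> (Jh n E) u + \<tau> * bd E u"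
      using eq L2_inner_commute[of \<Omega> H c] by simp
    have "nrm (\<lambda>x. E x - v x) \<le> ?s"
      using L2_norm_triangle[of E \<Omega> "\<lambda>x. (- 1) *\<^sub>R v x"] L2_norm_scaleR[of \<Omega> "- 1" v] L L2_scaleR[of v \<Omega> "- 1"] by simp
    then have "Ce * nrm (\<lambda>x. E x - v x) * nrm u \<le> Ce * ?s * nrm u"
      by (intro mult_right_mono mult_left_mono eps_upper(1) L2_norm_nonneg)
    then have 1: "eps_form n (\<lambda>x. E x - v x) u \<le> Ce * ?s * nrm u"
      using e_le[OF n L2_diff[OF L(2,3)] L(1)] by linarith
    have "CJ * nrm E * nrm u \<le> CJ * ?s * nrm u" "Cb * nrm E * nrm u \<le> Cb * ?s * nrm u"
      by (intro mult_right_mono mult_left_mono J_upper(1) bd_upper(1) L2_norm_nonneg; simp add: L2_norm_nonneg)+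
    then have "L2_inner \<Omega> (Jh n E) u \<le> CJ * ?s * nrm u" "bd E u \<le> Cb * ?s * nrm u"
      using J_le[OF n L(2) L(1)] bd_upper(2)[OF ND(2,1)] by linarith+
    then have "\<tau> * L2_inner \<Omega> (Jh n E) u \<le> \<tau> * (CJ * ?s * nrm u)" "\<tau> * bd E u \<le> \<tau> * (Cb * ?s * nrm u)"
      using tau by simp_all
    then have "\<tau> * mu_form H H \<le> \<tau> * ((Ce / \<tau> + CJ + Cb) * ?s * nrm u)"
      using 1 tau unfolding mHH by (simp add: distrib_left distrib_right)
    then have "mu_form H H \<le> (Ce / \<tau> + CJ + Cb) * ?s * nrm u" using tau by simp
    also have "\<dots> \<le> (Ce / \<tau> + CJ + Cb) * ?s * (C * nrm H)"
      using u(2) s0 eps_upper(1) J_upper(1) bd_upper(1) tau by (intro mult_left_mono) auto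
    also have "\<dots> = B * ?s * nrm H" by (simp add: B_def)
    finally have mle: "mu_form H H \<le> B * ?s * nrm H" .
    have "lM * nrm H * nrm H \<le> B * ?s * nrm H"
      using M_lower(2)[OF L(4)] mle by (simp add: power2_eq_square)
    then have "lM * nrm H \<le> B * ?s"
      using L2_norm_nonneg[of \<Omega> H] B0 s0 by (cases "nrm H = 0") (auto simp: mult_le_cancel_right)
    then have "nrm H \<le> B * ?s / lM" using M_lower(1) by (simp add: field_simps)
    then have "B * ?s * nrm H \<le> B * ?s * (B * ?s / lM)" using B0 s0 by (intro mult_left_mono) auto
    then show ?thesis using mle by (simp add: power2_eq_square mult_ac)
  qed
  moreover have "B * (B / lM) \<ge> 0" using B0 M_lower(1) by simp
  ultimately show ?thesis using that by blast
qed

text \<open>The energy after the step is at most \<open>A (\<parallel>E\<parallel>\<^sup>2 + \<parallel>v\<parallel>\<^sup>2)\<close> and the loss at least \<open>\<delta> (\<parallel>E\<parallel>\<^sup>2 + \<parallel>v\<parallel>\<^sup>2)\<close>, so \<open>\<kappa> = \<delta> / A\<close>.\<close>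

lemma energy_contraction:
  obtains \<kappa> where "\<kappa> > 0" "\<And>n v w E H u. late n \<Longrightarrow> step n (v, w) (E, H) \<Longrightarrow> v \<in> ND \<Omega> \<T> \<Longrightarrow> curl_lift M w u \<Longrightarrow>
     (1 + \<kappa>) * late_energy n (E, H) \<le> late_energy (n - 1) (v, w)"
proof -
  obtain \<delta> where \<delta>: "\<delta> > 0"
    "\<And>n v v'. late n \<Longrightarrow> v \<in> ND \<Omega> \<T> \<Longrightarrow> v' \<in> ND \<Omega> \<T> \<Longrightarrow> \<delta> * ((nrm v)\<^sup>2 + (nrm v')\<^sup>2) \<le> loss n v v'"
    using loss_strict by blast
  obtain K where K: "K \<ge> 0" "\<And>n v w E H u. late n \<Longrightarrow> step n (v, w) (E, H) \<Longrightarrow> v \<in> ND \<Omega> \<T> \<Longrightarrow> curl_lift M H u \<Longrightarrow>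
     mu_form H H \<le> K * (nrm E + nrm v)\<^sup>2"
    using magnetic_energy_bound by blast
  define A where "A = Ce / 2 + K + 1"
  have A: "A > 0" using K(1) eps_upper(1) by (simp add: A_def)
  have "(1 + \<delta> / A) * late_energy n (E, H) \<le> late_energy (n - 1) (v, w)"
    if n: "late n" and st: "step n (v, w) (E, H)" and v: "v \<in> ND \<Omega> \<T>" and w: "curl_lift M w u" for n v w E H u
  proof -
    have E: "E \<in> ND \<Omega> \<T>" using st unfolding step_def by auto
    let ?q = "(nrm E)\<^sup>2 + (nrm v)\<^sup>2"
    have wDG: "w \<in> DG \<Omega> \<T>" using w unfolding curl_lift_def by blast
    obtain u' where "curl_lift M H u'" using step_curl_lift[OF st w] by blast
    then have "mu_form H H \<le> K * (nrm E + nrm v)\<^sup>2" by (rule K(2)[OF n st v])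
    also have "\<dots> \<le> K * (2 * ?q)"
      using sum_squares_bound[of "nrm E" "nrm v"] K(1) by (intro mult_left_mono) (auto simp: power2_sum)
    finally have "mu_form H H \<le> 2 * K * ?q" by (simp add: algebra_simps)
    moreover have "eps_form n E E \<le> Ce * (nrm E)\<^sup>2" using e_le[OF n ND_L2[OF E] ND_L2[OF E]] by (simp add: power2_eq_square)
    moreover have "Ce * (nrm E)\<^sup>2 \<le> Ce * ?q" using eps_upper(1) by (intro mult_left_mono) auto
    ultimately have "late_energy n (E, H) \<le> (Ce / 2 + K) * ?q" by (simp add: late_energy_def algebra_simps)
    also have "\<dots> \<le> A * ?q" by (intro mult_right_mono) (auto simp: A_def)
    finally have "\<delta> / A * late_energy n (E, H) \<le> \<delta> / A * (A * ?q)" using \<delta>(1) A by (intro mult_left_mono) auto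
    also have "\<dots> = \<delta> * ?q" using A by simp
    also have "\<dots> \<le> loss n E v" by (rule \<delta>(2)[OF n E v])
    finally show ?thesis using step_energy[OF st v wDG] by (simp add: distrib_right)
  qed
  then show ?thesis using that[of "\<delta> / A"] \<delta>(1) A by simp
qed

text \<open>Choose \<open>c\<close> with \<open>exp (c \<tau>) = 1 + \<kappa>\<close> and iterate.\<close>

lemma late_energy_decay:
  obtains c where "c > 0" "\<And>m0 E H u. (\<And>n. n > m0 \<Longrightarrow> late n \<and> step n (E (n - 1), H (n - 1)) (E n, H n)) \<Longrightarrow>
      E m0 \<in> ND \<Omega> \<T> \<Longrightarrow> curl_lift M (H m0) u \<Longrightarrow>
      (\<forall>n\<ge>m0. (\<exists>u. curl_lift M (H n) u) \<and>
         late_energy n (E n, H n) \<le> exp (- c * (real n * \<tau> - real m0 * \<tau>)) * late_energy m0 (E m0, H m0))"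
proof -
  obtain \<kappa> where \<kappa>: "\<kappa> > 0" "\<And>n v w E H u. late n \<Longrightarrow> step n (v, w) (E, H) \<Longrightarrow> v \<in> ND \<Omega> \<T> \<Longrightarrow> curl_lift M w u \<Longrightarrow>
     (1 + \<kappa>) * late_energy n (E, H) \<le> late_energy (n - 1) (v, w)"
    using energy_contraction by blast
  define c where "c = ln (1 + \<kappa>) / \<tau>"
  have c: "c > 0" using \<kappa>(1) tau by (simp add: c_def)
  have ec: "exp (- c * \<tau>) * (1 + \<kappa>) = 1" using \<kappa>(1) tau by (simp add: c_def exp_minus)
  have "E n \<in> ND \<Omega> \<T> \<and> (\<exists>u. curl_lift M (H n) u) \<and>
      late_energy n (E n, H n) \<le> exp (- c * (real n * \<tau> - real m0 * \<tau>)) * late_energy m0 (E m0, H m0)"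
    if st: "\<And>n. n > m0 \<Longrightarrow> late n \<and> step n (E (n - 1), H (n - 1)) (E n, H n)"
      and E0: "E m0 \<in> ND \<Omega> \<T>" and H0: "curl_lift M (H m0) u" and n: "n \<ge> m0"
    for m0 E H u n
    using n
  proof (induction n rule: dec_induct)
    case base
    then show ?case using E0 H0 by auto
  next
    case (step n)
    have s: "late (Suc n)" "step (Suc n) (E n, H n) (E (Suc n), H (Suc n))" using st[of "Suc n"] step.hyps by auto
    obtain u' where u': "curl_lift M (H n) u'" using step.IH by blast
    have "(1 + \<kappa>) * late_energy (Suc n) (E (Suc n), H (Suc n)) \<le> late_energy n (E n, H n)"
      using \<kappa>(2)[OF s _ u'] step.IH by simp
    also have "\<dots> \<le> exp (- c * (real n * \<tau> - real m0 * \<tau>)) * late_energy m0 (E m0, H m0)"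
      using step.IH by blast
    finally have "exp (- c * \<tau>) * ((1 + \<kappa>) * late_energy (Suc n) (E (Suc n), H (Suc n)))
        \<le> exp (- c * \<tau>) * (exp (- c * (real n * \<tau> - real m0 * \<tau>)) * late_energy m0 (E m0, H m0))"
      by (intro mult_left_mono) auto
    moreover have "exp (- c * \<tau>) * exp (- c * (real n * \<tau> - real m0 * \<tau>)) = exp (- c * (real (Suc n) * \<tau> - real m0 * \<tau>))"
      by (simp add: exp_add[symmetric] algebra_simps)
    ultimately have "late_energy (Suc n) (E (Suc n), H (Suc n))
        \<le> exp (- c * (real (Suc n) * \<tau> - real m0 * \<tau>)) * late_energy m0 (E m0, H m0)"
      using ec by (simp only: mult.assoc[symmetric] mult_1_left)
    moreover have "E (Suc n) \<in> ND \<Omega> \<T>" using s(2) unfolding step_def by auto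
    ultimately show ?case using step_curl_lift[OF s(2) u'] by blast
  qed
  then show ?thesis using that[OF c] by blast
qed

text \<open>The mixed term is \<open>(M w, z) = (curl u, z) = 0\<close>.\<close>

lemma late_energy_split:
  assumes v: "v \<in> ND \<Omega> \<T>" and w: "curl_lift M w u" and z: "(\<lambda>x. 0, z) \<in> N_space \<Omega> \<T>"
  shows "late_energy n (v, \<lambda>x. w x + z x) = late_energy n (\<lambda>x. 0, z) + late_energy n (v, w)"
proof -
  obtain c where c: "has_weak_curl \<Omega> u c" "AE x in lebesgue_on \<Omega>. c x = M x *v w x"
    using w unfolding curl_lift_def by blast
  have L: "w \<in> L2 \<Omega>" "z \<in> L2 \<Omega>" "c \<in> L2 \<Omega>"
    using w z c(1) DG_L2 unfolding curl_lift_def N_space_def has_weak_curl_def by auto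
  have "mu_form w z = L2_inner \<Omega> c z"
    by (rule L2_inner_cong_AE[symmetric]) (use c(2) L Linf_sym_apply_L2[OF M_sym] in auto)
  also have "\<dots> = 0"
    using z w c(1) unfolding N_space_def curl_lift_def by (auto simp: L2_inner_commute[of \<Omega> c z])
  finally have "mu_form w z = 0" .
  then have "mu_form (\<lambda>x. w x + z x) (\<lambda>x. w x + z x) = mu_form w w + mu_form z z"
    using L by (simp add: matrix_vector_right_distrib L2_inner_add_left L2_inner_add_right
        Linf_sym_apply_L2[OF M_sym] L2_add m_commute[of z w])
  moreover have "eps_form n (\<lambda>x. 0) (\<lambda>x. 0) = 0" by (simp add: L2_inner_def)
  ultimately show ?thesis by (simp add: late_energy_def)
qed

text \<open>Subtracting \<open>z\<close> from both magnetic fields changes neither their increment nor, by orthogonality to curls, the first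
  equation. The three late-time data remove the source and the term with \<open>\<partial>\<^sub>t\<mu>\<close>.\<close>

lemma step_if_is_step:
  assumes n: "late n" and eps: "eps n = \<epsilon> (real n * \<tau>)"
    and Jh: "\<And>u. Jh n u = (\<lambda>x. J x (u x) 0 (real n * \<tau>))"
    and bd: "\<And>u v. bd u v = (LINT x|surface_measure \<Omega>. b x (tangential_trace \<Omega> u x) \<bullet> tangential_trace \<Omega> v x)"
    and late_data: "Qh \<T> (\<mu> (real n * \<tau>)) = M" "Qh \<T> (\<mu>t (real n * \<tau>)) = (\<lambda>x. 0)" "Qh \<T> (f (real n * \<tau>)) = (\<lambda>x. 0)"
    and indep: "\<And>u w. AE x in lebesgue_on \<Omega>. J x (u x) (w x) (real n * \<tau>) = J x (u x) 0 (real n * \<tau>)"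
    and st: "is_step \<Omega> \<T> \<tau> \<epsilon> \<mu> \<mu>t J b f n (v, w) (E, H)"
    and v: "v \<in> ND \<Omega> \<T>" and w: "w \<in> DG \<Omega> \<T>" and z: "(\<lambda>x. 0, z) \<in> N_space \<Omega> \<T>"
  shows "step n (v, \<lambda>x. w x - z x) (E, \<lambda>x. H x - z x)"
proof -
  let ?t = "real n * \<tau>"
  have zDG: "z \<in> DG \<Omega> \<T>" and orth: "\<And>v c. v \<in> ND \<Omega> \<T> \<Longrightarrow> has_weak_curl \<Omega> v c \<Longrightarrow> L2_inner \<Omega> z c = 0"
    using z unfolding N_space_def by auto
  have E: "E \<in> ND \<Omega> \<T>" and H: "H \<in> DG \<Omega> \<T>"
    and weak: "\<And>vh c. vh \<in> ND \<Omega> \<T> \<Longrightarrow> has_weak_curl \<Omega> vh c \<Longrightarrow>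
      (LINT x|lebesgue_on \<Omega>. (\<epsilon> ?t x *v ((1 / \<tau>) *\<^sub>R (E x - v x))) \<bullet> vh x - H x \<bullet> c x + J x (E x) (H x) ?t \<bullet> vh x)
        + bd E vh = 0"
    and strong: "\<exists>c. has_weak_curl \<Omega> E c \<and> (AE x in lebesgue_on \<Omega>. M x *v ((1 / \<tau>) *\<^sub>R (H x - w x)) + c x = 0)"
    using st late_data by (auto simp: is_step_def Let_def bd)
  have L: "E \<in> L2 \<Omega>" "v \<in> L2 \<Omega>" "H \<in> L2 \<Omega>" "z \<in> L2 \<Omega>" using E v H zDG ND_L2 DG_L2 by auto
  have "eps_form n (\<lambda>x. E x - v x) vh - \<tau> * L2_inner \<Omega> (\<lambda>x. H x - z x) c + \<tau> * L2_inner \<Omega> (Jh n E) vh + \<tau> * bd E vh = 0"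
    if vh: "vh \<in> ND \<Omega> \<T>" and c: "has_weak_curl \<Omega> vh c" for vh c
  proof -
    have Lv: "vh \<in> L2 \<Omega>" "c \<in> L2 \<Omega>" using vh c ND_L2 unfolding has_weak_curl_def by auto
    let ?A = "\<lambda>x. eps n x *v ((1 / \<tau>) *\<^sub>R (E x - v x))"
    have A: "?A \<in> L2 \<Omega>" by (intro Linf_sym_apply_L2 eps_sym L2_scaleR L2_diff L)
    have JE: "Jh n E \<in> L2 \<Omega>" by (rule J_upper(2)[OF n L(1)])
    have JH: "(\<lambda>x. J x (E x) (H x) ?t) \<in> borel_measurable (lebesgue_on \<Omega>)"
      by (rule borel_measurable_lebesgue_on_AE[OF _ L2_measurable[OF JE]])
         (use \<Omega>_open indep[of E H] in \<open>auto simp: Jh elim!: eventually_mono\<close>)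
    have "(LINT x|lebesgue_on \<Omega>. ?A x \<bullet> vh x - H x \<bullet> c x + J x (E x) (H x) ?t \<bullet> vh x)
        = (LINT x|lebesgue_on \<Omega>. ?A x \<bullet> vh x - H x \<bullet> c x + Jh n E x \<bullet> vh x)"
    proof (rule integral_cong_AE)
      show "AE x in lebesgue_on \<Omega>. ?A x \<bullet> vh x - H x \<bullet> c x + J x (E x) (H x) ?t \<bullet> vh x
          = ?A x \<bullet> vh x - H x \<bullet> c x + Jh n E x \<bullet> vh x"
        using indep[of E H] by eventually_elim (simp add: Jh)
    qed (intro borel_measurable_add borel_measurable_diff borel_measurable_inner JH L2_measurable A JE L(3) Lv)+
    also have "\<dots> = L2_inner \<Omega> ?A vh - L2_inner \<Omega> H c + L2_inner \<Omega> (Jh n E) vh"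
      unfolding L2_inner_def
      using integrable_inner_L2[OF A Lv(1)] integrable_inner_L2[OF L(3) Lv(2)] integrable_inner_L2[OF JE Lv(1)] by simp
    also have "L2_inner \<Omega> ?A vh = (1 / \<tau>) * eps_form n (\<lambda>x. E x - v x) vh"
      by (simp add: matrix_vector_mult_scaleR L2_inner_scaleR_left)
    also have "L2_inner \<Omega> H c = L2_inner \<Omega> (\<lambda>x. H x - z x) c"
      using orth[OF vh c] L Lv by (simp add: L2_inner_diff_left)
    finally have "(1 / \<tau>) * eps_form n (\<lambda>x. E x - v x) vh - L2_inner \<Omega> (\<lambda>x. H x - z x) c + L2_inner \<Omega> (Jh n E) vh + bd E vh = 0"
      using weak[OF vh c] by (simp add: eps)
    then have "\<tau> * ((1 / \<tau>) * eps_form n (\<lambda>x. E x - v x) vh - L2_inner \<Omega> (\<lambda>x. H x - z x) c + L2_inner \<Omega> (Jh n E) vh + bd E vh) = 0"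
      by simp
    then show ?thesis using tau by (simp add: distrib_left right_diff_distrib)
  qed
  moreover have "\<exists>c. has_weak_curl \<Omega> E c \<and> (AE x in lebesgue_on \<Omega>. M x *v (H x - z x - (w x - z x)) + \<tau> *\<^sub>R c x = 0)"
  proof -
    obtain c where c: "has_weak_curl \<Omega> E c" "AE x in lebesgue_on \<Omega>. M x *v ((1 / \<tau>) *\<^sub>R (H x - w x)) + c x = 0"
      using strong by blast
    have "AE x in lebesgue_on \<Omega>. M x *v (H x - z x - (w x - z x)) + \<tau> *\<^sub>R c x = 0"
      using c(2)
    proof eventually_elim
      case (elim x)
      then have "\<tau> *\<^sub>R (M x *v ((1 / \<tau>) *\<^sub>R (H x - w x)) + c x) = 0" by simp
      then show ?case using tau by (simp add: matrix_vector_mult_scaleR scaleR_add_right)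
    qed
    then show ?thesis using c(1) by blast
  qed
  moreover have "(\<lambda>x. H x - z x) \<in> DG \<Omega> \<T>" using DG_add_scaleR[OF H zDG, of "- 1"] by simp
  ultimately show ?thesis using E unfolding step_def by simp
qed

end

section \<open>Exponential decay\<close>

theorem theorem3p13:
  fixes \<Omega> :: "vec3 set" and I :: "real set" and \<T> :: "real \<Rightarrow> vec3 set set"
    and h \<tau> T\<^sub>\<mu> T\<^sub>J T\<^sub>f :: real
    and \<epsilon> \<epsilon>t \<mu> \<mu>t :: "real \<Rightarrow> vec3 \<Rightarrow> mat3" and \<mu>inf :: "vec3 \<Rightarrow> mat3"
    and Jtot :: "vec3 \<Rightarrow> vec3 \<Rightarrow> vec3 \<Rightarrow> real \<Rightarrow> vec3" and b :: "vec3 \<Rightarrow> vec3 \<Rightarrow> vec3"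
    and f :: "real \<Rightarrow> field3"
  assumes domain: "bounded_lipschitz_polyhedral_domain \<Omega>"
    and meshes: "quasi_uniform_family \<Omega> I \<T>"
    and h: "h \<in> I" "h > 0"
    and tau: "\<tau> > 0"
    and B1: "coefficient_assumption \<Omega> \<epsilon> \<epsilon>t \<mu> \<mu>t \<mu>inf T\<^sub>\<mu>"
    and B2: "current_assumption \<Omega> Jtot T\<^sub>J"
    and B3: "boundary_assumption \<Omega> b"
    and B4: "source_assumption \<Omega> f T\<^sub>f"
    and B5: "dissipation_assumption \<Omega> (\<T> h) \<tau> \<epsilon> (current Jtot \<epsilon>t) T\<^sub>J"
    and WP: "well_posed \<Omega> (\<T> h) \<tau> \<epsilon> \<mu> \<mu>t (current Jtot \<epsilon>t) b f"
  defines "S \<equiv> solution_operator \<Omega> (\<T> h) \<tau> \<epsilon> \<mu> \<mu>t (current Jtot \<epsilon>t) b f"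
    and "\<E> \<equiv> energy \<Omega> (\<T> h) \<tau> \<epsilon> \<mu>"
    and "m \<equiv> LEAST n::nat. real n * \<tau> \<ge> max T\<^sub>J (max T\<^sub>f T\<^sub>\<mu>)"
  shows "\<exists>c>0. \<forall>E H E' H' Hinf.
     (E 0, H 0) \<in> ND \<Omega> (\<T> h) \<times> DG \<Omega> (\<T> h) \<and>
     (\<forall>n\<ge>1. (E n, H n) = S n (E (n - 1), H (n - 1))) \<and>
     (E', H') \<in> W_space \<Omega> (\<T> h) \<mu>inf \<and> (\<lambda>x. 0, Hinf) \<in> N_space \<Omega> (\<T> h) \<and>
     E m = E' \<and> H m = (\<lambda>x. H' x + Hinf x)
     \<longrightarrow> (\<forall>n\<ge>m + 1. \<E> n (E n, H n) \<le>
            \<E> m (\<lambda>x. 0, Hinf) + exp (- c * (real n * \<tau> - real m * \<tau>)) * \<E> m (E', H'))"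
proof -
  let ?J = "current Jtot \<epsilon>t" and ?M = "Qh (\<T> h) \<mu>inf"
  interpret meshed_domain \<Omega> "\<T> h"
    using domain meshes h(1) unfolding quasi_uniform_family_def by unfold_locales auto
  have \<epsilon>_sym: "\<And>t. t \<ge> 0 \<Longrightarrow> \<epsilon> t \<in> Linf_sym \<Omega>" and \<mu>_sym: "\<And>t. t \<ge> 0 \<Longrightarrow> \<mu> t \<in> Linf_sym \<Omega>"
    and \<epsilon>_cont: "time_continuous {0<..} (Linf_sym \<Omega>) (Linf_norm \<Omega>) \<epsilon>"
    and \<epsilon>t_cont: "time_continuous {0<..} (Linf_sym \<Omega>) (Linf_norm \<Omega>) \<epsilon>t"
    and \<mu>t_cont: "time_continuous {0<..} (Linf_sym \<Omega>) (Linf_norm \<Omega>) \<mu>t"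
    and \<epsilon>_bd: "bochner_Linf {0<..} (Linf_sym \<Omega>) (Linf_norm \<Omega>) \<epsilon>"
    and \<epsilon>t_bd: "bochner_Linf {0<..} (Linf_sym \<Omega>) (Linf_norm \<Omega>) \<epsilon>t"
    and \<mu>_deriv: "weak_time_derivative {0<..} \<Omega> \<mu> \<mu>t"
    and T\<mu>: "T\<^sub>\<mu> \<ge> 0" and \<mu>inf_sym: "\<mu>inf \<in> Linf_sym \<Omega>"
    and \<mu>_late: "\<And>t. t \<ge> T\<^sub>\<mu> \<Longrightarrow> AE x in lebesgue_on \<Omega>. \<mu> t x = \<mu>inf x"
  proof -
    have "time_continuous {0..} (Linf_sym \<Omega>) (Linf_norm \<Omega>) \<epsilon>" using B1 unfolding coefficient_assumption_def by blast
    then show "time_continuous {0<..} (Linf_sym \<Omega>) (Linf_norm \<Omega>) \<epsilon>"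
      unfolding time_continuous_def by (auto intro: tendsto_within_subset[of _ _ _ "{0..}"])
  qed (use B1 in \<open>auto simp: coefficient_assumption_def time_continuous_def W1_Linf_sym_def\<close>)
  obtain l where l: "l > 0" "\<And>t. t \<ge> 0 \<Longrightarrow> AE x in lebesgue_on \<Omega>. \<forall>\<xi>. l * (norm \<xi>)\<^sup>2 \<le> \<xi> \<bullet> (\<epsilon> t x *v \<xi>)"
    by (rule uniform_bounds_coercive[of \<Omega> \<epsilon>]) (use B1 in \<open>auto simp: coefficient_assumption_def\<close>)
  obtain lM where lM: "lM > 0" "AE x in lebesgue_on \<Omega>. \<forall>\<xi>. lM * (norm \<xi>)\<^sup>2 \<le> \<xi> \<bullet> (\<mu>inf x *v \<xi>)"
    by (rule uniform_bounds_coercive[of \<Omega> "\<lambda>t. \<mu>inf"]) (use B1 in \<open>auto simp: coefficient_assumption_def\<close>)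
  have M_coercive: "AE x in lebesgue_on \<Omega>. \<forall>\<xi>. lM * (norm \<xi>)\<^sup>2 \<le> \<xi> \<bullet> (?M x *v \<xi>)"
    using AE_in_cells by eventually_elim (use Qh_coercive[OF \<mu>inf_sym lM(2)] in blast)
  obtain C\<epsilon> where C\<epsilon>: "C\<epsilon> \<ge> 0" "\<And>t. t > 0 \<Longrightarrow> AE x in lebesgue_on \<Omega>. norm (\<epsilon> t x) \<le> C\<epsilon>"
    using bounded_in_time[OF \<epsilon>_bd \<epsilon>_cont] by blast
  have \<Omega>_sets: "\<Omega> \<in> sets lebesgue" using \<Omega>_open by auto
  obtain CJ where CJ: "CJ \<ge> 0"
    "\<And>t v. t > 0 \<Longrightarrow> t \<ge> T\<^sub>J \<Longrightarrow> v \<in> L2 \<Omega> \<Longrightarrow> (\<lambda>x. ?J x (v x) 0 t) \<in> L2 \<Omega>"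
    "\<And>t v. t > 0 \<Longrightarrow> t \<ge> T\<^sub>J \<Longrightarrow> v \<in> L2 \<Omega> \<Longrightarrow> L2_norm \<Omega> (\<lambda>x. ?J x (v x) 0 t) \<le> CJ * L2_norm \<Omega> v"
    "\<And>t v w. t > 0 \<Longrightarrow> t \<ge> T\<^sub>J \<Longrightarrow> AE x in lebesgue_on \<Omega>. ?J x (v x) (w x) t = ?J x (v x) 0 t"
    by (rule late_current[OF \<Omega>_sets B2 \<epsilon>t_bd \<epsilon>t_cont]) blast
  let ?bd = "\<lambda>u v. LINT x|surface_measure \<Omega>. b x (tangential_trace \<Omega> u x) \<bullet> tangential_trace \<Omega> v x"
  obtain Cb where Cb: "Cb \<ge> 0" "\<And>u v. u \<in> ND \<Omega> (\<T> h) \<Longrightarrow> v \<in> ND \<Omega> (\<T> h) \<Longrightarrow>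
      \<bar>?bd u v\<bar> \<le> Cb * L2_norm \<Omega> u * L2_norm \<Omega> v"
    using boundary_term_bound[OF B3] by blast
  obtain \<gamma> where \<gamma>: "\<gamma> > 0" "\<And>v v' n. v \<in> ND \<Omega> (\<T> h) \<Longrightarrow> v' \<in> ND \<Omega> (\<T> h) \<Longrightarrow> n \<ge> 1 \<Longrightarrow> real n * \<tau> \<ge> T\<^sub>J \<Longrightarrow>
        \<gamma> * (L2_norm \<Omega> v)\<^sup>2 \<le> 1/2 * L2_inner \<Omega> (\<lambda>x. \<epsilon> (real n * \<tau>) x *v (v x - v' x)) (\<lambda>x. v x - v' x)
        + \<tau> * L2_inner \<Omega> (\<lambda>x. ?J x (v x) 0 (real n * \<tau>)) v
        - 1/2 * L2_inner \<Omega> (\<lambda>x. (\<epsilon> (real n * \<tau>) x - \<epsilon> (real (n - 1) * \<tau>) x) *v v' x) v'"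
    using B5 unfolding dissipation_assumption_def by blast
  \<comment> \<open>some multiple of \<open>\<tau>\<close> exceeds the maximum, so the least index exists\<close>
  have tm: "real m * \<tau> \<ge> max T\<^sub>J (max T\<^sub>f T\<^sub>\<mu>)"
  proof -
    obtain k :: nat where "real k * \<tau> \<ge> max T\<^sub>J (max T\<^sub>f T\<^sub>\<mu>)"
      using real_arch_simple[of "max T\<^sub>J (max T\<^sub>f T\<^sub>\<mu>) / \<tau>"] tau by (auto simp: field_simps)
    then show ?thesis unfolding m_def by (rule LeastI)
  qed
  have late: "real n * \<tau> \<ge> T\<^sub>J" "real n * \<tau> \<ge> T\<^sub>f" "real n * \<tau> > T\<^sub>\<mu>" "real n * \<tau> > 0" "n \<ge> 1" if "n > m" for n
  proof -
    have "real m * \<tau> < real n * \<tau>" using that tau by simp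
    then show "real n * \<tau> \<ge> T\<^sub>J" "real n * \<tau> \<ge> T\<^sub>f" "real n * \<tau> > T\<^sub>\<mu>" "real n * \<tau> > 0" "n \<ge> 1"
      using tm T\<mu> that by auto
  qed
  have Qh_\<mu>: "Qh (\<T> h) (\<mu> (real n * \<tau>)) = ?M" if "n \<ge> m" for n
  proof -
    have "real n * \<tau> \<ge> T\<^sub>\<mu>" using tm that tau by (smt (verit) mult_right_mono of_nat_mono)
    then show ?thesis using T\<mu> \<mu>_late
      by (intro Qh_cong_AE Linf_sym_measurable \<mu>_sym \<mu>inf_sym) auto
  qed
  have Qh_\<mu>t: "Qh (\<T> h) (\<mu>t (real n * \<tau>)) = (\<lambda>x. 0)" if n: "n > m" for n
  proof (rule Qh_eq_0_if_orthogonal_L2)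
    have "\<mu>t (real n * \<tau>) \<in> Linf_sym \<Omega>" using \<mu>t_cont late(4)[OF n] unfolding time_continuous_def by auto
    then show "\<mu>t (real n * \<tau>) \<in> L2 \<Omega>" by (rule Linf_sym_L2[OF \<Omega>_bounded \<Omega>_open])
    show "L2_inner \<Omega> (\<mu>t (real n * \<tau>)) \<rho> = 0" if "\<rho> \<in> L2 \<Omega>" for \<rho>
      by (rule stationary_imp_derivative_0[OF \<Omega>_bounded \<Omega>_open T\<mu> late(3)[OF n] _ \<mu>inf_sym \<mu>t_cont \<mu>_deriv _ that])
         (use \<mu>_sym \<mu>_late T\<mu> in auto)
  qed
  have Qh_f: "Qh (\<T> h) (f (real n * \<tau>)) = (\<lambda>x. 0)" if n: "n > m" for n
  proof -
    have "f (real n * \<tau>) \<in> L2 \<Omega>" using B4 late(4)[OF n] unfolding source_assumption_def time_continuous_def by auto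
    moreover have "AE x in lebesgue_on \<Omega>. f (real n * \<tau>) x = 0" using B4 late(2)[OF n] unfolding source_assumption_def by auto
    ultimately have "Qh (\<T> h) (f (real n * \<tau>)) = Qh (\<T> h) (\<lambda>x. 0)"
      by (intro Qh_cong_AE L2_measurable borel_measurable_const)
    then show ?thesis by (simp add: Qh_0)
  qed
  interpret late_scheme \<Omega> "\<T> h" \<tau> "\<lambda>n. \<epsilon> (real n * \<tau>)" "\<lambda>n u x. ?J x (u x) 0 (real n * \<tau>)" ?bd ?M "\<lambda>n. n > m"
    l "3 * C\<epsilon>" CJ Cb lM \<gamma>
  proof unfold_locales
    show "l * (L2_norm \<Omega> u)\<^sup>2 \<le> L2_inner \<Omega> (\<lambda>x. \<epsilon> (real n * \<tau>) x *v u x) u" if "u \<in> L2 \<Omega>" for n u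
      using tau that by (intro coercive_field_L2_lower \<epsilon>_sym l(2)) auto
    show "L2_norm \<Omega> (\<lambda>x. \<epsilon> (real n * \<tau>) x *v u x) \<le> 3 * C\<epsilon> * L2_norm \<Omega> u" if "m < n" "u \<in> L2 \<Omega>" for n u
      using late(4)[OF that(1)] that(2)
      by (intro matrix_field_apply(2) Linf_sym_measurable \<epsilon>_sym C\<epsilon>) auto
    show "lM * (L2_norm \<Omega> u)\<^sup>2 \<le> L2_inner \<Omega> (\<lambda>x. ?M x *v u x) u" if "u \<in> L2 \<Omega>" for u
      by (intro coercive_field_L2_lower Qh_Linf_sym \<mu>inf_sym that M_coercive)
  qed (use tau l(1) \<epsilon>_sym C\<epsilon>(1) CJ late Cb lM(1) \<gamma> boundary_term_nonneg[OF B3] Qh_Linf_sym[OF \<mu>inf_sym] in auto)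
  obtain c where c: "c > 0" "\<And>m0 E H u. (\<And>n. n > m0 \<Longrightarrow> n > m \<and> step n (E (n - 1), H (n - 1)) (E n, H n)) \<Longrightarrow>
      E m0 \<in> ND \<Omega> (\<T> h) \<Longrightarrow> curl_lift ?M (H m0) u \<Longrightarrow>
      (\<forall>n\<ge>m0. (\<exists>u. curl_lift ?M (H n) u) \<and>
         late_energy n (E n, H n) \<le> exp (- c * (real n * \<tau> - real m0 * \<tau>)) * late_energy m0 (E m0, H m0))"
    using late_energy_decay by blast
  have energy_eq: "\<E> n = late_energy n" if "n \<ge> m" for n
    unfolding \<E>_def energy_def late_energy_def Qh_\<mu>[OF that] ..
  have "\<E> n (E n, H n) \<le> \<E> m (\<lambda>x. 0, Hinf) + exp (- c * (real n * \<tau> - real m * \<tau>)) * \<E> m (E', H')"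
    if init: "(E 0, H 0) \<in> ND \<Omega> (\<T> h) \<times> DG \<Omega> (\<T> h)"
      and rec: "\<And>n. n \<ge> 1 \<Longrightarrow> (E n, H n) = S n (E (n - 1), H (n - 1))"
      and W: "(E', H') \<in> W_space \<Omega> (\<T> h) \<mu>inf" and N: "(\<lambda>x. 0, Hinf) \<in> N_space \<Omega> (\<T> h)"
      and split: "E m = E'" "H m = (\<lambda>x. H' x + Hinf x)" and n: "n \<ge> m + 1"
    for E H :: "nat \<Rightarrow> field3" and E' H' Hinf n
  proof -
    have is_step: "is_step \<Omega> (\<T> h) \<tau> \<epsilon> \<mu> \<mu>t ?J b f (Suc k) (E k, H k) (E (Suc k), H (Suc k))"
      if "(E k, H k) \<in> ND \<Omega> (\<T> h) \<times> DG \<Omega> (\<T> h)" for k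
    proof -
      have "\<exists>!EH. is_step \<Omega> (\<T> h) \<tau> \<epsilon> \<mu> \<mu>t ?J b f (Suc k) (E k, H k) EH"
        using WP that unfolding well_posed_def by auto
      from theI'[OF this] show ?thesis using rec[of "Suc k"] unfolding S_def solution_operator_def by simp
    qed
    have space: "(E k, H k) \<in> ND \<Omega> (\<T> h) \<times> DG \<Omega> (\<T> h)" for k
    proof (induction k)
      case (Suc k)
      then show ?case using is_step[OF Suc] by (auto simp: is_step_def Let_def)
    qed (rule init)
    \<comment> \<open>the magnetic field without its component in \<open>\<N>\<^sub>h\<close>\<close>
    define Hs where "Hs k = (\<lambda>x. H k x - Hinf x)" for k
    have Hsm: "Hs m = H'" by (simp add: Hs_def split)
    have steps: "k > m \<and> step k (E (k - 1), Hs (k - 1)) (E k, Hs k)" if k: "k > m" for k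
    proof -
      have "is_step \<Omega> (\<T> h) \<tau> \<epsilon> \<mu> \<mu>t ?J b f k (E (k - 1), H (k - 1)) (E k, H k)"
        using is_step[OF space, of "k - 1"] k by simp
      then have "step k (E (k - 1), Hs (k - 1)) (E k, Hs k)"
        unfolding Hs_def using space[of "k - 1"] late(1,4)[OF k] Qh_\<mu>[of k] Qh_\<mu>t[OF k] Qh_f[OF k] k N CJ(4)
        by (intro step_if_is_step) auto
      then show ?thesis using k by simp
    qed
    obtain u where u: "curl_lift ?M H' u"
    proof -
      obtain u c where uc: "u \<in> ND \<Omega> (\<T> h)" "has_weak_curl \<Omega> u c" "H' \<in> DG \<Omega> (\<T> h)"
        "AE x in lebesgue_on \<Omega>. H' x = matrix_inv (?M x) *v c x"
        using W unfolding W_space_def by blast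
      have "AE x in lebesgue_on \<Omega>. c x = ?M x *v H' x"
        using uc(4) AE_in_cells by eventually_elim (simp add: Qh_matrix_inv[OF \<mu>inf_sym lM])
      then show ?thesis using that uc unfolding curl_lift_def by blast
    qed
    have "\<forall>n\<ge>m. (\<exists>u. curl_lift ?M (Hs n) u) \<and>
         late_energy n (E n, Hs n) \<le> exp (- c * (real n * \<tau> - real m * \<tau>)) * late_energy m (E m, Hs m)"
      by (rule c(2)[OF steps _ u[folded Hsm]]) (use space in auto)
    then obtain u' where u': "curl_lift ?M (Hs n) u'"
      and le: "late_energy n (E n, Hs n) \<le> exp (- c * (real n * \<tau> - real m * \<tau>)) * late_energy m (E m, Hs m)"
      using n by (meson add_leD1)
    have "\<E> n (E n, H n) = late_energy n (E n, \<lambda>x. Hs n x + Hinf x)"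
      using n by (simp add: energy_eq Hs_def)
    also have "\<dots> = late_energy n (\<lambda>x. 0, Hinf) + late_energy n (E n, Hs n)"
      by (rule late_energy_split[OF _ u' N]) (use space in auto)
    also have "late_energy n (\<lambda>x. 0, Hinf) = \<E> m (\<lambda>x. 0, Hinf)"
      by (simp add: energy_eq late_energy_def L2_inner_def)
    also have "late_energy n (E n, Hs n) \<le> exp (- c * (real n * \<tau> - real m * \<tau>)) * \<E> m (E', H')"
      using le by (simp add: energy_eq Hsm split)
    finally show ?thesis by simp
  qed
  then show ?thesis using c(1) by (intro exI[of _ c]) blast
qed

end
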